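(* Let $\varphi$ be a continuous nowhere-zero function on the unit circle with Fourier coefficients $\varphi_j$ satisfying $\sum_j|j\varphi_j|<\infty$ and winding number $\#(\varphi)$. For $n\in\mathbb Z$ let $\mathcal K_n$ be the integral operator on $L^2(\{|z|=1\},dw)$ with kernel $\mathcal K_n(z,w)=\frac{1-z^n\varphi(z)w^{-n}\varphi(w)^{-1}}{2\pi i(z-w)}$, and let $S$ be the matrix on $\mathbb Z\times\mathbb Z$ with $S(i,j)=\sum_{k\ge1}(\varphi^{-1})_{i+k}\varphi_{-j-k}$. Let $0=n_0\le n_1\le\cdots\le n_k\le n_{k+1}=\infty$ be integers (except $n_{k+1}$), and let $s_1,\dots,s_k\in\mathbb C$ with $s_k\ne-1$ and $s_k-s_j\ne-1$ for all $j$; set $s_0=0$. Then $$\det\Big(1-\sum_{j=1}^k(s_j-s_{j-1})\mathcal K_{n_j}\Big)=(1+s_k)^{\#(\varphi)}\Big[\prod_{j=0}^{k-1}(1+s_k-s_j)^{n_{j+1}-n_j}\Big]\det\Big(1-\Big(\sum_{j=1}^k\frac{s_ks_j}{1+s_k-s_j}\chi_{[n_j,n_{j+1})}\Big)S\Big),$$ where the last determinant is on $\ell^2(\mathbb Z)$ and $\chi_{[a,b)}S$ denotes the operator with matrix entries $S(i,j)$ for $i\in[a,b)$ and $0$ otherwise.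
   Context: $(\varphi^{-1})_l$ are the Fourier coefficients of $1/\varphi$; $(\mathcal K_nf)(z)=\int_{|w|=1}\mathcal K_n(z,w)f(w)dw$; determinants are Fredholm determinants. *)

theory Defs
  imports "HOL-Complex_Analysis.Complex_Analysis"
begin

definition fourier_coeff :: "(complex \<Rightarrow> complex) \<Rightarrow> int \<Rightarrow> complex" where
  "fourier_coeff f j =
     (1 / (2 * of_real pi)) * integral {0..2*pi} (\<lambda>t. f (cis t) * cis (- (of_int j * t)))"

definition wind :: "(complex \<Rightarrow> complex) \<Rightarrow> int" where
  "wind f = (THE m. of_int m = winding_number (f \<circ> circlepath 0 1) 0)"

definition det_fun :: "nat \<Rightarrow> (nat \<Rightarrow> nat \<Rightarrow> complex) \<Rightarrow> complex" where
  "det_fun m M = (\<Sum>p | p permutes {..<m}. of_int (sign p) * (\<Prod>i<m. M i (p i)))"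

text \<open>Fredholm determinant det(1 + A) of the integral operator
  (A f)(z) = \<ointegral>_{|w|=1} A(z,w) f(w) dw  on L^2 of the unit circle,
  given by Fredholm's series
  sum_m 1/m! \<ointegral>...\<ointegral> det[A(z_a,z_b)]_{a,b<m} dz_1...dz_m,
  with z = e^{it}, dz = i e^{it} dt.\<close>
definition fredholm_det_circle :: "(complex \<Rightarrow> complex \<Rightarrow> complex) \<Rightarrow> complex" where
  "fredholm_det_circle A =
     (\<Sum>m. (integral\<^sup>L (Pi\<^sub>M {..<m} (\<lambda>_. lebesgue_on {0..2*pi}))
              (\<lambda>t. det_fun m (\<lambda>a b. A (cis (t a)) (cis (t b))) * (\<Prod>a<m. \<i> * cis (t a))))
           / of_nat (fact m))"

text \<open>Fredholm determinant det(1 + A) on l^2(Z) of the matrix A(i,j), via Fredholm's series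
  sum_m 1/m! sum_{i in Z^m} det[A(i_a,i_b)]_{a,b<m}.\<close>
definition fredholm_det_l2 :: "(int \<Rightarrow> int \<Rightarrow> complex) \<Rightarrow> complex" where
  "fredholm_det_l2 A =
     (\<Sum>m. (\<Sum>\<^sub>\<infinity>i\<in>PiE {..<m} (\<lambda>_. (UNIV :: int set)). det_fun m (\<lambda>a b. A (i a) (i b)))
           / of_nat (fact m))"

definition K_formula :: "(complex \<Rightarrow> complex) \<Rightarrow> int \<Rightarrow> complex \<Rightarrow> complex \<Rightarrow> complex" where
  "K_formula \<phi> n z w =
     (1 - z powi n * \<phi> z * w powi (-n) * inverse (\<phi> w)) / (2 * of_real pi * \<i> * (z - w))"

definition K_kernel :: "(complex \<Rightarrow> complex) \<Rightarrow> int \<Rightarrow> complex \<Rightarrow> complex \<Rightarrow> complex" where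
  "K_kernel \<phi> n z w =
     (if z = w then Lim (at z within sphere 0 1) (\<lambda>w'. K_formula \<phi> n z w')
      else K_formula \<phi> n z w)"

definition S_matrix :: "(complex \<Rightarrow> complex) \<Rightarrow> int \<Rightarrow> int \<Rightarrow> complex" where
  "S_matrix \<phi> i j =
     (\<Sum>k. fourier_coeff (\<lambda>z. inverse (\<phi> z)) (i + int (Suc k)) * fourier_coeff \<phi> (- j - int (Suc k)))"

end

theory Submission
  imports Defs "Jordan_Normal_Form.Determinant"
begin

text \<open>
  Let P be the projection onto the nonnegative frequencies, Q = 1 - P, and P_n the projection onto
  the frequencies at least n; let \<Phi> be multiplication by \<phi> and s = s_k. In the Fourier basis
  K_n = \<Phi> P_n \<Phi>^{-1} - P, so the operator on the left-hand side is
  T = 1 + s P - \<Phi> D \<Phi>^{-1} with D diagonal, equal to s_j on [n_j, n_(j+1)). Put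
  A_l = 1 + (l - 1) Q, A = A_(1+s), B = diag(1 + s - d_i) on the nonnegative frequencies (1 elsewhere),
  S = \<Phi>^{-1} Q \<Phi> and X = s D / (1 + s - D). A direct computation gives
  T = \<Phi> B [A (1 - X S) A^{-1}] [A \<Phi>^{-1} A^{-1} \<Phi>] \<Phi>^{-1}, hence
  det T = det B * det (1 - X S) * F(1 + s) with F(l) = det (A_l \<Phi>^{-1} A_l^{-1} \<Phi>).
  F is multiplicative in l and F'(1) = \<Sum> m \<phi>_m (1/\<phi>)_(-m), which is the winding number
  of \<phi>; therefore F(l) is l to the power of the winding number.
  All perturbations of the identity that occur have absolutely summable matrix entries, so
  multiplicativity of the determinant and det (1 + X Y) = det (1 + Y X) pass to the limit from finite
  sections.
\<close>

section \<open>Finite determinants\<close>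

text \<open>The source of summability is the commutator Q \<Phi> - \<Phi> Q: it lives where row and
  column index have opposite signs, which happens |m| times on the diagonal i - j = m, and this is
  exactly the weight in the hypothesis on \<phi>. For 1/\<phi> only unweighted summability of the
  coefficients is established, so every perturbation is built from this commutator of \<Phi> and
  from finite diagonal matrices by bounded factors. F is multiplicative because A_(l m) = A_l A_m
  and determinants are invariant under conjugation by A_l. A multiplicative function that is
  differentiable at 1 satisfies the differential equation of a power, and the exponent gives a
  single-valued power because it is a winding number. Pairing z^i with w^(-j-1) turns contour
  integrals into index sums, so the Fredholm series on the circle and on the integers agree term by
  term. Absolute row sums and dominated convergence replace the abstract theory of trace-class
  operators.\<close>

definition dets :: "'a set \<Rightarrow> ('a \<Rightarrow> 'a \<Rightarrow> complex) \<Rightarrow> complex" where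
  "dets A M = (\<Sum>p | p permutes A. of_int (sign p) * (\<Prod>i\<in>A. M i (p i)))"

lemma det_fun_eq_dets: "det_fun m M = dets {..<m} M"
  by (simp add: det_fun_def dets_def)

lemma dets_cong:
  assumes "\<And>i j. i \<in> A \<Longrightarrow> j \<in> A \<Longrightarrow> M i j = N i j"
  shows "dets A M = dets A N"
  unfolding dets_def by (intro sum.cong refl arg_cong2[where f="(*)"] prod.cong)
    (auto simp: assms permutes_in_image)

text \<open>Transporting a permutation along \<open>f\<close> by \<open>map_permutation\<close>
  keeps its sign. This is what lets sections indexed by sets of integers borrow results on matrices
  over \<open>{..<n}\<close>.\<close>

lemma dets_image:
  assumes f: "inj_on f A" and A: "finite A"
  shows "dets (f ` A) M = dets A (\<lambda>i j. M (f i) (f j))"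
proof -
  have "(\<Sum>p | p permutes f ` A. of_int (sign p) * (\<Prod>i\<in>f ` A. M i (p i))) =
        (\<Sum>p | p permutes A. of_int (sign p) * (\<Prod>i\<in>A. M (f i) (f (p i))))"
  proof (rule sum.reindex_bij_witness[where i = "map_permutation A f"
        and j = "map_permutation (f ` A) (inv_into A f)"])
    fix p assume "p \<in> {p. p permutes f ` A}"
    then have p: "p permutes f ` A" by simp
    have bij: "bij_betw (inv_into A f) (f ` A) A"
      using f by (simp add: bij_betw_inv_into inj_on_imp_bij_betw)
    show 1: "map_permutation A f (map_permutation (f ` A) (inv_into A f) p) = p"
      using bij p by (intro map_permutation_compose_inv[where A = "f ` A"]) (auto simp: f_inv_into_f)
    show 2: "map_permutation (f ` A) (inv_into A f) p \<in> {p. p permutes A}"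
      using map_permutation_permutes[OF bij p] by simp
    let ?q = "map_permutation (f ` A) (inv_into A f) p"
    have s: "sign ?q = sign p"
      using bij A p by (intro sign_map_permutation) (auto simp: bij_betw_def)
    have "f (?q i) = p (f i)" if "i \<in> A" for i
      using map_permutation_apply[OF f, of i ?q] that by (simp add: 1)
    then show "of_int (sign ?q) * (\<Prod>i\<in>A. M (f i) (f (?q i))) =
        of_int (sign p) * (\<Prod>i\<in>f ` A. M i (p i))"
      by (simp add: s prod.reindex[OF f])
  next
    fix p assume "p \<in> {p. p permutes A}"
    then have p: "p permutes A" by simp
    have bij: "bij_betw f A (f ` A)" using f by (simp add: inj_on_imp_bij_betw)
    show "map_permutation (f ` A) (inv_into A f) (map_permutation A f p) = p"
      using bij p f by (intro map_permutation_compose_inv[where A = "A"]) auto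
    show "map_permutation A f p \<in> {p. p permutes f ` A}"
      using map_permutation_permutes[OF bij p] by simp
  qed
  then show ?thesis by (simp add: dets_def)
qed

lemma det_mat_eq_dets: "Determinant.det (Matrix.mat n n (\<lambda>(i, j). M i j)) = dets {..<n} M"
  unfolding dets_def Determinant.det_def
  by (auto simp: atLeast0LessThan permutes_in_image intro!: sum.cong prod.cong arg_cong2[where f="(*)"])

lemma finite_enum:
  assumes "finite W"
  obtains n :: nat and f where "inj_on f {..<n}" "W = f ` {..<n}"
  using ex_bij_betw_nat_finite[OF assms] by (metis atLeast0LessThan bij_betw_def)

lemma dets_mult:
  assumes "finite W"
  shows "dets W (\<lambda>i j. \<Sum>k\<in>W. A i k * B k j) = dets W A * dets W B"
proof -
  obtain n :: nat and f where f: "inj_on f {..<n}" and W: "W = f ` {..<n}"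
    using finite_enum[OF assms] by blast
  let ?m = "\<lambda>A. Matrix.mat n n (\<lambda>(i, j). A (f i) (f j))"
  have "?m (\<lambda>i j. \<Sum>k\<in>W. A i k * B k j) = ?m A * ?m B"
    by (intro eq_matI) (auto simp: scalar_prod_def W sum.reindex[OF f] atLeast0LessThan intro!: sum.cong)
  then have "Determinant.det (?m (\<lambda>i j. \<Sum>k\<in>W. A i k * B k j)) = Determinant.det (?m A) * Determinant.det (?m B)"
    by (simp add: det_mult[of _ n])
  then show ?thesis
    unfolding det_mat_eq_dets W dets_image[OF f finite_lessThan] .
qed

text \<open>The block matrix \<open>?M\<close> with blocks 1, -a, b, 1 becomes block triangular when
  the unipotent \<open>?U\<close> is multiplied on either side. One product has 1 + a b on its
  diagonal, the other 1 + b a, and \<open>?U\<close> has determinant 1.\<close>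

lemma dets_sylvester:
  assumes "finite W"
  shows "dets W (\<lambda>i j. (if i = j then 1 else 0) + (\<Sum>k\<in>W. A i k * B k j)) =
         dets W (\<lambda>i j. (if i = j then 1 else 0) + (\<Sum>k\<in>W. B i k * A k j))"
proof -
  obtain n :: nat and f where f: "inj_on f {..<n}" and W: "W = f ` {..<n}"
    using finite_enum[OF assms] by blast
  let ?m = "\<lambda>A. Matrix.mat n n (\<lambda>(i, j). A (f i) (f j))"
  let ?a = "?m A" and ?b = "?m B"
  have ca: "?a \<in> carrier_mat n n" "?b \<in> carrier_mat n n" by auto
  let ?M = "four_block_mat (1\<^sub>m n) (- ?a) ?b (1\<^sub>m n)"
  let ?U = "four_block_mat (1\<^sub>m n) ?a (0\<^sub>m n n) (1\<^sub>m n)"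
  have M: "?M \<in> carrier_mat (n + n) (n + n)" and U: "?U \<in> carrier_mat (n + n) (n + n)" by auto
  have detU: "Determinant.det ?U = 1"
    by (subst det_four_block_mat_lower_left_zero[of _ n _ n]) auto
  have UM: "?U * ?M = four_block_mat (1\<^sub>m n + ?a * ?b) (0\<^sub>m n n) ?b (1\<^sub>m n)"
    by (subst mult_four_block_mat[of _ n n _ n _ n _ _ n _ n])
       (use ca in \<open>auto intro!: arg_cong2[where f = "four_block_mat"] eq_matI simp: \<close>)
  have MU: "?M * ?U = four_block_mat (1\<^sub>m n) (0\<^sub>m n n) ?b (1\<^sub>m n + ?b * ?a)"
    by (subst mult_four_block_mat[of _ n n _ n _ n _ _ n _ n])
       (use ca in \<open>auto intro!: eq_matI simp: \<close>)
  have "Determinant.det (1\<^sub>m n + ?a * ?b) = Determinant.det (?U * ?M)"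
    unfolding UM by (subst det_four_block_mat_upper_right_zero[of _ n _ n]) auto
  also have "\<dots> = Determinant.det (?M * ?U)"
    by (simp add: det_mult[OF M U] det_mult[OF U M])
  also have "\<dots> = Determinant.det (1\<^sub>m n + ?b * ?a)"
    unfolding MU by (subst det_four_block_mat_upper_right_zero[of _ n _ n]) auto
  finally have e: "Determinant.det (1\<^sub>m n + ?a * ?b) = Determinant.det (1\<^sub>m n + ?b * ?a)" .
  have *: "1\<^sub>m n + ?m A * ?m B = ?m (\<lambda>i j. (if i = j then 1 else 0) + (\<Sum>k\<in>W. A i k * B k j))" for A B
    by (intro eq_matI) (auto simp: scalar_prod_def W sum.reindex[OF f] atLeast0LessThan inj_onD[OF f] intro!: sum.cong)
  show ?thesis
    using e unfolding * det_mat_eq_dets W dets_image[OF f finite_lessThan] .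
qed

lemma dets_diag:
  assumes "finite W"
  shows "dets W (\<lambda>i j. if i = j then c i else 0) = (\<Prod>i\<in>W. c i)"
proof -
  have "of_int (sign p) * (\<Prod>i\<in>W. if i = p i then c i else 0) = (if p = id then \<Prod>i\<in>W. c i else 0)"
    if "p permutes W" for p
  proof (cases "p = id")
    case False
    then obtain i where "p i \<noteq> i" by (metis eq_id_iff)
    then have "i \<in> W" "i \<noteq> p i" using that by (auto simp: permutes_def)
    then have "(\<Prod>i\<in>W. if i = p i then c i else 0) = 0"
      using assms by (intro prod_zero) auto
    with False show ?thesis by simp
  qed simp
  then have "dets W (\<lambda>i j. if i = j then c i else 0) =
      (\<Sum>p | p permutes W. if p = id then \<Prod>i\<in>W. c i else 0)"
    unfolding dets_def by (intro sum.cong) auto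
  then show ?thesis
    using finite_permutations[OF assms] by (simp add: permutes_id sum.delta')
qed

text \<open>Two equal rows. Hence sums over all index tuples in Fredholm's series only see injective
  ones.\<close>

lemma dets_eq_0_if_not_inj:
  fixes I :: "nat \<Rightarrow> 'b"
  assumes "\<not> inj_on I {..<m}"
  shows "dets {..<m} (\<lambda>a b. C (I a) (I b)) = 0"
proof -
  obtain x y where xy: "x < m" "y < m" "x \<noteq> y" "I x = I y" using assms by (auto simp: inj_on_def)
  show ?thesis
    unfolding det_mat_eq_dets[symmetric]
    by (rule det_identical_rows[where n = m and i = x and j = y]) (use xy in \<open>auto intro!: eq_vecI\<close>)
qed

section \<open>Fredholm determinants as limits of finite sections\<close>

text \<open>Expanding the product over rows chooses a set X of rows that take their entry from C;
  the remaining rows force fixed points, so what is left is the principal minor on X.\<close>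

lemma dets_one_plus:
  assumes W: "finite W"
  shows "dets W (\<lambda>i j. (if i = j then 1 else 0) + C i j) = (\<Sum>J\<in>Pow W. dets J C)"
proof -
  have "dets W (\<lambda>i j. (if i = j then 1 else 0) + C i j) =
      (\<Sum>p | p permutes W. of_int (sign p) *
         (\<Sum>X\<in>Pow W. (\<Prod>i\<in>X. C i (p i)) * (\<Prod>i\<in>W-X. if i = p i then 1 else 0)))"
    unfolding dets_def by (subst add.commute, subst prod_add[OF W]) simp
  also have "\<dots> = (\<Sum>X\<in>Pow W. \<Sum>p | p permutes W. of_int (sign p) *
         ((\<Prod>i\<in>X. C i (p i)) * (\<Prod>i\<in>W-X. if i = p i then 1 else 0)))"
    unfolding sum_distrib_left by (rule sum.swap)
  also have "\<dots> = (\<Sum>X\<in>Pow W. dets X C)"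
  proof (rule sum.cong[OF refl])
    fix X assume "X \<in> Pow W"
    then have X: "X \<subseteq> W" by simp
    \<comment> \<open>A permutation of W that fixes every point off X is the same thing as a
      permutation of X, since permutations are total functions that are the identity outside their
      set.\<close>
    have *: "p permutes X \<longleftrightarrow> p permutes W \<and> (\<forall>i\<in>W-X. i = p i)" for p
      using X permutes_subset[OF _ X] permutes_superset[of p W X] by (force simp: permutes_not_in)
    have "(\<Prod>i\<in>W-X. if i = p i then 1 else (0::complex)) = (if \<forall>i\<in>W-X. i = p i then 1 else 0)" for p
      using W by auto
    then have "(\<Sum>p | p permutes W. of_int (sign p) *
         ((\<Prod>i\<in>X. C i (p i)) * (\<Prod>i\<in>W-X. if i = p i then 1 else 0))) =
       (\<Sum>p | p permutes W. if p permutes X then of_int (sign p) * (\<Prod>i\<in>X. C i (p i)) else 0)"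
      by (intro sum.cong) (simp_all add: *)
    also have "\<dots> = (\<Sum>p \<in> {p. p permutes W} \<inter> {p. p permutes X}. of_int (sign p) * (\<Prod>i\<in>X. C i (p i)))"
      using finite_permutations[OF W] by (simp add: sum.inter_restrict)
    also have "{p. p permutes W} \<inter> {p. p permutes X} = {p. p permutes X}"
      using * by auto
    finally show "(\<Sum>p | p permutes W. of_int (sign p) *
         ((\<Prod>i\<in>X. C i (p i)) * (\<Prod>i\<in>W-X. if i = p i then 1 else 0))) = dets X C"
      by (simp add: dets_def)
  qed
  finally show ?thesis .
qed

text \<open>The factor that cancels 1/m! in Fredholm's series: the enumerations of J are a fixed one
  composed with permutations. The restriction is there because members of \<open>PiE\<close> must be
  \<open>undefined\<close> off their domain.\<close>

lemma card_bij_PiE: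
  assumes "finite J" "card J = m"
  shows "card {I \<in> {..<m} \<rightarrow>\<^sub>E J. inj_on I {..<m} \<and> I ` {..<m} = J} = fact m"
proof -
  obtain f where f: "bij_betw f {..<m} J"
    using ex_bij_betw_nat_finite[OF assms(1)] assms(2) by (auto simp: atLeast0LessThan)
  define g where "g = inv_into {..<m} f"
  have gf: "g (f x) = x" if "x < m" for x
    using that f unfolding g_def by (simp add: bij_betw_def inv_into_f_f)
  have fg: "f (g y) = y" if "y \<in> J" for y
    using that f unfolding g_def by (simp add: bij_betw_def f_inv_into_f)
  have bg: "bij_betw g J {..<m}" unfolding g_def by (rule bij_betw_inv_into[OF f])
  have "bij_betw (\<lambda>p. restrict (f \<circ> p) {..<m}) {p. p permutes {..<m}}
      {I \<in> {..<m} \<rightarrow>\<^sub>E J. inj_on I {..<m} \<and> I ` {..<m} = J}"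
  proof (rule bij_betw_byWitness[where f' = "\<lambda>I x. if x < m then g (I x) else x"])
    show "\<forall>p\<in>{p. p permutes {..<m}}. (\<lambda>x. if x < m then g (restrict (f \<circ> p) {..<m} x) else x) = p"
    proof (intro ballI ext)
      fix p x assume p: "p \<in> {p. p permutes {..<m}}"
      then have "x < m \<Longrightarrow> p x < m" using permutes_in_image[of p "{..<m}" x] by simp
      then show "(if x < m then g (restrict (f \<circ> p) {..<m} x) else x) = p x"
        using p by (auto simp: gf permutes_not_in)
    qed
    show "\<forall>I\<in>{I \<in> {..<m} \<rightarrow>\<^sub>E J. inj_on I {..<m} \<and> I ` {..<m} = J}.
        restrict (f \<circ> (\<lambda>x. if x < m then g (I x) else x)) {..<m} = I"
    proof (intro ballI ext)
      fix I x assume "I \<in> {I \<in> {..<m} \<rightarrow>\<^sub>E J. inj_on I {..<m} \<and> I ` {..<m} = J}"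
      then have I: "I \<in> {..<m} \<rightarrow>\<^sub>E J" by simp
      show "restrict (f \<circ> (\<lambda>x. if x < m then g (I x) else x)) {..<m} x = I x"
        using PiE_mem[OF I, of x] PiE_arb[OF I, of x] by (cases "x < m") (simp_all add: fg)
    qed
    show "(\<lambda>p. restrict (f \<circ> p) {..<m}) ` {p. p permutes {..<m}} \<subseteq>
        {I \<in> {..<m} \<rightarrow>\<^sub>E J. inj_on I {..<m} \<and> I ` {..<m} = J}"
    proof
      fix I assume "I \<in> (\<lambda>p. restrict (f \<circ> p) {..<m}) ` {p. p permutes {..<m}}"
      then obtain p where p: "p permutes {..<m}" and I: "I = restrict (f \<circ> p) {..<m}" by auto
      have "bij_betw (f \<circ> p) {..<m} J"
        using bij_betw_trans[OF permutes_imp_bij[OF p] f] .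
      then have "bij_betw I {..<m} J" unfolding I by (simp add: bij_betw_cong[of _ "restrict (f \<circ> p) {..<m}" "f \<circ> p"])
      then show "I \<in> {I \<in> {..<m} \<rightarrow>\<^sub>E J. inj_on I {..<m} \<and> I ` {..<m} = J}"
        unfolding bij_betw_def by (auto simp: I)
    qed
    show "(\<lambda>I x. if x < m then g (I x) else x) ` {I \<in> {..<m} \<rightarrow>\<^sub>E J. inj_on I {..<m} \<and> I ` {..<m} = J} \<subseteq> {p. p permutes {..<m}}"
    proof
      fix p assume "p \<in> (\<lambda>I x. if x < m then g (I x) else x) ` {I \<in> {..<m} \<rightarrow>\<^sub>E J. inj_on I {..<m} \<and> I ` {..<m} = J}"
      then obtain I where I: "bij_betw I {..<m} J" and p: "p = (\<lambda>x. if x < m then g (I x) else x)"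
        by (auto simp: bij_betw_def)
      have "bij_betw (g \<circ> I) {..<m} {..<m}" by (rule bij_betw_trans[OF I bg])
      then have "bij_betw p {..<m} {..<m}" unfolding p by (subst bij_betw_cong[of _ _ "g \<circ> I"]) auto
      then show "p \<in> {p. p permutes {..<m}}"
        by (intro CollectI bij_imp_permutes) (simp_all add: p)
    qed
  qed
  then show ?thesis
    using bij_betw_same_card card_permutations[of "{..<m}" m] by fastforce
qed

text \<open>Non-injective tuples contribute 0; the injective ones are grouped by their image J, and
  each of the m! orderings gives the same minor.\<close>

lemma sum_dets_PiE:
  assumes W: "finite W"
  shows "(\<Sum>I\<in>{..<m} \<rightarrow>\<^sub>E W. dets {..<m} (\<lambda>a b. C (I a) (I b))) =
         fact m * (\<Sum>J | J \<subseteq> W \<and> card J = m. dets J C)"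
proof -
  let ?P = "{I \<in> {..<m} \<rightarrow>\<^sub>E W. inj_on I {..<m}}" and ?Q = "{J. J \<subseteq> W \<and> card J = m}"
  have fin: "finite ({..<m} \<rightarrow>\<^sub>E W)" using W by (intro finite_PiE) auto
  have "(\<Sum>I\<in>{..<m} \<rightarrow>\<^sub>E W. dets {..<m} (\<lambda>a b. C (I a) (I b))) = (\<Sum>I\<in>?P. dets {..<m} (\<lambda>a b. C (I a) (I b)))"
    using fin by (intro sum.mono_neutral_right) (auto simp: dets_eq_0_if_not_inj)
  also have "\<dots> = (\<Sum>J\<in>?Q. \<Sum>I | I \<in> ?P \<and> I ` {..<m} = J. dets {..<m} (\<lambda>a b. C (I a) (I b)))"
  proof (rule sum.group[symmetric])
    show "finite ?P" by (rule finite_subset[OF _ fin]) blast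
    show "finite ?Q" using W by simp
    show "(\<lambda>I. I ` {..<m}) ` ?P \<subseteq> ?Q"
      by (auto simp: card_image PiE_iff)
  qed
  also have "\<dots> = (\<Sum>J\<in>?Q. fact m * dets J C)"
  proof (rule sum.cong[OF refl])
    fix J assume "J \<in> ?Q"
    then have J: "J \<subseteq> W" "card J = m" "finite J" using W finite_subset by auto
    have "{I. I \<in> ?P \<and> I ` {..<m} = J} = {I \<in> {..<m} \<rightarrow>\<^sub>E J. inj_on I {..<m} \<and> I ` {..<m} = J}"
      using J(1) by (auto simp: PiE_iff)
    then have "card {I. I \<in> ?P \<and> I ` {..<m} = J} = fact m"
      using card_bij_PiE[OF J(3,2)] by simp
    moreover have "dets {..<m} (\<lambda>a b. C (I a) (I b)) = dets J C" if "I \<in> ?P" "I ` {..<m} = J" for I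
      using dets_image[of I "{..<m}" C] that by simp
    ultimately show "(\<Sum>I | I \<in> ?P \<and> I ` {..<m} = J. dets {..<m} (\<lambda>a b. C (I a) (I b))) = fact m * dets J C"
      by (simp add: sum.cong[where h = "\<lambda>_. dets J C"] )
  qed
  finally show ?thesis by (simp add: sum_distrib_left)
qed

text \<open>The finite-dimensional Fredholm series, in the shape that can be compared term by term
  with \<open>fredholm_det_l2\<close>.\<close>

lemma dets_one_plus_PiE:
  assumes W: "finite W"
  shows "dets W (\<lambda>i j. (if i = j then 1 else 0) + C i j) =
    (\<Sum>m\<le>card W. \<Sum>I\<in>{..<m} \<rightarrow>\<^sub>E W. dets {..<m} (\<lambda>a b. C (I a) (I b)) / fact m)"
proof -
  have "(\<Sum>J\<in>Pow W. dets J C) = (\<Sum>m\<le>card W. \<Sum>J | J \<in> Pow W \<and> card J = m. dets J C)"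
    using W by (intro sum.group[symmetric]) (auto intro: card_mono)
  also have "\<dots> = (\<Sum>m\<le>card W. (\<Sum>I\<in>{..<m} \<rightarrow>\<^sub>E W. dets {..<m} (\<lambda>a b. C (I a) (I b))) / fact m)"
    by (intro sum.cong refl) (simp add: sum_dets_PiE[OF W])
  finally show ?thesis by (simp add: dets_one_plus[OF W] sum_divide_distrib)
qed

text \<open>Enlarging the sum over permutations to all self-maps of A makes it factor into row sums.
  This crude bound takes the place of Hadamard's inequality: with the 1/m! it still gives a
  convergent series.\<close>

lemma norm_dets_le:
  assumes A: "finite A"
  shows "norm (dets A M) \<le> (\<Prod>i\<in>A. \<Sum>j\<in>A. norm (M i j))"
proof -
  have "norm (dets A M) \<le> (\<Sum>p | p permutes A. \<Prod>i\<in>A. norm (M i (p i)))"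
    unfolding dets_def
    by (rule order_trans[OF norm_sum], intro sum_mono) (auto simp: norm_mult prod_norm sign_def)
  also have "\<dots> = (\<Sum>p \<in> (\<lambda>p. restrict p A) ` {p. p permutes A}. \<Prod>i\<in>A. norm (M i (p i)))"
  proof (subst sum.reindex)
    show "inj_on (\<lambda>p. restrict p A) {p. p permutes A}"
      by (intro inj_onI ext) (metis mem_Collect_eq permutes_not_in restrict_apply')
  qed auto
  also have "\<dots> \<le> (\<Sum>p\<in>A \<rightarrow>\<^sub>E A. \<Prod>i\<in>A. norm (M i (p i)))"
    using A by (intro sum_mono2 finite_PiE prod_nonneg) (auto simp: permutes_in_image)
  also have "\<dots> = (\<Prod>i\<in>A. \<Sum>j\<in>A. norm (M i j))"
    using A by (simp add: prod_sum_PiE)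
  finally show ?thesis .
qed

lemma norm_minor_le:
  fixes I :: "nat \<Rightarrow> 'b"
  assumes r: "\<And>i F. finite F \<Longrightarrow> (\<Sum>j\<in>F. norm (C i j)) \<le> r i"
  shows "norm (dets {..<m} (\<lambda>a b. C (I a) (I b))) \<le> (\<Prod>a<m. r (I a))"
proof (cases "inj_on I {..<m}")
  case True
  have "norm (dets {..<m} (\<lambda>a b. C (I a) (I b))) \<le> (\<Prod>a<m. \<Sum>b<m. norm (C (I a) (I b)))"
    by (rule norm_dets_le) simp
  also have "\<dots> \<le> (\<Prod>a<m. r (I a))"
  proof (intro prod_mono conjI)
    fix a
    show "(\<Sum>b<m. norm (C (I a) (I b))) \<le> r (I a)"
      using r[of "I ` {..<m}" "I a"] by (simp add: sum.reindex[OF True])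
  qed (auto intro: sum_nonneg)
  finally show ?thesis .
next
  case False
  have "0 \<le> r i" for i using r[of "{}" i] by simp
  \<comment> \<open>With repeated indices a sum over columns would count entries several times and
    could exceed \<open>r\<close>, but then the minor itself is 0.\<close>
  then show ?thesis by (simp add: dets_eq_0_if_not_inj[OF False] prod_nonneg)
qed

lemma PiE_subset_finite:
  assumes "finite F" "F \<subseteq> A \<rightarrow>\<^sub>E (UNIV :: 'b set)" "finite A"
  obtains W where "finite W" "F \<subseteq> A \<rightarrow>\<^sub>E W"
proof
  show "finite (\<Union>I\<in>F. I ` A)" using assms by auto
  show "F \<subseteq> A \<rightarrow>\<^sub>E (\<Union>I\<in>F. I ` A)"
  proof
    fix I assume I: "I \<in> F"
    with assms(2) have "I \<in> extensional A" by (auto simp: PiE_iff)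
    then show "I \<in> A \<rightarrow>\<^sub>E (\<Union>I\<in>F. I ` A)"
      using I unfolding PiE_iff by blast
  qed
qed

lemma sum_PiE_prod_le:
  fixes r :: "'b \<Rightarrow> real"
  assumes r: "r summable_on UNIV" "\<And>i. 0 \<le> r i" and F: "finite F" "F \<subseteq> {..<m} \<rightarrow>\<^sub>E UNIV"
  shows "(\<Sum>I\<in>F. \<Prod>a<m. r (I a)) \<le> infsum r UNIV ^ m"
proof -
  obtain W where W: "finite W" "F \<subseteq> {..<m} \<rightarrow>\<^sub>E W" using PiE_subset_finite[OF F] by auto
  have "(\<Sum>I\<in>F. \<Prod>a<m. r (I a)) \<le> (\<Sum>I\<in>{..<m} \<rightarrow>\<^sub>E W. \<Prod>a<m. r (I a))"
    using W r(2) by (intro sum_mono2 finite_PiE prod_nonneg) auto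
  also have "\<dots> = (\<Prod>a<m. \<Sum>i\<in>W. r i)" using W(1) by (subst prod_sum_PiE) auto
  also have "\<dots> \<le> (\<Prod>a<m. infsum r UNIV)"
    using r W(1) by (intro prod_mono conjI sum_nonneg finite_sum_le_infsum) auto
  finally show ?thesis by simp
qed

text \<open>With R the total of the row bounds, the tuples of length m contribute at most R^m / m!,
  so everything is bounded by exp R.\<close>

lemma summable_fredholm_majorant:
  fixes r :: "'b \<Rightarrow> real"
  assumes r: "r summable_on UNIV" "\<And>i. 0 \<le> r i"
  shows "(\<lambda>(m, I). (\<Prod>a<m. r (I a)) / fact m) summable_on (SIGMA m:UNIV. {..<m} \<rightarrow>\<^sub>E UNIV)"
proof (rule nonneg_bdd_above_summable_on)
  show "0 \<le> (case x of (m, I) \<Rightarrow> (\<Prod>a<m. r (I a)) / fact m)" for x :: "nat \<times> (nat \<Rightarrow> 'b)"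
    using r(2) by (auto intro!: prod_nonneg divide_nonneg_nonneg split: prod.split)
  let ?R = "infsum r UNIV"
  have R: "0 \<le> ?R" by (intro infsum_nonneg r)
  show "bdd_above (sum (\<lambda>(m, I). (\<Prod>a<m. r (I a)) / fact m) ` {F. F \<subseteq> (SIGMA m:UNIV. {..<m} \<rightarrow>\<^sub>E UNIV) \<and> finite F})"
  proof (rule bdd_aboveI2[where M = "exp ?R"])
    fix F :: "(nat \<times> (nat \<Rightarrow> 'b)) set"
    assume "F \<in> {F. F \<subseteq> (SIGMA m:UNIV. {..<m} \<rightarrow>\<^sub>E UNIV) \<and> finite F}"
    then have F: "F \<subseteq> (SIGMA m:UNIV. {..<m} \<rightarrow>\<^sub>E UNIV)" "finite F" by auto
    have eq: "F = (SIGMA m:fst ` F. {I. (m, I) \<in> F})" by force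
    have fin: "finite {I. (m, I) \<in> F}" for m
      by (rule finite_subset[of _ "snd ` F"]) (use F(2) in \<open>auto intro: rev_image_eqI\<close>)
    have "(\<Sum>(m, I)\<in>F. (\<Prod>a<m. r (I a)) / fact m) =
        (\<Sum>m\<in>fst ` F. \<Sum>I | (m, I) \<in> F. (\<Prod>a<m. r (I a)) / fact m)"
      by (subst eq, subst sum.Sigma) (use F(2) fin in auto)
    also have "\<dots> \<le> (\<Sum>m\<in>fst ` F. ?R ^ m / fact m)"
      unfolding sum_divide_distrib[symmetric] using F(1)
      by (intro sum_mono divide_right_mono sum_PiE_prod_le r fin) auto
    also have "\<dots> \<le> (\<Sum>m. ?R ^ m / fact m)"
      using F(2) R summable_exp_generic[of ?R]
      by (intro sum_le_suminf) (auto simp: divide_inverse mult.commute)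
    also have "\<dots> = exp ?R"
      by (simp add: exp_def divide_inverse mult.commute)
    finally show "(\<Sum>(m, I)\<in>F. (\<Prod>a<m. r (I a)) / fact m) \<le> exp ?R" .
  qed
qed

text \<open>Dominated convergence for unordered sums: the M-test makes the finite partial sums
  converge uniformly in the parameter n, which permits exchanging the two limits.\<close>

lemma infsum_dominated_tendsto:
  fixes f :: "'n \<Rightarrow> 'a \<Rightarrow> 'c :: banach"
  assumes lim: "\<And>x. x \<in> A \<Longrightarrow> ((\<lambda>n. f n x) \<longlongrightarrow> g x) F"
    and le: "\<And>n x. x \<in> A \<Longrightarrow> norm (f n x) \<le> M x" and M: "M summable_on A"
    and F: "F \<noteq> bot"
  shows "((\<lambda>n. infsum (f n) A) \<longlongrightarrow> infsum g A) F"
proof (rule swap_uniform_limit'[where S = UNIV and F = "finite_subsets_at_top A"])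
  show "uniform_limit UNIV (\<lambda>X n. \<Sum>x\<in>X. f n x) (\<lambda>n. infsum (f n) A) (finite_subsets_at_top A)"
    by (rule Weierstrass_m_test_general[OF _ M]) (simp add: le)
  show "\<forall>\<^sub>F X in finite_subsets_at_top A. ((\<lambda>n. \<Sum>x\<in>X. f n x) \<longlongrightarrow> sum g X) F"
    by (rule eventually_finite_subsets_at_top_weakI) (auto intro!: tendsto_sum lim)
  have "norm (g x) \<le> M x" if "x \<in> A" for x
    by (rule Lim_norm_ubound[OF F lim[OF that]]) (simp add: le that)
  then have "g summable_on A"
    using Infinite_Sum.abs_summable_on_comparison_test'[OF M] abs_summable_summable by blast
  then show "(sum g \<longlongrightarrow> infsum g A) (finite_subsets_at_top A)"
    using has_sum_infsum has_sum_def by blast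
qed auto

section \<open>Symmetric windows and entrywise summable matrices\<close>

definition win :: "nat \<Rightarrow> int set" where "win N = {- int N..int N}"

lemma finite_win [simp]: "finite (win N)"
  by (simp add: win_def)

text \<open>The windows are cofinal among finite sets, so each unordered sum over the integers is
  the ordinary limit of its symmetric partial sums.\<close>

lemma filterlim_win: "filterlim win (finite_subsets_at_top UNIV) sequentially"
  unfolding filterlim_finite_subsets_at_top
proof safe
  fix X :: "int set" assume X: "finite X"
  have "X \<subseteq> win N" if "N \<ge> nat (Max (insert 0 (abs ` X)))" for N
  proof
    fix x assume "x \<in> X"
    then have "\<bar>x\<bar> \<le> Max (insert 0 (abs ` X))" using X by (intro Max_ge) auto
    then show "x \<in> win N" using that by (auto simp: win_def)
  qed
  then show "\<forall>\<^sub>F N in sequentially. finite (win N) \<and> X \<subseteq> win N \<and> win N \<subseteq> UNIV"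
    by (auto simp: eventually_sequentially)
qed

lemma eventually_mem_win: "eventually (\<lambda>N. i \<in> win N) sequentially"
  using filterlim_win[unfolded filterlim_finite_subsets_at_top, rule_format, of "{i}"]
  by (auto elim: eventually_mono)

lemma has_sum_win: "(f has_sum s) UNIV \<Longrightarrow> (\<lambda>N. sum f (win N)) \<longlonglongrightarrow> s"
  unfolding has_sum_def by (rule filterlim_compose[OF _ filterlim_win])

text \<open>Entrywise summability stands in for the trace class, of which it defines a subspace.\<close>
definition tc :: "(int \<Rightarrow> int \<Rightarrow> complex) \<Rightarrow> bool" where
  "tc A \<longleftrightarrow> (\<lambda>(i, j). A i j) summable_on UNIV"

definition rsum :: "(int \<Rightarrow> int \<Rightarrow> complex) \<Rightarrow> int \<Rightarrow> real" where
  "rsum A i = (\<Sum>\<^sub>\<infinity>j. norm (A i j))"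

lemma tc_abs: "tc A \<longleftrightarrow> (\<lambda>(i, j). norm (A i j)) summable_on UNIV"
  unfolding tc_def by (subst summable_on_iff_abs_summable_on_complex) (simp add: case_prod_unfold)

lemma tc_mono:
  assumes A: "tc A" and le: "\<And>i j. norm (B i j) \<le> norm (A i j)"
  shows "tc B"
  unfolding tc_abs
  by (rule summable_on_comparison_test[OF A[unfolded tc_abs]]) (auto intro: le)

lemma tc_rows:
  assumes "tc A" shows "(\<lambda>j. norm (A i j)) summable_on UNIV" "rsum A summable_on UNIV"
proof -
  have *: "(\<lambda>x. norm (case x of (i, j) \<Rightarrow> A i j)) summable_on UNIV \<times> UNIV"
    using assms unfolding tc_abs by (simp add: case_prod_unfold)
  then show "(\<lambda>j. norm (A i j)) summable_on UNIV"
    unfolding Infinite_Sum.abs_summable_on_Sigma_iff by simp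
  show "rsum A summable_on UNIV"
    using summable_on_Sigma_banach[of "\<lambda>i j. norm (A i j)" UNIV "\<lambda>_. UNIV"] assms
    unfolding tc_abs by (simp add: rsum_def[abs_def])
qed

lemma rsum_nonneg: "0 \<le> rsum A i"
  unfolding rsum_def by (rule infsum_nonneg) simp

lemma rsum_ge:
  assumes "tc A" "finite F" "\<And>j. j \<in> F \<Longrightarrow> norm (B i j) \<le> norm (A i j)"
  shows "(\<Sum>j\<in>F. norm (B i j)) \<le> rsum A i"
proof -
  have "(\<Sum>j\<in>F. norm (B i j)) \<le> (\<Sum>j\<in>F. norm (A i j))" by (intro sum_mono assms)
  also have "\<dots> \<le> rsum A i"
    unfolding rsum_def using tc_rows[OF assms(1)] assms(2) by (intro finite_sum_le_infsum) auto
  finally show ?thesis .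
qed

abbreviation minor_index :: "(nat \<times> (nat \<Rightarrow> int)) set" where
  "minor_index \<equiv> (SIGMA m:UNIV. {..<m} \<rightarrow>\<^sub>E UNIV)"

lemma norm_minor_le_rsum:
  assumes A: "tc A" and le: "\<And>i j. norm (C i j) \<le> norm (A i j)"
  shows "norm (dets {..<m} (\<lambda>a b. C (I a) (I b)) / fact m) \<le> (\<Prod>a<m. rsum A (I a)) / fact m"
proof -
  have "norm (dets {..<m} (\<lambda>a b. C (I a) (I b))) \<le> (\<Prod>a<m. rsum A (I a))"
    by (rule norm_minor_le, rule rsum_ge[OF A]) (simp_all add: le)
  then show ?thesis unfolding norm_divide by (simp add: divide_right_mono)
qed

lemma minor_summable:
  assumes A: "tc A" and le: "\<And>i j. norm (C i j) \<le> norm (A i j)"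
  shows "(\<lambda>(m, I). dets {..<m} (\<lambda>a b. C (I a) (I b)) / fact m) summable_on minor_index"
proof -
  have "(\<lambda>x. norm (case x of (m, I) \<Rightarrow> dets {..<m} (\<lambda>a b. C (I a) (I b)) / fact m)) summable_on minor_index"
    by (rule Infinite_Sum.abs_summable_on_comparison_test'[OF summable_fredholm_majorant[OF tc_rows(2)[OF A] rsum_nonneg]])
       (use norm_minor_le_rsum[OF A le] in \<open>simp add: case_prod_unfold\<close>)
  then show ?thesis by (rule abs_summable_summable)
qed

text \<open>The definition nests an unordered sum inside an ordered series. A single unordered sum
  over pairs (m, I) is the form to which dominated convergence applies.\<close>

lemma fredholm_det_l2_eq_infsum:
  assumes C: "tc C"
  shows "fredholm_det_l2 C = (\<Sum>\<^sub>\<infinity>(m, I)\<in>minor_index. dets {..<m} (\<lambda>a b. C (I a) (I b)) / fact m)"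
proof -
  have s: "(\<lambda>(m, I). dets {..<m} (\<lambda>a b. C (I a) (I b)) / fact m) summable_on minor_index"
    by (rule minor_summable[OF C]) simp
  have "((\<lambda>m. \<Sum>\<^sub>\<infinity>I\<in>{..<m} \<rightarrow>\<^sub>E UNIV. dets {..<m} (\<lambda>a b. C (I a) (I b)) / fact m) has_sum
     (\<Sum>\<^sub>\<infinity>(m, I)\<in>minor_index. dets {..<m} (\<lambda>a b. C (I a) (I b)) / fact m)) UNIV"
    using summable_on_Sigma_banach[OF s] infsum_Sigma'_banach[OF s] by (simp add: has_sum_iff)
  from has_sum_imp_sums[OF this] show ?thesis
    by (simp add: fredholm_det_l2_def det_fun_eq_dets sums_iff divide_inverse infsum_cmult_left')
qed

text \<open>The passage from finite sections to Fredholm determinants. The matrix may itself depend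
  on N, because products will be used with their inner summation truncated to the same window; a
  single summable majorant controls all stages.\<close>

lemma dets_win_tendsto:
  assumes A: "tc A" and le: "\<And>N i j. norm (C N i j) \<le> norm (A i j)"
    and lim: "\<And>i j. (\<lambda>N. C N i j) \<longlonglongrightarrow> B i j"
  shows "(\<lambda>N. dets (win N) (\<lambda>i j. (if i = j then 1 else 0) + C N i j)) \<longlonglongrightarrow> fredholm_det_l2 B"
proof -
  have leB: "norm (B i j) \<le> norm (A i j)" for i j
    by (rule Lim_norm_ubound[OF _ lim]) (auto simp: le)
  have tcB: "tc B"
    by (rule tc_mono[OF A leB])
  \<comment> \<open>Extension by 0 puts all sections on one index set, as dominated convergence
    requires.\<close>
  let ?f = "\<lambda>N (m, I). if I \<in> {..<m} \<rightarrow>\<^sub>E win N then dets {..<m} (\<lambda>a b. C N (I a) (I b)) / fact m else 0"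
  have "dets (win N) (\<lambda>i j. (if i = j then 1 else 0) + C N i j) = infsum (?f N) minor_index" for N
  proof -
    let ?S = "SIGMA m:{..card (win N)}. {..<m} \<rightarrow>\<^sub>E win N"
    have "infsum (?f N) minor_index = infsum (?f N) ?S"
    proof (rule infsum_cong_neutral)
      \<comment> \<open>Tuples longer than the window cannot be injective, so their minors vanish
        and the cutoff at \<open>card (win N)\<close> costs nothing.\<close>
      fix x assume x: "x \<in> minor_index - ?S"
      obtain m I where xe: "x = (m, I)" by (cases x)
      show "?f N x = 0"
      proof (cases "I \<in> {..<m} \<rightarrow>\<^sub>E win N")
        case True
        with x xe have "card (win N) < m" by auto
        then have "\<not> inj_on I {..<m}"
          using card_inj_on_le[of I "{..<m}" "win N"] True by auto
        then show ?thesis using xe by (simp add: dets_eq_0_if_not_inj)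
      qed (use xe in auto)
    qed auto
    also have "\<dots> = sum (?f N) ?S" by (simp add: finite_PiE)
    also have "\<dots> = (\<Sum>m\<le>card (win N). \<Sum>I\<in>{..<m} \<rightarrow>\<^sub>E win N. dets {..<m} (\<lambda>a b. C N (I a) (I b)) / fact m)"
      by (subst sum.Sigma[symmetric]) (auto simp: finite_PiE)
    finally show ?thesis by (simp add: dets_one_plus_PiE)
  qed
  moreover have "(\<lambda>N. infsum (?f N) minor_index) \<longlonglongrightarrow>
      (\<Sum>\<^sub>\<infinity>(m, I)\<in>minor_index. dets {..<m} (\<lambda>a b. B (I a) (I b)) / fact m)"
  proof (rule infsum_dominated_tendsto[OF _ _ summable_fredholm_majorant[OF tc_rows(2)[OF A] rsum_nonneg]])
    fix x assume "x \<in> minor_index"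
    then obtain m I where x: "x = (m, I)" and I: "I \<in> {..<m} \<rightarrow>\<^sub>E UNIV" by auto
    have "eventually (\<lambda>N. \<forall>a\<in>{..<m}. I a \<in> win N) sequentially"
      by (intro eventually_ball_finite) (auto intro: eventually_mem_win)
    then have ev: "eventually (\<lambda>N. dets {..<m} (\<lambda>a b. C N (I a) (I b)) / fact m = ?f N x) sequentially"
      by eventually_elim (use I x in \<open>auto simp: PiE_iff\<close>)
    have "(\<lambda>N. dets {..<m} (\<lambda>a b. C N (I a) (I b)) / fact m) \<longlonglongrightarrow> dets {..<m} (\<lambda>a b. B (I a) (I b)) / fact m"
      unfolding dets_def by (intro tendsto_intros lim) auto
    from Lim_transform_eventually[OF this ev]
    show "(\<lambda>N. ?f N x) \<longlonglongrightarrow> (case x of (m, I) \<Rightarrow> dets {..<m} (\<lambda>a b. B (I a) (I b)) / fact m)"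
      by (simp add: x)
  next
    fix N x assume "x \<in> minor_index"
    show "norm (?f N x) \<le> (case x of (m, I) \<Rightarrow> (\<Prod>a<m. rsum A (I a)) / fact m)"
      using norm_minor_le_rsum[OF A le[of N], of "fst x" "snd x"]
      by (simp add: case_prod_unfold prod_nonneg rsum_nonneg)
  qed (auto simp: rsum_nonneg)
  ultimately show ?thesis by (simp add: fredholm_det_l2_eq_infsum[OF tcB])
qed

lemma norm_minor_sum_le:
  assumes B: "tc B"
  shows "norm (\<Sum>\<^sub>\<infinity>I\<in>{..<m} \<rightarrow>\<^sub>E UNIV. dets {..<m} (\<lambda>a b. B (I a) (I b))) \<le> infsum (rsum B) UNIV ^ m"
proof -
  let ?g = "\<lambda>I. \<Prod>a<m. rsum B (I a)" and ?A = "{..<m} \<rightarrow>\<^sub>E (UNIV :: int set)"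
  let ?f = "\<lambda>I. dets {..<m} (\<lambda>a b. B (I a) (I b))"
  have le: "sum ?g F \<le> infsum (rsum B) UNIV ^ m" if "finite F" "F \<subseteq> ?A" for F
    using that by (intro sum_PiE_prod_le tc_rows(2)[OF B] rsum_nonneg)
  have sg: "?g summable_on ?A"
    using le by (intro nonneg_bdd_above_summable_on) (auto intro!: bdd_aboveI2 prod_nonneg rsum_nonneg)
  have fg: "norm (?f I) \<le> ?g I" for I
    by (rule norm_minor_le, rule rsum_ge[OF B]) simp_all
  have "norm (infsum ?f ?A) \<le> infsum ?g ?A"
    by (rule norm_infsum_le[OF has_sum_infsum[OF abs_summable_summable] has_sum_infsum[OF sg]])
      (use fg in \<open>auto intro: Infinite_Sum.abs_summable_on_comparison_test'[OF sg]\<close>)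
  also have "\<dots> \<le> infsum (rsum B) UNIV ^ m"
    using le by (intro infsum_le_finite_sums sg)
  finally show ?thesis .
qed

text \<open>First-order expansion of det (1 + B), with R the entrywise l1 norm of B: the terms m = 0
  and m = 1 are 1 and the trace, the rest is quadratically small. It serves to differentiate F at
  1.\<close>

lemma fredholm_det_l2_approx:
  assumes B: "tc B"
  shows "norm (fredholm_det_l2 B - 1 - (\<Sum>\<^sub>\<infinity>i. B i i)) \<le>
    (infsum (rsum B) UNIV)\<^sup>2 * exp (infsum (rsum B) UNIV)"
proof -
  define R where "R = infsum (rsum B) UNIV"
  have R: "0 \<le> R" unfolding R_def by (intro infsum_nonneg rsum_nonneg)
  define t where "t m = (\<Sum>\<^sub>\<infinity>I\<in>{..<m} \<rightarrow>\<^sub>E UNIV. dets {..<m} (\<lambda>a b. B (I a) (I b))) / fact m" for m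
  have t: "norm (t m) \<le> R ^ m / fact m" for m
    unfolding t_def R_def norm_divide using norm_minor_sum_le[OF B, of m]
    by (simp add: divide_right_mono)
  have exp: "(\<lambda>m. R ^ m / fact m) sums exp R"
    using exp_converges[of R] by (simp add: divide_inverse mult.commute)
  have st: "summable t"
    by (rule summable_comparison_test'[OF sums_summable[OF exp]]) (use t in auto)
  have t0: "t 0 = 1" by (simp add: t_def dets_def permutes_empty)
  have t1: "t 1 = (\<Sum>\<^sub>\<infinity>i. B i i)"
  proof -
    have "(\<Sum>\<^sub>\<infinity>I\<in>{..<1::nat} \<rightarrow>\<^sub>E UNIV. dets {..<1} (\<lambda>a b. B (I a) (I b))) = (\<Sum>\<^sub>\<infinity>i. B i i)"
    proof (rule infsum_reindex_bij_witness[where j = "\<lambda>I. I 0" and i = "\<lambda>i. \<lambda>a\<in>{..<1::nat}. i"])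
      fix I :: "nat \<Rightarrow> int" assume "I \<in> {..<1} \<rightarrow>\<^sub>E UNIV"
      then show "(\<lambda>a\<in>{..<1}. I 0) = I" by (auto simp: PiE_iff extensional_def fun_eq_iff)
      have "{..<1::nat} = {0}" by auto
      then show "B (I 0) (I 0) = dets {..<1} (\<lambda>a b. B (I a) (I b))"
        by (simp add: dets_def permutes_sing)
    qed auto
    then show ?thesis by (simp add: t_def)
  qed
  have "fredholm_det_l2 B = (\<Sum>m. t m)"
    by (simp add: fredholm_det_l2_def det_fun_eq_dets t_def[abs_def])
  also have "\<dots> = (\<Sum>m. t (m + 2)) + (t 0 + t 1)"
    using suminf_split_initial_segment[OF st, of 2] by (simp add: eval_nat_numeral)
  finally have "fredholm_det_l2 B - 1 - (\<Sum>\<^sub>\<infinity>i. B i i) = (\<Sum>m. t (m + 2))"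
    by (simp add: t0 t1 del: One_nat_def)
  also have "norm \<dots> \<le> (\<Sum>m. R\<^sup>2 * (R ^ m / fact m))"
  proof (rule norm_suminf_le)
    show "summable (\<lambda>m. R\<^sup>2 * (R ^ m / fact m))" by (intro summable_mult sums_summable[OF exp])
    fix m
    have "norm (t (m + 2)) \<le> R ^ (m + 2) / fact (m + 2)" by (rule t)
    \<comment> \<open>Replacing (m + 2)! by m! pulls out R^2 and leaves the full exponential
      series.\<close>
    also have "\<dots> \<le> R ^ (m + 2) / fact m"
      using R by (intro divide_left_mono fact_mono) auto
    finally show "norm (t (m + 2)) \<le> R\<^sup>2 * (R ^ m / fact m)" by (simp add: power_add power2_eq_square algebra_simps)
  qed
  also have "\<dots> = R\<^sup>2 * exp R" using sums_unique[OF sums_mult[OF exp]] by metis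
  finally show ?thesis by (simp add: R_def)
qed

section \<open>Matrices with bounded row and column sums\<close>

lemma has_sum_finite_sum:
  fixes f :: "'b \<Rightarrow> 'a \<Rightarrow> 'c :: topological_comm_monoid_add"
  assumes "finite F" "\<And>j. j \<in> F \<Longrightarrow> (f j has_sum s j) A"
  shows "((\<lambda>x. \<Sum>j\<in>F. f j x) has_sum (\<Sum>j\<in>F. s j)) A"
  using assms by (induction F rule: finite_induct) (auto intro!: has_sum_add)

text \<open>The hypothesis of Schur's test. Quantifying over finite sets states summability of all
  rows and columns and the uniform bound at once.\<close>

definition schur_bound :: "(int \<Rightarrow> int \<Rightarrow> complex) \<Rightarrow> real \<Rightarrow> bool" where
  "schur_bound A C \<longleftrightarrow> (\<forall>i F. finite F \<longrightarrow>
     (\<Sum>j\<in>F. norm (A i j)) \<le> C \<and> (\<Sum>j\<in>F. norm (A j i)) \<le> C)"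

lemma schur_boundD:
  assumes "schur_bound A C"
  shows "finite F \<Longrightarrow> (\<Sum>j\<in>F. norm (A i j)) \<le> C" "finite F \<Longrightarrow> (\<Sum>j\<in>F. norm (A j i)) \<le> C"
    "norm (A i j) \<le> C" "0 \<le> C"
  using assms[unfolded schur_bound_def, rule_format, of F i]
    assms[unfolded schur_bound_def, rule_format, of "{j}" i]
    assms[unfolded schur_bound_def, rule_format, of "{}" i] by auto

lemma schur_bound_row:
  assumes "schur_bound A C"
  shows "(\<lambda>j. norm (A i j)) summable_on UNIV" "(\<Sum>\<^sub>\<infinity>j. norm (A i j)) \<le> C"
proof -
  show *: "(\<lambda>j. norm (A i j)) summable_on UNIV"
    using schur_boundD(1)[OF assms] by (intro nonneg_bdd_above_summable_on) (auto intro!: bdd_aboveI2)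
  show "(\<Sum>\<^sub>\<infinity>j. norm (A i j)) \<le> C"
    using schur_boundD(1)[OF assms] by (intro infsum_le_finite_sums *) auto
qed

lemma schur_bound_row_mult:
  assumes "schur_bound A C" "schur_bound B D"
  shows "(\<lambda>k. norm (A i k) * norm (B k j)) summable_on UNIV" "(\<lambda>k. A i k * B k j) summable_on UNIV"
proof -
  show "(\<lambda>k. norm (A i k) * norm (B k j)) summable_on UNIV"
    by (rule summable_on_comparison_test[OF summable_on_cmult_left[OF schur_bound_row(1)[OF assms(1)], where c = D]])
       (auto intro!: mult_left_mono schur_boundD(3)[OF assms(2)])
  then show "(\<lambda>k. A i k * B k j) summable_on UNIV"
    by (subst summable_on_iff_abs_summable_on_complex) (simp add: norm_mult)
qed

definition mat_mul :: "(int \<Rightarrow> int \<Rightarrow> complex) \<Rightarrow> (int \<Rightarrow> int \<Rightarrow> complex) \<Rightarrow> int \<Rightarrow> int \<Rightarrow> complex" where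
  "mat_mul A B i j = (\<Sum>\<^sub>\<infinity>k. A i k * B k j)"

lemma mat_mul_transpose: "mat_mul (\<lambda>i j. B j i) (\<lambda>i j. A j i) i j = mat_mul A B j i"
  by (simp add: mat_mul_def mult.commute)

lemma mat_mul_row_le:
  assumes A: "schur_bound A C" and B: "schur_bound B D" and F: "finite F"
  shows "(\<Sum>j\<in>F. norm (mat_mul A B i j)) \<le> C * D"
proof -
  note s = schur_bound_row_mult(1)[OF A B]
  have "norm (mat_mul A B i j) \<le> (\<Sum>\<^sub>\<infinity>k. norm (A i k) * norm (B k j))" for j
    unfolding mat_mul_def
    by (rule norm_infsum_le[OF has_sum_infsum[OF schur_bound_row_mult(2)[OF A B]] has_sum_infsum[OF s]])
       (simp add: norm_mult)
  then have "(\<Sum>j\<in>F. norm (mat_mul A B i j)) \<le> (\<Sum>j\<in>F. \<Sum>\<^sub>\<infinity>k. norm (A i k) * norm (B k j))"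
    by (rule sum_mono)
  also have "\<dots> = (\<Sum>\<^sub>\<infinity>k. \<Sum>j\<in>F. norm (A i k) * norm (B k j))"
    by (rule infsumI[symmetric], rule has_sum_finite_sum[OF F], rule has_sum_infsum, rule s)
  also have "\<dots> \<le> (\<Sum>\<^sub>\<infinity>k. norm (A i k) * D)"
  proof (rule infsum_mono)
    show "(\<lambda>k. \<Sum>j\<in>F. norm (A i k) * norm (B k j)) summable_on UNIV"
      by (rule has_sum_imp_summable, rule has_sum_finite_sum[OF F], rule has_sum_infsum, rule s)
    show "(\<lambda>k. norm (A i k) * D) summable_on UNIV"
      by (intro summable_on_cmult_left schur_bound_row(1)[OF A])
    show "(\<Sum>j\<in>F. norm (A i k) * norm (B k j)) \<le> norm (A i k) * D" for k
      unfolding sum_distrib_left[symmetric] by (intro mult_left_mono schur_boundD(1)[OF B F]) simp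
  qed
  also have "\<dots> \<le> C * D"
    unfolding infsum_cmult_left' by (intro mult_right_mono schur_bound_row(2)[OF A] schur_boundD(4)[OF B])
  finally show ?thesis .
qed

lemma schur_bound_mult:
  assumes A: "schur_bound A C" and B: "schur_bound B D"
  shows "schur_bound (mat_mul A B) (C * D)"
  unfolding schur_bound_def
proof (intro allI impI conjI)
  fix i and F :: "int set" assume F: "finite F"
  show "(\<Sum>j\<in>F. norm (mat_mul A B i j)) \<le> C * D" by (rule mat_mul_row_le[OF A B F])
  \<comment> \<open>Column sums of a product are row sums of the product of the transposes in
    reverse order.\<close>
  have "schur_bound (\<lambda>i j. A j i) C" "schur_bound (\<lambda>i j. B j i) D"
    using A B by (auto simp: schur_bound_def)
  from mat_mul_row_le[OF this(2,1) F, of i]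
  show "(\<Sum>j\<in>F. norm (mat_mul A B j i)) \<le> C * D" by (simp add: mat_mul_transpose[of B A] mult.commute)
qed

text \<open>The recurring criterion for Fubini: inner absolute sums bounded by a constant multiple
  of a summable outer family.\<close>

lemma summable_on_pairs:
  fixes f :: "'a \<Rightarrow> 'b \<Rightarrow> complex" and a :: "'a \<Rightarrow> complex"
  assumes a: "a summable_on UNIV" and le: "\<And>k F. finite F \<Longrightarrow> (\<Sum>l\<in>F. norm (f k l)) \<le> norm (a k) * M"
  shows "(\<lambda>(k, l). f k l) summable_on UNIV"
proof (rule abs_summable_summable, rule nonneg_bdd_above_summable_on)
  have an: "(\<lambda>k. norm (a k)) summable_on UNIV"
    using a summable_on_iff_abs_summable_on_complex by auto
  show "bdd_above (sum (\<lambda>x. norm (case x of (k, l) \<Rightarrow> f k l)) ` {F. F \<subseteq> UNIV \<and> finite F})"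
  proof (rule bdd_aboveI2)
    fix F :: "('a \<times> 'b) set" assume "F \<in> {F. F \<subseteq> UNIV \<and> finite F}"
    then have F: "finite F" by simp
    have "sum (\<lambda>x. norm (case x of (k, l) \<Rightarrow> f k l)) F \<le> sum (\<lambda>x. norm (case x of (k, l) \<Rightarrow> f k l)) (fst ` F \<times> snd ` F)"
      using F by (intro sum_mono2) (auto simp: rev_image_eqI)
    also have "\<dots> = (\<Sum>k\<in>fst ` F. \<Sum>l\<in>snd ` F. norm (f k l))"
      by (subst sum.cartesian_product) (auto intro: sum.cong)
    \<comment> \<open>The sign of \<open>M\<close> is not assumed, so its absolute value is used for
      the monotonicity steps.\<close>
    also have "\<dots> \<le> (\<Sum>k\<in>fst ` F. norm (a k) * \<bar>M\<bar>)"
      using F by (intro sum_mono order_trans[OF le] mult_left_mono) auto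
    also have "\<dots> = (\<Sum>k\<in>fst ` F. norm (a k)) * \<bar>M\<bar>" by (simp add: sum_distrib_right)
    also have "\<dots> \<le> (\<Sum>\<^sub>\<infinity>k. norm (a k)) * \<bar>M\<bar>"
      using F by (intro mult_right_mono finite_sum_le_infsum an) auto
    finally show "sum (\<lambda>x. norm (case x of (k, l) \<Rightarrow> f k l)) F \<le> (\<Sum>\<^sub>\<infinity>k. norm (a k)) * \<bar>M\<bar>" .
  qed
qed simp

text \<open>Fubini for the double sum over k and l: the row of A is summable, the rows of B have
  uniformly bounded sums, and the entries of C are bounded.\<close>

lemma mat_mul_assoc:
  assumes A: "schur_bound A a" and B: "schur_bound B b" and C: "schur_bound C c"
  shows "mat_mul (mat_mul A B) C = mat_mul A (mat_mul B C)"
proof (intro ext)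
  fix i j
  have s: "(\<lambda>(k, l). A i k * B k l * C l j) summable_on UNIV"
  proof (rule summable_on_pairs)
    show "(\<lambda>k. A i k) summable_on UNIV"
      using schur_bound_row(1)[OF A] by (rule abs_summable_summable)
    fix k and F :: "int set" assume F: "finite F"
    have "(\<Sum>l\<in>F. norm (A i k * B k l * C l j)) \<le> (\<Sum>l\<in>F. norm (A i k) * (norm (B k l) * c))"
      unfolding norm_mult mult.assoc
      by (intro sum_mono mult_left_mono schur_boundD(3)[OF C]) auto
    also have "\<dots> = norm (A i k) * ((\<Sum>l\<in>F. norm (B k l)) * c)"
      by (simp add: sum_distrib_left sum_distrib_right)
    also have "\<dots> \<le> norm (A i k) * (b * c)"
      by (intro mult_left_mono mult_right_mono schur_boundD(1)[OF B F] schur_boundD(4)[OF C]) auto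
    finally show "(\<Sum>l\<in>F. norm (A i k * B k l * C l j)) \<le> norm (A i k) * (b * c)" .
  qed
  have "mat_mul (mat_mul A B) C i j = (\<Sum>\<^sub>\<infinity>l. \<Sum>\<^sub>\<infinity>k. A i k * B k l * C l j)"
    by (simp add: mat_mul_def infsum_cmult_left')
  also have "\<dots> = (\<Sum>\<^sub>\<infinity>k. \<Sum>\<^sub>\<infinity>l. A i k * B k l * C l j)"
    by (rule infsum_swap_banach[symmetric]) (use s in simp)
  also have "\<dots> = mat_mul A (mat_mul B C) i j"
    by (simp add: mat_mul_def infsum_cmult_right'[symmetric] mult.assoc)
  finally show "mat_mul (mat_mul A B) C i j = mat_mul A (mat_mul B C) i j" .
qed

lemma schur_bound_diag:
  assumes "\<And>i. norm (c i) \<le> C"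
  shows "schur_bound (\<lambda>i j. if i = j then c i else 0) C"
  unfolding schur_bound_def
proof (intro allI impI conjI)
  fix i and F :: "int set" assume F: "finite F"
  have C: "0 \<le> C" using assms[of 0] norm_ge_zero order_trans by blast
  have "(\<Sum>j\<in>F. norm (if i = j then c i else 0)) = (\<Sum>j\<in>F. if i = j then norm (c i) else 0)"
    "(\<Sum>j\<in>F. norm (if j = i then c j else 0)) = (\<Sum>j\<in>F. if i = j then norm (c i) else 0)"
    by (auto intro: sum.cong)
  then show "(\<Sum>j\<in>F. norm (if i = j then c i else 0)) \<le> C" "(\<Sum>j\<in>F. norm (if j = i then c j else 0)) \<le> C"
    using assms[of i] F C by (auto simp: sum.delta)
qed

lemma mat_mul_diag_left: "mat_mul (\<lambda>i j. if i = j then c i else 0) A = (\<lambda>i j. c i * A i j)"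
proof (intro ext)
  fix i j
  have "mat_mul (\<lambda>i j. if i = j then c i else 0) A i j = (\<Sum>\<^sub>\<infinity>k\<in>{i}. c i * A k j)"
    unfolding mat_mul_def by (rule infsum_cong_neutral) auto
  then show "mat_mul (\<lambda>i j. if i = j then c i else 0) A i j = c i * A i j" by simp
qed

lemma mat_mul_diag_right: "mat_mul A (\<lambda>i j. if i = j then c i else 0) = (\<lambda>i j. A i j * c j)"
proof (intro ext)
  fix i j
  have "mat_mul A (\<lambda>i j. if i = j then c i else 0) i j = (\<Sum>\<^sub>\<infinity>k\<in>{j}. A i k * c j)"
    unfolding mat_mul_def by (rule infsum_cong_neutral) auto
  then show "mat_mul A (\<lambda>i j. if i = j then c i else 0) i j = A i j * c j" by simp
qed

lemma schur_bound_add: "schur_bound A C \<Longrightarrow> schur_bound B D \<Longrightarrow> schur_bound (\<lambda>i j. A i j + B i j) (C + D)"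
  unfolding schur_bound_def
  by (intro allI impI conjI)
     (rule order_trans[OF sum_mono[OF norm_triangle_ineq]], simp add: sum.distrib add_mono)+

lemma schur_bound_uminus: "schur_bound A C \<Longrightarrow> schur_bound (\<lambda>i j. - A i j) C"
  by (simp add: schur_bound_def)

text \<open>The ring of matrices with uniformly bounded absolute row and column sums, all of which act
  boundedly on the ideal of entrywise summable matrices.\<close>
typedef schur = "{A. \<exists>C. schur_bound A C}"
  morphisms ent Abs_schur
  by (rule exI[of _ "\<lambda>_ _. 0"]) (auto simp: schur_bound_def intro!: exI[of _ 0])

setup_lifting type_definition_schur

instantiation schur :: ring_1
begin

lift_definition zero_schur :: schur is "\<lambda>_ _. 0"
  by (auto simp: schur_bound_def intro!: exI[of _ 0])

lift_definition one_schur :: schur is "\<lambda>i j. if i = j then 1 else 0"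
  by (rule exI, rule schur_bound_diag[of "\<lambda>_. 1" 1]) simp

lift_definition plus_schur :: "schur \<Rightarrow> schur \<Rightarrow> schur" is "\<lambda>A B i j. A i j + B i j"
  using schur_bound_add by blast

lift_definition uminus_schur :: "schur \<Rightarrow> schur" is "\<lambda>A i j. - A i j"
  using schur_bound_uminus by blast

lift_definition minus_schur :: "schur \<Rightarrow> schur \<Rightarrow> schur" is "\<lambda>A B i j. A i j - B i j"
  using schur_bound_add[OF _ schur_bound_uminus] by fastforce

lift_definition times_schur :: "schur \<Rightarrow> schur \<Rightarrow> schur" is mat_mul
  using schur_bound_mult by blast

instance
proof
  fix a b c :: schur
  show "a * b * c = a * (b * c)" by transfer (auto intro: mat_mul_assoc)
  show "1 * a = a" by transfer (simp add: mat_mul_diag_left)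
  show "a * 1 = a" by transfer (simp add: mat_mul_diag_right)
  show "(a + b) * c = a * c + b * c"
    by transfer (auto simp: mat_mul_def fun_eq_iff distrib_right intro!: infsum_add schur_bound_row_mult(2))
  show "a * (b + c) = a * b + a * c"
    by transfer (auto simp: mat_mul_def fun_eq_iff distrib_left intro!: infsum_add schur_bound_row_mult(2))
  show "(0::schur) \<noteq> 1" by transfer (metis one_neq_zero)
qed (transfer; simp add: fun_eq_iff)+

end

lemma ent_simps [simp]:
  "ent 0 i j = 0" "ent 1 i j = (if i = j then 1 else 0)" "ent (- A) i j = - ent A i j"
  "ent (A + B) i j = ent A i j + ent B i j" "ent (A - B) i j = ent A i j - ent B i j"
  by (simp_all add: zero_schur.rep_eq one_schur.rep_eq plus_schur.rep_eq uminus_schur.rep_eq minus_schur.rep_eq)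

lemma ent_mult: "ent (A * B) i j = (\<Sum>\<^sub>\<infinity>k. ent A i k * ent B k j)"
  by (simp add: times_schur.rep_eq mat_mul_def)

lemma schur_eqI: "(\<And>i j. ent A i j = ent B i j) \<Longrightarrow> A = B"
  by (simp add: ent_inject[symmetric] fun_eq_iff)

lemma ent_mult_summable: "(\<lambda>k. ent A i k * ent B k j) summable_on UNIV"
  using ent[of A] ent[of B] by (auto intro: schur_bound_row_mult(2))

text \<open>Entrywise absolute values. The matrix \<open>sabs A * sabs B\<close> dominates every
  truncation of the sums defining \<open>A * B\<close>, which makes it the majorant for finite
  sections of products.\<close>

lift_definition sabs :: "schur \<Rightarrow> schur" is "\<lambda>A i j. of_real (norm (A i j))"
  by (simp add: schur_bound_def[abs_def])

lemma tc_sabs [simp]: "tc (ent (sabs A)) \<longleftrightarrow> tc (ent A)"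
  by (simp add: tc_abs sabs.rep_eq)

lemma tc_add [simp, intro]: "tc (ent A) \<Longrightarrow> tc (ent B) \<Longrightarrow> tc (ent (A + B))"
  unfolding tc_def using summable_on_add[of "\<lambda>(i, j). ent A i j" UNIV "\<lambda>(i, j). ent B i j"]
  by (simp add: case_prod_unfold)

lemma tc_uminus [simp]: "tc (ent (- A)) \<longleftrightarrow> tc (ent A)"
  by (simp add: tc_abs)

lemma tc_minus [simp, intro]: "tc (ent A) \<Longrightarrow> tc (ent B) \<Longrightarrow> tc (ent (A - B))"
  using tc_add[of A "- B"] by simp

lemma tc_zero [simp, intro]: "tc (ent 0)"
  by (simp add: tc_def case_prod_unfold)

text \<open>The ideal property: in the triple sum over i, k, j, summing over i first meets only a
  column sum of Y, which is bounded, and leaves the summable entries of X. The mirrored lemma uses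
  row sums instead.\<close>

lemma tc_mult_left [simp, intro]:
  assumes X: "tc (ent X)"
  shows "tc (ent (Y * X))"
proof -
  obtain C where C: "schur_bound (ent Y) C" using ent[of Y] by auto
  have "(\<lambda>(p, i). ent Y i (fst p) * ent X (fst p) (snd p)) summable_on UNIV"
  proof (rule summable_on_pairs)
    show "(\<lambda>p. ent X (fst p) (snd p)) summable_on UNIV" using X by (simp add: tc_def case_prod_unfold)
    fix p :: "int \<times> int" and F :: "int set" assume F: "finite F"
    show "(\<Sum>i\<in>F. norm (ent Y i (fst p) * ent X (fst p) (snd p))) \<le> norm (ent X (fst p) (snd p)) * C"
      unfolding norm_mult sum_distrib_right[symmetric]
      by (subst mult.commute) (intro mult_left_mono schur_boundD(2)[OF C F], simp)
  qed
  then have "(\<lambda>(p, k). ent Y (fst p) k * ent X k (snd p)) summable_on UNIV \<times> UNIV"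
    by (subst summable_on_reindex_bij_witness[where T = UNIV
        and j = "\<lambda>((i, j), k). ((k, j), i)" and i = "\<lambda>((k, j), i). ((i, j), k)"
        and h = "\<lambda>(p, i). ent Y i (fst p) * ent X (fst p) (snd p)"]) auto
  from summable_on_Sigma_banach[OF this] show ?thesis
    by (simp add: tc_def ent_mult case_prod_unfold)
qed

lemma tc_mult_right [simp, intro]:
  assumes X: "tc (ent X)"
  shows "tc (ent (X * Y))"
proof -
  obtain C where C: "schur_bound (ent Y) C" using ent[of Y] by auto
  have "(\<lambda>(p, j). ent X (fst p) (snd p) * ent Y (snd p) j) summable_on UNIV"
  proof (rule summable_on_pairs)
    show "(\<lambda>p. ent X (fst p) (snd p)) summable_on UNIV" using X by (simp add: tc_def case_prod_unfold)
    fix p :: "int \<times> int" and F :: "int set" assume F: "finite F"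
    show "(\<Sum>j\<in>F. norm (ent X (fst p) (snd p) * ent Y (snd p) j)) \<le> norm (ent X (fst p) (snd p)) * C"
      unfolding norm_mult sum_distrib_left[symmetric]
      by (intro mult_left_mono schur_boundD(1)[OF C F], simp)
  qed
  then have "(\<lambda>(p, k). ent X (fst p) k * ent Y k (snd p)) summable_on UNIV \<times> UNIV"
    by (subst summable_on_reindex_bij_witness[where T = UNIV
        and j = "\<lambda>((i, j), k). ((i, k), j)" and i = "\<lambda>((i, k), j). ((i, j), k)"
        and h = "\<lambda>(p, j). ent X (fst p) (snd p) * ent Y (snd p) j"]) auto
  from summable_on_Sigma_banach[OF this] show ?thesis
    by (simp add: tc_def ent_mult case_prod_unfold)
qed

section \<open>Determinants of summable perturbations of the identity\<close>

definition det1 :: "schur \<Rightarrow> complex" where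
  "det1 U = fredholm_det_l2 (ent (U - 1))"

abbreviation tc1 :: "schur \<Rightarrow> bool" where "tc1 U \<equiv> tc (ent (U - 1))"

lemma norm_partial_mult_le:
  "norm (\<Sum>k\<in>win N. ent A i k * ent B k j) \<le> Re (ent (sabs A * sabs B) i j)"
proof -
  have s: "(\<lambda>k. norm (ent A i k) * norm (ent B k j)) summable_on UNIV"
    using ent[of A] ent[of B] by (auto intro: schur_bound_row_mult(1))
  have "norm (\<Sum>k\<in>win N. ent A i k * ent B k j) \<le> (\<Sum>k\<in>win N. norm (ent A i k) * norm (ent B k j))"
    by (rule order_trans[OF norm_sum]) (simp add: norm_mult)
  also have "\<dots> \<le> (\<Sum>\<^sub>\<infinity>k. norm (ent A i k) * norm (ent B k j))"
    using s by (intro finite_sum_le_infsum) auto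
  also have "\<dots> = Re (ent (sabs A * sabs B) i j)"
    using infsumI[OF has_sum_of_real[OF has_sum_infsum[OF s], where 'a = complex]]
    by (simp add: ent_mult sabs.rep_eq)
  finally show ?thesis .
qed

lemma norm_le_of_Re: "x \<le> Re z \<Longrightarrow> x \<le> norm z"
  using complex_Re_le_cmod order_trans by blast

text \<open>A section of a product is not the product of the sections. Truncating the inner sum to
  the same window makes the finite identity exact at every N, and the truncated matrices still
  converge entrywise under one summable majorant.\<close>

lemma det1_mult:
  assumes U: "tc1 U" and V: "tc1 V"
  shows "det1 (U * V) = det1 U * det1 V"
proof -
  define A where "A = U - 1"
  define B where "B = V - 1"
  have tc: "tc (ent A)" "tc (ent B)" using U V by (simp_all add: A_def B_def)
  have UV: "U * V - 1 = A + B + A * B" by (simp add: A_def B_def algebra_simps)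
  let ?W = "\<lambda>C N. dets (win N) (\<lambda>i j. (if i = j then 1 else 0) + C i j)"
  have "?W (\<lambda>i j. ent A i j + ent B i j + (\<Sum>k\<in>win N. ent A i k * ent B k j)) N = ?W (ent A) N * ?W (ent B) N" for N
  proof -
    have "(\<Sum>k\<in>win N. ((if i = k then 1 else 0) + ent A i k) * ((if k = j then 1 else 0) + ent B k j)) =
        (if i = j then 1 else 0) + (ent A i j + ent B i j + (\<Sum>k\<in>win N. ent A i k * ent B k j))"
      if "i \<in> win N" "j \<in> win N" for i j
    proof -
      have "(\<Sum>k\<in>win N. ((if i = k then 1 else 0) + ent A i k) * ((if k = j then 1 else 0) + ent B k j)) =
        (\<Sum>k\<in>win N. (if i = k then (if k = j then 1 else 0) + ent B k j else 0) +
           (if k = j then ent A i k else 0) + ent A i k * ent B k j)"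
        by (intro sum.cong) (auto simp: algebra_simps)
      also have "\<dots> = ((if i = j then 1 else 0) + ent B i j) + ent A i j + (\<Sum>k\<in>win N. ent A i k * ent B k j)"
        using that by (simp add: sum.distrib sum.delta sum.delta')
      finally show ?thesis by simp
    qed
    then show ?thesis
      unfolding dets_mult[OF finite_win, symmetric] by (intro dets_cong) simp
  qed
  moreover have "(\<lambda>N. ?W (\<lambda>i j. ent A i j + ent B i j + (\<Sum>k\<in>win N. ent A i k * ent B k j)) N)
      \<longlonglongrightarrow> fredholm_det_l2 (ent (U * V - 1))"
  proof (rule dets_win_tendsto)
    show "tc (ent (sabs A + sabs B + sabs A * sabs B))" using tc by simp
    fix i j
    show "norm (ent A i j + ent B i j + (\<Sum>k\<in>win N. ent A i k * ent B k j))
        \<le> norm (ent (sabs A + sabs B + sabs A * sabs B) i j)" for N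
    proof (rule norm_le_of_Re)
      have "norm (ent A i j + ent B i j + (\<Sum>k\<in>win N. ent A i k * ent B k j)) \<le>
          norm (ent A i j) + norm (ent B i j) + norm (\<Sum>k\<in>win N. ent A i k * ent B k j)"
        by (meson add_right_mono norm_triangle_ineq order_trans)
      then show "norm (ent A i j + ent B i j + (\<Sum>k\<in>win N. ent A i k * ent B k j))
        \<le> Re (ent (sabs A + sabs B + sabs A * sabs B) i j)"
        using norm_partial_mult_le[of A i B j N] by (simp add: sabs.rep_eq)
    qed
    show "(\<lambda>N. ent A i j + ent B i j + (\<Sum>k\<in>win N. ent A i k * ent B k j)) \<longlonglongrightarrow> ent (U * V - 1) i j"
      unfolding UV ent_simps ent_mult
      by (intro tendsto_intros has_sum_win has_sum_infsum ent_mult_summable)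
  qed
  moreover have "(\<lambda>N. ?W (ent A) N * ?W (ent B) N) \<longlonglongrightarrow> det1 U * det1 V"
    unfolding det1_def A_def[symmetric] B_def[symmetric]
    by (intro tendsto_mult dets_win_tendsto[of "ent A"] dets_win_tendsto[of "ent B"] tc) auto
  ultimately show ?thesis
    unfolding det1_def[of "U * V"] using LIMSEQ_unique by fastforce
qed

text \<open>Sylvester's identity on windows, passed to the limit. Only one factor is summable; the
  other is any matrix with bounded row and column sums, as is needed to conjugate by operators far
  from the identity.\<close>

lemma fredholm_det_l2_mult_commute:
  assumes Y: "tc (ent Y)"
  shows "fredholm_det_l2 (ent (X * Y)) = fredholm_det_l2 (ent (Y * X))"
proof -
  have lim: "(\<lambda>N. dets (win N) (\<lambda>i j. (if i = j then 1 else 0) + (\<Sum>k\<in>win N. ent A i k * ent B k j)))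
      \<longlonglongrightarrow> fredholm_det_l2 (ent (A * B))" if "tc (ent (sabs A * sabs B))" for A B
  proof (rule dets_win_tendsto[OF that])
    fix i j
    show "norm (\<Sum>k\<in>win N. ent A i k * ent B k j) \<le> norm (ent (sabs A * sabs B) i j)" for N
      by (rule norm_le_of_Re[OF norm_partial_mult_le])
    show "(\<lambda>N. \<Sum>k\<in>win N. ent A i k * ent B k j) \<longlonglongrightarrow> ent (A * B) i j"
      unfolding ent_mult by (intro has_sum_win has_sum_infsum ent_mult_summable)
  qed
  show ?thesis
    using lim[of X Y] lim[of Y X] Y dets_sylvester[OF finite_win, of _ "ent X" "ent Y"]
    by (auto intro: LIMSEQ_unique)
qed

text \<open>The difference from 1 is X ((U - 1) Y), with the bracket summable, so X can be moved
  cyclically to the right, where it cancels Y.\<close>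

lemma det1_conj:
  assumes "tc1 U" "X * Y = 1" "Y * X = 1"
  shows "det1 (X * U * Y) = det1 U" "tc1 (X * U * Y)"
proof -
  have *: "X * U * Y - 1 = X * ((U - 1) * Y)" using assms(2) by (simp add: algebra_simps)
  have "(U - 1) * Y * X = U - 1" using assms(3) by (simp add: mult.assoc)
  then show "det1 (X * U * Y) = det1 U"
    unfolding det1_def * using assms(1) by (subst fredholm_det_l2_mult_commute) auto
  show "tc1 (X * U * Y)" unfolding * using assms(1) by simp
qed

lemma tc1_mult [simp, intro]: "tc1 U \<Longrightarrow> tc1 V \<Longrightarrow> tc1 (U * V)"
proof -
  assume "tc1 U" "tc1 V"
  then have "tc (ent ((U - 1) + (V - 1) + (U - 1) * (V - 1)))" by simp
  moreover have "(U - 1) + (V - 1) + (U - 1) * (V - 1) = U * V - 1"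
    by (simp add: ring_distribs)
  ultimately show "tc1 (U * V)" by simp
qed

section \<open>Multiplication operators and the conjugated determinant\<close>

text \<open>The guard makes the lift total: an unbounded sequence yields the zero matrix, and all
  lemmas assume boundedness.\<close>

lift_definition diag_op :: "(int \<Rightarrow> complex) \<Rightarrow> schur" is
  "\<lambda>c i j. if i = j then (if bounded (range c) then c i else 0) else 0"
proof -
  fix c :: "int \<Rightarrow> complex"
  obtain C where "norm (if bounded (range c) then c i else 0) \<le> C" for i
  proof (cases "bounded (range c)")
    case True
    then obtain C where "norm (c i) \<le> C" for i by (auto simp: bounded_iff)
    with True show ?thesis using that[of C] by simp
  next
    case False
    then show ?thesis using that[of 0] by simp
  qed
  from schur_bound_diag[OF this]
  show "\<exists>C. schur_bound (\<lambda>i j. if i = j then (if bounded (range c) then c i else 0) else 0) C" ..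
qed

lemma ent_diag_op: "bounded (range c) \<Longrightarrow> ent (diag_op c) i j = (if i = j then c i else 0)"
  by transfer simp

lemma ent_diag_op_mult:
  assumes "bounded (range c)"
  shows "ent (diag_op c * A) i j = c i * ent A i j" "ent (A * diag_op c) i j = ent A i j * c j"
  using assms by (transfer, simp add: mat_mul_diag_left mat_mul_diag_right)+

text \<open>Multiplication by the function with Fourier coefficients \<open>f\<close>, written in
  the basis of powers of z: column j is \<open>f\<close> shifted by j. A sequence that is not
  summable yields the zero matrix.\<close>

lift_definition laurent :: "(int \<Rightarrow> complex) \<Rightarrow> schur" is
  "\<lambda>f i j. if f summable_on UNIV then f (i - j) else 0"
proof -
  fix f :: "int \<Rightarrow> complex"
  show "\<exists>C. schur_bound (\<lambda>i j. if f summable_on UNIV then f (i - j) else 0) C"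
  proof (cases "f summable_on UNIV")
    case True
    then have s: "(\<lambda>x. norm (f x)) summable_on UNIV"
      using summable_on_iff_abs_summable_on_complex by auto
    have *: "(\<Sum>j\<in>F. norm (f (h j))) \<le> (\<Sum>\<^sub>\<infinity>x. norm (f x))" if "finite F" "inj h" for F and h :: "int \<Rightarrow> int"
    proof -
      have "(\<Sum>j\<in>F. norm (f (h j))) = (\<Sum>x\<in>h ` F. norm (f x))"
        using that by (simp add: sum.reindex inj_on_subset)
      then show ?thesis using that s by (simp add: finite_sum_le_infsum)
    qed
    show ?thesis
    proof
      show "schur_bound (\<lambda>i j. if f summable_on UNIV then f (i - j) else 0) (\<Sum>\<^sub>\<infinity>x. norm (f x))"
        unfolding schur_bound_def using True by (auto intro!: * injI)
    qed
  qed (auto simp: schur_bound_def intro!: exI[of _ 0])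
qed

lemma ent_laurent: "f summable_on UNIV \<Longrightarrow> ent (laurent f) i j = f (i - j)"
  by transfer simp

lemma laurent_mult_eq_1:
  assumes "f summable_on UNIV" "g summable_on UNIV"
    and conv: "\<And>m. (\<Sum>\<^sub>\<infinity>l. f (m - l) * g l) = (if m = 0 then 1 else 0)"
  shows "laurent f * laurent g = 1"
proof (rule schur_eqI)
  fix i j
  have "ent (laurent f * laurent g) i j = (\<Sum>\<^sub>\<infinity>k. f (i - k) * g (k - j))"
    by (simp add: ent_mult ent_laurent assms)
  also have "\<dots> = (\<Sum>\<^sub>\<infinity>l. f ((i - j) - l) * g l)"
    by (rule infsum_reindex_bij_witness[where j = "\<lambda>k. k - j" and i = "\<lambda>l. l + j"]) auto
  finally show "ent (laurent f * laurent g) i j = ent 1 i j" by (simp add: conv)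
qed

text \<open>One source for the boundedness of all diagonals derived from a step function: such a
  diagonal is a function of the sign of i and of the finitely many values of
  \<open>d\<close>.\<close>

lemma bounded_range_sign:
  assumes "finite (range d)"
  shows "bounded (range (\<lambda>i :: int. h (i < 0) (d i) :: complex))"
proof -
  have "range (\<lambda>i. h (i < 0) (d i)) \<subseteq> (\<lambda>(b, x). h b x) ` (UNIV \<times> range d)" by auto
  then show ?thesis
    using assms by (intro finite_imp_bounded) (auto elim!: finite_subset)
qed

lemma bounded_const_image [simp]: "bounded ((\<lambda>_. c) ` A)"
  by (rule bounded_subset[of "{c}"]) auto

lemma bounded_range_sign0: "bounded (range (\<lambda>i :: int. if i < 0 then (x :: complex) else y))"
  by (rule finite_imp_bounded, rule finite_subset[of _ "{x, y}"]) auto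

lemma bounded_range_const: "bounded (range (\<lambda>i :: int. x :: complex))"
  by simp

lemma diag_op_mult:
  assumes "bounded (range c)" "bounded (range d)"
  shows "diag_op c * diag_op d = diag_op (\<lambda>i. c i * d i)"
proof (rule schur_eqI)
  obtain C D where "norm (c i) \<le> C" "norm (d i) \<le> D" for i
    using assms by (auto simp: bounded_iff)
  then have "norm (c i * d i) \<le> C * D" for i
    unfolding norm_mult by (meson mult_mono norm_ge_zero order_trans)
  then have "bounded (range (\<lambda>i. c i * d i))" by (auto simp: bounded_iff)
  then show "ent (diag_op c * diag_op d) i j = ent (diag_op (\<lambda>i. c i * d i)) i j" for i j
    using assms by (simp add: ent_diag_op_mult ent_diag_op)
qed

lemma diag_op_const_commute: "diag_op (\<lambda>_. x) * A = A * diag_op (\<lambda>_. x)"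
  by (rule schur_eqI) (simp add: ent_diag_op_mult mult.commute)

lemma diag_op_1: "diag_op (\<lambda>_. 1) = 1"
  by (rule schur_eqI) (simp add: ent_diag_op)

lemma det1_diag_op_finite:
  assumes fin: "finite {i. c i \<noteq> 1}"
  shows "tc1 (diag_op c)" "det1 (diag_op c) = (\<Prod>i | c i \<noteq> 1. c i)"
proof -
  let ?S = "{i. c i \<noteq> 1}"
  have "range c \<subseteq> insert 1 (c ` ?S)" by auto
  then have b: "bounded (range c)"
    using fin by (meson finite_imageI finite_imp_bounded finite_insert finite_subset)
  have e: "ent (diag_op c - 1) i j = (if i = j then c i - 1 else 0)" for i j
    by (simp add: ent_diag_op b)
  have "finite ((\<lambda>i. (i, i)) ` ?S)" using fin by simp
  then show tc: "tc1 (diag_op c)"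
    unfolding tc_def
    by (rule finite_nonzero_values_imp_summable_on[OF finite_subset[rotated]]) (auto simp: e simp del: ent_simps split: if_splits)
  have "(\<lambda>N. dets (win N) (\<lambda>i j. (if i = j then 1 else 0) + ent (diag_op c - 1) i j)) \<longlonglongrightarrow> det1 (diag_op c)"
    unfolding det1_def by (rule dets_win_tendsto[OF tc]) auto
  moreover have "dets (win N) (\<lambda>i j. (if i = j then 1 else 0) + ent (diag_op c - 1) i j) = (\<Prod>i\<in>win N. c i)" for N
    by (subst dets_diag[symmetric]) (auto simp: e simp del: ent_simps intro!: dets_cong)
  ultimately have lim: "(\<lambda>N. \<Prod>i\<in>win N. c i) \<longlonglongrightarrow> det1 (diag_op c)" by simp
  have "eventually (\<lambda>N. \<forall>i\<in>?S. i \<in> win N) sequentially"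
    using fin by (intro eventually_ball_finite) (auto intro: eventually_mem_win)
  then have "eventually (\<lambda>N. (\<Prod>i\<in>?S. c i) = (\<Prod>i\<in>win N. c i)) sequentially"
    by eventually_elim (rule prod.mono_neutral_left, auto)
  from Lim_transform_eventually[OF tendsto_const this] lim
  show "det1 (diag_op c) = (\<Prod>i | c i \<noteq> 1. c i)"
    by (rule LIMSEQ_unique[symmetric])
qed

section \<open>The commutator determinant F\<close>

definition scale_neg :: "complex \<Rightarrow> schur" where
  "scale_neg l = diag_op (\<lambda>i. if i < 0 then l else 1)"

text \<open>This is Q; the preceding \<open>scale_neg l\<close> is A_l.\<close>

definition proj_neg :: schur where "proj_neg = diag_op (\<lambda>i. if i < 0 then 1 else 0)"

lemma scale_neg_mult: "scale_neg l * scale_neg m = scale_neg (l * m)"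
  unfolding scale_neg_def diag_op_mult[OF bounded_range_sign0 bounded_range_sign0]
  by (intro arg_cong[where f = diag_op]) auto

lemma scale_neg_1: "scale_neg 1 = 1"
  by (simp add: scale_neg_def diag_op_1)

lemma scale_neg_inverse: "l \<noteq> 0 \<Longrightarrow> scale_neg l * scale_neg (1 / l) = 1" "l \<noteq> 0 \<Longrightarrow> scale_neg (1 / l) * scale_neg l = 1"
  by (simp_all add: scale_neg_mult scale_neg_1)

text \<open>The sequences f and g are the Fourier coefficients of a symbol and of its inverse.\<close>
locale symbol_pair =
  fixes f g :: "int \<Rightarrow> complex"
  assumes f: "f summable_on UNIV" and g: "g summable_on UNIV"
    and wf: "(\<lambda>m. of_int m * f m) summable_on UNIV"
    and conv: "\<And>m. (\<Sum>\<^sub>\<infinity>l. f (m - l) * g l) = (if m = 0 then 1 else 0)"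
    and conv': "\<And>m. (\<Sum>\<^sub>\<infinity>l. g (m - l) * f l) = (if m = 0 then 1 else 0)"
begin

definition "Phi = laurent f"
definition "Phii = laurent g"
text \<open>The commutator of Q with \<Phi>. It consists of the two off-diagonal corners of the
  matrix of \<Phi>, which become Hankel matrices after a reflection of one index.\<close>

definition "hankel = proj_neg * Phi - Phi * proj_neg"

lemma inv [simp]: "Phi * Phii = 1" "Phii * Phi = 1"
  unfolding Phi_def Phii_def by (intro laurent_mult_eq_1 f g conv conv')+

lemma inv' [simp]: "Phi * (Phii * X) = X" "Phii * (Phi * X) = X"
  by (simp_all add: mult.assoc[symmetric])

lemma ent_hankel: "ent hankel i j = ((if i < 0 then 1 else 0) - (if j < 0 then 1 else 0)) * f (i - j)"
  unfolding hankel_def proj_neg_def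
  by (simp add: ent_diag_op_mult[OF bounded_range_sign0] Phi_def ent_laurent[OF f] algebra_simps)

text \<open>The columns in which the diagonal i - j = m meets a corner of the commutator. There are
  |m| of them, the origin of the weight on the Fourier coefficients.\<close>

lemma sign_change:
  shows "{j. (m + j < 0) \<noteq> (j < (0::int))} = (if m \<ge> 0 then {-m..<0} else {0..<-m})"
  by auto

text \<open>Summing along diagonals, the entries with i - j = m contribute at most |m| copies of |f
  m|.\<close>

lemma tc_hankel: "tc (ent hankel)"
proof -
  have "(\<lambda>(m, j). ent hankel (m + j) j) summable_on UNIV"
  proof (rule summable_on_pairs[OF wf, where M = 1])
    fix m :: int and F :: "int set" assume F: "finite F"
    let ?S = "{j. (m + j < 0) \<noteq> (j < (0::int))}"
    have S: "finite ?S" "card ?S = nat \<bar>m\<bar>" unfolding sign_change by auto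
    have "(\<Sum>j\<in>F. norm (ent hankel (m + j) j)) = (\<Sum>j\<in>F. if j \<in> ?S then norm (f m) else 0)"
      by (intro sum.cong) (auto simp: ent_hankel norm_mult)
    also have "\<dots> = (\<Sum>j\<in>F \<inter> ?S. norm (f m))"
      by (rule sum.inter_restrict[OF F, symmetric])
    also have "\<dots> \<le> (\<Sum>j\<in>?S. norm (f m))"
      using S by (intro sum_mono2) auto
    also have "\<dots> = norm (of_int m * f m) * 1"
      unfolding sum_constant S(2) by (simp add: norm_mult)
    finally show "(\<Sum>j\<in>F. norm (ent hankel (m + j) j)) \<le> norm (of_int m * f m) * 1" .
  qed
  then show ?thesis
    unfolding tc_def
    by (subst summable_on_reindex_bij_witness[where T = UNIV
        and j = "\<lambda>(i, j). (i - j, j)" and i = "\<lambda>(m, j). (m + j, j)"]) auto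
qed

text \<open>Since \<open>scale_neg (1 / l)\<close> is 1 + (1/l - 1) Q, only the commutator with Q
  survives.\<close>

lemma scale_neg_comm:
  assumes "l \<noteq> 0"
  shows "scale_neg (1 / l) * Phi - Phi * scale_neg (1 / l) = diag_op (\<lambda>_. 1 / l - 1) * hankel"
  by (rule schur_eqI)
     (simp add: scale_neg_def ent_diag_op_mult bounded_range_sign0 ent_hankel Phi_def ent_laurent f algebra_simps)

text \<open>The determinant of this multiplicative commutator is F(l). The grouping is what makes it
  a summable perturbation of 1, which its factors need not be.\<close>

definition "scale_comm l = scale_neg l * Phii * scale_neg (1 / l) * Phi"

lemma scale_comm_minus_1:
  assumes "l \<noteq> 0"
  shows "scale_comm l - 1 = scale_neg l * Phii * (diag_op (\<lambda>_. 1 / l - 1) * hankel)"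
  unfolding scale_comm_def scale_neg_comm[OF assms, symmetric]
  using scale_neg_inverse[OF assms] by (simp add: right_diff_distrib mult.assoc)

lemma tc1_scale_comm: "l \<noteq> 0 \<Longrightarrow> tc1 (scale_comm l)"
  by (simp add: scale_comm_minus_1 tc_hankel)

text \<open>Writing C(l) for \<open>scale_comm l\<close>, the product of A_l C(m) A_l^{-1} with C(l)
  collapses to C(l m), and the conjugation does not change the determinant.\<close>

lemma det1_scale_comm_mult:
  assumes "l \<noteq> 0" "m \<noteq> 0"
  shows "det1 (scale_comm (l * m)) = det1 (scale_comm l) * det1 (scale_comm m)"
proof -
  have "1 / (l * m) = 1 / m * (1 / l)" by simp
  then have "scale_comm (l * m) = scale_neg l * scale_neg m * Phii * (scale_neg (1 / m) * scale_neg (1 / l)) * Phi"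
    unfolding scale_comm_def scale_neg_mult by (simp add: mult.commute[of m l])
  also have "\<dots> = (scale_neg l * scale_comm m * scale_neg (1 / l)) * scale_comm l"
    unfolding scale_comm_def using scale_neg_inverse[OF assms(1)]
    by (simp add: mult.assoc) (simp add: mult.assoc[symmetric])
  finally have "det1 (scale_comm (l * m)) = det1 (scale_neg l * scale_comm m * scale_neg (1 / l)) * det1 (scale_comm l)"
    using det1_conj[OF tc1_scale_comm[OF assms(2)] scale_neg_inverse[OF assms(1)]] tc1_scale_comm[OF assms(1)]
    by (simp add: det1_mult)
  then show ?thesis
    using det1_conj[OF tc1_scale_comm[OF assms(2)] scale_neg_inverse[OF assms(1)]] by simp
qed

lemma det1_scale_comm_1: "det1 (scale_comm 1) = 1"
proof -
  have "scale_comm 1 = diag_op (\<lambda>_. 1)" by (simp add: scale_comm_def scale_neg_1 diag_op_1)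
  then show ?thesis using det1_diag_op_finite(2)[of "\<lambda>_. 1"] by simp
qed

text \<open>Independent of l: up to the explicit scalar and row factors in
  \<open>ent_scale_comm\<close>, this is C(l) - 1, so the dependence of the determinant on l becomes
  elementary.\<close>

definition "inv_hankel = Phii * hankel"

lemma tc_inv_hankel: "tc (ent inv_hankel)" by (simp add: inv_hankel_def tc_hankel)

lemma ent_scale_comm: "l \<noteq> 0 \<Longrightarrow> ent (scale_comm l - 1) i j = (1 / l - 1) * ((if i < 0 then l else 1) * ent inv_hankel i j)"
proof -
  assume "l \<noteq> 0"
  then have "scale_comm l - 1 = diag_op (\<lambda>_. 1 / l - 1) * (scale_neg l * inv_hankel)"
    unfolding scale_comm_minus_1[OF \<open>l \<noteq> 0\<close>] inv_hankel_def
    by (metis diag_op_const_commute mult.assoc)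
  then show ?thesis
    by (simp add: ent_diag_op_mult scale_neg_def bounded_range_sign0 del: ent_simps)
qed

text \<open>For fixed shift m the commutator has |m| entries, each equal to -sgn m times
  \<open>f m\<close>, whence the weight -m after summing over i. Absolute convergence of the double
  sum comes from the weighted coefficients of f and a uniform bound for g.\<close>

lemma trace_inv_hankel: "((\<lambda>i. ent inv_hankel i i) has_sum - (\<Sum>\<^sub>\<infinity>m. of_int m * f m * g (- m))) UNIV"
proof -
  obtain G where G: "norm (g j) \<le> G" for j
  proof -
    have s: "(\<lambda>x. norm (g x)) summable_on UNIV"
      using g summable_on_iff_abs_summable_on_complex by auto
    have "norm (g j) \<le> (\<Sum>\<^sub>\<infinity>x. norm (g x))" for j
      using finite_sum_le_infsum[OF s, of "{j}"] by simp
    then show thesis using that by blast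
  qed
  let ?h = "\<lambda>m i. g (- m) * ent hankel (m + i) i"
  have s: "(\<lambda>(m, i). ?h m i) summable_on UNIV"
  proof (rule summable_on_pairs[OF wf, where M = G])
    fix m :: int and F :: "int set" assume F: "finite F"
    let ?S = "{j. (m + j < 0) \<noteq> (j < (0::int))}"
    have S: "finite ?S" "card ?S = nat \<bar>m\<bar>" unfolding sign_change by auto
    have "(\<Sum>j\<in>F. norm (?h m j)) = (\<Sum>j\<in>F. if j \<in> ?S then norm (f m) * norm (g (- m)) else 0)"
      by (intro sum.cong) (auto simp: ent_hankel norm_mult)
    also have "\<dots> = (\<Sum>j\<in>F \<inter> ?S. norm (f m) * norm (g (- m)))"
      by (rule sum.inter_restrict[OF F, symmetric])
    also have "\<dots> \<le> (\<Sum>j\<in>?S. norm (f m) * norm (g (- m)))"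
      using S by (intro sum_mono2) auto
    also have "\<dots> = norm (of_int m * f m) * norm (g (- m))"
      unfolding sum_constant S(2) by (simp add: norm_mult)
    also have "\<dots> \<le> norm (of_int m * f m) * G"
      by (intro mult_left_mono G) simp
    finally show "(\<Sum>j\<in>F. norm (?h m j)) \<le> norm (of_int m * f m) * G" .
  qed
  have inner: "(\<Sum>\<^sub>\<infinity>i. ?h m i) = - (of_int m * f m * g (- m))" for m
  proof -
    let ?S = "{j. (m + j < 0) \<noteq> (j < (0::int))}"
    have S: "finite ?S" "card ?S = nat \<bar>m\<bar>" unfolding sign_change by auto
    have "(\<Sum>\<^sub>\<infinity>i. ?h m i) = (\<Sum>\<^sub>\<infinity>i\<in>?S. - of_int (sgn m) * (f m * g (- m)))"
      by (rule infsum_cong_neutral) (auto simp: ent_hankel sgn_if)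
    also have "\<dots> = - of_int (sgn m * \<bar>m\<bar>) * (f m * g (- m))" using S by simp
    also have "sgn m * \<bar>m\<bar> = m" by (simp add: sgn_mult_abs)
    finally show ?thesis by simp
  qed
  have "(\<Sum>\<^sub>\<infinity>i. ent inv_hankel i i) = (\<Sum>\<^sub>\<infinity>i. \<Sum>\<^sub>\<infinity>m. ?h m i)"
  proof (rule infsum_cong)
    fix i
    have "ent inv_hankel i i = (\<Sum>\<^sub>\<infinity>k. g (i - k) * ent hankel k i)"
      by (simp add: inv_hankel_def ent_mult Phii_def ent_laurent[OF g])
    also have "\<dots> = (\<Sum>\<^sub>\<infinity>m. ?h m i)"
      by (rule infsum_reindex_bij_witness[where j = "\<lambda>k. k - i" and i = "\<lambda>m. m + i"]) auto
    finally show "ent inv_hankel i i = (\<Sum>\<^sub>\<infinity>m. ?h m i)" .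
  qed
  also have "\<dots> = (\<Sum>\<^sub>\<infinity>m. \<Sum>\<^sub>\<infinity>i. ?h m i)"
    using infsum_swap_banach[of ?h UNIV UNIV] s by simp
  also have "\<dots> = - (\<Sum>\<^sub>\<infinity>m. of_int m * f m * g (- m))"
    unfolding inner by (rule infsum_uminus)
  finally have e: "(\<Sum>\<^sub>\<infinity>i. ent inv_hankel i i) = - (\<Sum>\<^sub>\<infinity>m. of_int m * f m * g (- m))" .
  have "(\<lambda>p. case p of (i, j) \<Rightarrow> ent inv_hankel i j) summable_on (\<lambda>i. (i, i)) ` UNIV"
    using tc_inv_hankel unfolding tc_def by (rule summable_on_subset_banach) simp
  then have "(\<lambda>i. ent inv_hankel i i) summable_on UNIV"
    by (subst (asm) summable_on_reindex) (auto simp: o_def inj_on_def)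
  then show ?thesis using has_sum_infsum e by metis
qed

text \<open>The Fourier form of the integral of \<phi>'/\<phi> over the circle divided by 2 \<pi> i;
  for an actual symbol this is shown in \<open>log_deriv_integral\<close>.\<close>

definition "log_residue = (\<Sum>\<^sub>\<infinity>m. of_int m * f m * g (- m))"

text \<open>To first order the determinant is 1 plus the trace of C(l) - 1. At l = 1 the factor 1/l
  - 1 has derivative -1, which cancels the sign in \<open>trace_inv_hankel\<close>.\<close>

lemma det1_scale_comm_deriv_1: "((\<lambda>l. det1 (scale_comm l)) has_field_derivative log_residue) (at 1)"
proof -
  define R where "R = infsum (rsum (ent inv_hankel)) UNIV"
  have R: "0 \<le> R" unfolding R_def by (intro infsum_nonneg rsum_nonneg)
  have rs: "rsum (ent inv_hankel) summable_on UNIV" by (rule tc_rows(2)[OF tc_inv_hankel])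
  \<comment> \<open>The trace over negative indices, where the row factor is l instead of 1. It
    enters with (1/l - 1)(l - 1), hence only to second order.\<close>
  define t' where "t' = (\<Sum>\<^sub>\<infinity>i. if i < 0 then ent inv_hankel i i else 0)"
  have tr: "((\<lambda>i. ent inv_hankel i i) has_sum - log_residue) UNIV" unfolding log_residue_def by (rule trace_inv_hankel)
  have tr': "((\<lambda>i. if i < 0 then ent inv_hankel i i else 0) has_sum t') UNIV"
  proof -
    have "(\<lambda>i. ent inv_hankel i i) summable_on {..<0}"
      using tr by (meson has_sum_imp_summable subset_UNIV summable_on_subset_banach)
    then have "(\<lambda>i. if i < 0 then ent inv_hankel i i else 0) summable_on UNIV"
      by (subst summable_on_cong_neutral[where T = "{..<0}" and g = "\<lambda>i. ent inv_hankel i i"]) auto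
    then show ?thesis unfolding t'_def by simp
  qed
  define E where "E l = det1 (scale_comm l) - 1 - (1 / l - 1) * (- log_residue + (l - 1) * t')" for l
  \<comment> \<open>For |l - 1| at most 1/2 one has |1/l - 1| at most 2 |l - 1| and |l| at most 3/2,
    so the entrywise norm of C(l) - 1 is at most 3 |l - 1| R. Its square gives the 9, and 3 |l - 1|
    R \<le> 2 R gives the exponential.\<close>
  have E: "norm (E l) \<le> 9 * R\<^sup>2 * exp (2 * R) * (norm (l - 1))\<^sup>2" if l: "norm (l - 1) \<le> 1/2" for l
  proof -
    have "norm (1 :: complex) \<le> norm l + norm (l - 1)"
      by (metis norm_minus_commute norm_triangle_sub)
    then have l1: "1/2 \<le> norm l" using l by simp
    then have l0: "l \<noteq> 0" by auto
    have "norm l \<le> norm (1 :: complex) + norm (l - 1)" by (rule norm_triangle_sub)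
    then have l2: "norm l \<le> 3/2" using l by simp
    let ?k = "1 / l - 1" and ?B = "ent (scale_comm l - 1)"
    have k: "norm ?k \<le> 2 * norm (l - 1)"
    proof -
      have "?k = (1 - l) / l" using l0 by (simp add: field_simps)
      then have "norm ?k = norm (l - 1) / norm l" by (simp add: norm_divide norm_minus_commute)
      also have "\<dots> \<le> norm (l - 1) / (1/2)" using l1 by (intro divide_left_mono) auto
      finally show ?thesis by simp
    qed
    have tcB: "tc ?B" by (rule tc1_scale_comm[OF l0])
    have Bij: "norm (?B i j) \<le> 3 * norm (l - 1) * norm (ent inv_hankel i j)" for i j
    proof -
      have "norm (?B i j) = norm ?k * (norm (if i < 0 then l else 1) * norm (ent inv_hankel i j))"
        by (simp add: ent_scale_comm[OF l0] norm_mult del: ent_simps)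
      also have "\<dots> \<le> (2 * norm (l - 1)) * (3/2 * norm (ent inv_hankel i j))"
        using l2 k by (intro mult_mono) auto
      finally show ?thesis by simp
    qed
    have rB: "rsum ?B i \<le> 3 * norm (l - 1) * rsum (ent inv_hankel) i" for i
      unfolding rsum_def infsum_cmult_right'[symmetric]
      by (intro infsum_mono Bij tc_rows(1)[OF tcB] summable_on_cmult_right tc_rows(1)[OF tc_inv_hankel])
    have RB: "infsum (rsum ?B) UNIV \<le> 3 * norm (l - 1) * R"
      unfolding R_def infsum_cmult_right'[symmetric]
      by (intro infsum_mono rB tc_rows(2)[OF tcB] summable_on_cmult_right rs)
    have RB0: "0 \<le> infsum (rsum ?B) UNIV" by (intro infsum_nonneg rsum_nonneg)
    have "((\<lambda>i. ?k * (ent inv_hankel i i + (l - 1) * (if i < 0 then ent inv_hankel i i else 0))) has_sum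
        ?k * (- log_residue + (l - 1) * t')) UNIV"
      by (intro has_sum_cmult_right has_sum_add tr tr')
    also have "(\<lambda>i. ?k * (ent inv_hankel i i + (l - 1) * (if i < 0 then ent inv_hankel i i else 0))) = (\<lambda>i. ?B i i)"
      by (auto simp: ent_scale_comm[OF l0] algebra_simps simp del: ent_simps)
    finally have "(\<Sum>\<^sub>\<infinity>i. ?B i i) = ?k * (- log_residue + (l - 1) * t')" by (rule infsumI)
    then have "norm (E l) \<le> (infsum (rsum ?B) UNIV)\<^sup>2 * exp (infsum (rsum ?B) UNIV)"
      using fredholm_det_l2_approx[OF tcB] by (simp add: E_def det1_def del: ent_simps)
    also have "\<dots> \<le> (3 * norm (l - 1) * R)\<^sup>2 * exp (2 * R)"
    proof (intro mult_mono power_mono RB RB0)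
      have "3 * norm (l - 1) * R \<le> 2 * R" using l R by (intro mult_right_mono) auto
      then show "exp (infsum (rsum ?B) UNIV) \<le> exp (2 * R)" using RB by simp
    qed auto
    finally show ?thesis by (simp add: power_mult_distrib algebra_simps)
  qed
  have E1: "E 1 = 0" by (simp add: E_def det1_scale_comm_1)
  have dE: "(E has_field_derivative 0) (at 1)"
    unfolding has_field_derivative_iff
  proof (rule Lim_null_comparison)
    let ?K = "9 * R\<^sup>2 * exp (2 * R)"
    have "eventually (\<lambda>l. norm (l - 1) \<le> 1/2) (at (1::complex))"
      unfolding eventually_at by (rule exI[of _ "1/2"]) (auto simp: dist_norm)
    then show "\<forall>\<^sub>F l in at 1. norm ((E l - E 1) / (l - 1)) \<le> ?K * norm (l - 1)"
    proof eventually_elim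
      case (elim l)
      show ?case
      proof (cases "l = 1")
        case False
        then show ?thesis
          using E[OF elim] by (simp add: E1 norm_divide power2_eq_square divide_simps mult.assoc)
      qed (simp add: E1)
    qed
    show "((\<lambda>l. ?K * norm (l - 1)) \<longlongrightarrow> 0) (at (1::complex))"
      by (auto intro!: tendsto_eq_intros)
  qed
  have eq: "(\<lambda>l. det1 (scale_comm l)) = (\<lambda>l. E l + (1 + (1 / l - 1) * (- log_residue + (l - 1) * t')))"
    by (auto simp: E_def)
  show ?thesis
    unfolding eq by (rule derivative_eq_intros dE refl | simp)+
qed

text \<open>Multiplicativity carries the derivative from 1 to every nonzero l, so F' =
  \<open>log_residue\<close> F / l. Then F(l) l^(-n) has zero derivative on the connected punctured
  plane, where integrality of n makes the power single-valued.\<close>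

lemma det1_scale_comm:
  assumes n: "log_residue = of_int n" and l: "l \<noteq> 0"
  shows "det1 (scale_comm l) = l powi n"
proof -
  have deriv: "((\<lambda>l. det1 (scale_comm l)) has_field_derivative det1 (scale_comm l) * log_residue / l) (at l)" if "l \<noteq> 0" for l
  proof -
    have "((\<lambda>m. det1 (scale_comm l) * det1 (scale_comm (m / l))) has_field_derivative det1 (scale_comm l) * (log_residue * (1 / l))) (at l)"
    proof (rule DERIV_cmult, rule DERIV_chain2[where f = "\<lambda>l. det1 (scale_comm l)"])
      show "((\<lambda>l. det1 (scale_comm l)) has_field_derivative log_residue) (at (l / l))"
        using det1_scale_comm_deriv_1 that by simp
      show "((\<lambda>m. m / l) has_field_derivative 1 / l) (at l)"
        using that by (auto intro!: derivative_eq_intros)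
    qed
    moreover have "eventually (\<lambda>m. det1 (scale_comm l) * det1 (scale_comm (m / l)) = det1 (scale_comm m)) (nhds l)"
    proof -
      have "eventually (\<lambda>m. m \<noteq> 0) (nhds l)"
        using that t1_space_nhds by blast
      then show ?thesis
        by eventually_elim (use that in \<open>simp add: det1_scale_comm_mult[symmetric]\<close>)
    qed
    ultimately show ?thesis
      by (subst (asm) DERIV_cong_ev[OF refl _ refl]) auto
  qed
  have "(\<lambda>l. det1 (scale_comm l) * l powi (- n)) constant_on (- {0})"
  proof (rule has_field_derivative_0_imp_constant_on)
    show "connected (- {0 :: complex})"
      by (rule connected_punctured_universe) simp
    show "open (- {0 :: complex})" by auto
    fix l :: complex assume "l \<in> - {0}"
    then have l: "l \<noteq> 0" by simp
    have "((\<lambda>l. det1 (scale_comm l) * l powi (- n)) has_field_derivative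
       (det1 (scale_comm l) * log_residue / l) * l powi (- n) + (of_int (- n) * l powi (- n - 1) * 1) * det1 (scale_comm l)) (at l)"
      by (rule DERIV_mult deriv[OF l] DERIV_power_int DERIV_ident disjI2 l)+
    also have "(det1 (scale_comm l) * log_residue / l) * l powi (- n) + (of_int (- n) * l powi (- n - 1) * 1) * det1 (scale_comm l) = 0"
      using l by (simp add: n power_int_diff)
    finally show "((\<lambda>l. det1 (scale_comm l) * l powi (- n)) has_field_derivative 0) (at l)" .
  qed
  then obtain c where "\<And>x. x \<in> - {0} \<Longrightarrow> det1 (scale_comm x) * x powi (- n) = c"
    unfolding constant_on_def by blast
  from this[of l] this[of 1] l have "det1 (scale_comm l) * l powi (- n) = det1 (scale_comm 1) * 1 powi (- n)" by simp
  then show ?thesis using l by (simp add: det1_scale_comm_1 power_int_minus field_simps)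
qed

theorem det1_factorization:
  fixes d :: "int \<Rightarrow> complex" and s :: complex
  assumes n: "log_residue = of_int n" and fin: "finite (range d)" and s: "1 + s \<noteq> 0"
    and dneg: "\<And>i. i < 0 \<Longrightarrow> d i = 0" and dpos: "\<And>i. N \<le> i \<Longrightarrow> d i = s" and nz: "\<And>i. 1 + s - d i \<noteq> 0"
    and N: "0 \<le> N"
  shows "det1 (1 + diag_op (\<lambda>i. if i < 0 then 0 else s) - Phi * diag_op d * Phii) =
     (1 + s) powi n * (\<Prod>i\<in>{0..<N}. 1 + s - d i) *
       det1 (1 - diag_op (\<lambda>i. s * d i / (1 + s - d i)) * (Phii * proj_neg * Phi))"
    (is "det1 ?T = _ * _ * det1 (1 - ?X * ?S)")
proof -
  let ?b = "\<lambda>i. if i < 0 then 1 else 1 + s - d i"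
  let ?a = "scale_neg (1 + s)" and ?ai = "scale_neg (1 / (1 + s))"
  note bd = bounded_range_sign[OF fin]
  have bd0: "bounded (range d)" using bd[of "\<lambda>_ x. x"] by simp
  have bdb: "bounded (range ?b)" using bd[of "\<lambda>b x. if b then 1 else 1 + s - x"] by simp
  have bdX: "bounded (range (\<lambda>i. s * d i / (1 + s - d i)))"
    using bd[of "\<lambda>b x. s * x / (1 + s - x)"] by simp
  have bdG: "bounded (range (\<lambda>i. 1 + s - d i))"
    using bd[of "\<lambda>b x. 1 + s - x"] by simp
  have a: "?a = 1 + diag_op (\<lambda>_. s) * proj_neg"
    by (rule schur_eqI) (auto simp: scale_neg_def proj_neg_def ent_diag_op_mult ent_diag_op bounded_range_sign0)
  have ba: "diag_op ?b * ?a = diag_op (\<lambda>_. 1 + s) - diag_op d"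
    by (rule schur_eqI) (auto simp: scale_neg_def ent_diag_op_mult[OF bdb] ent_diag_op bounded_range_sign0 bd0 dneg)
  have GX: "(diag_op (\<lambda>_. 1 + s) - diag_op d) * ?X = diag_op (\<lambda>_. s) * diag_op d"
  proof -
    have "diag_op (\<lambda>_. 1 + s) - diag_op d = diag_op (\<lambda>i. 1 + s - d i)"
      by (rule schur_eqI) (auto simp: ent_diag_op bd0 bdG)
    then show ?thesis
      using nz by (simp add: diag_op_mult bdG bdX bd0)
  qed
  have sa: "(1 + diag_op (\<lambda>i. if i < 0 then 0 else s)) * ?a = diag_op (\<lambda>_. 1 + s)"
    by (rule schur_eqI)
       (auto simp: distrib_right scale_neg_def ent_diag_op_mult ent_diag_op bounded_range_sign0)
  \<comment> \<open>Multiplying by A on the right removes A^{-1} from the factorization, and both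
    sides become polynomial in D and Q: B A = 1 + s - D and (1 + s - D) X = s D reduce each to 1 + s
    - \<Phi> D \<Phi>^{-1} - s \<Phi> D \<Phi>^{-1} Q.\<close>
  have star: "?T * ?a = Phi * (diag_op ?b * ?a) * (1 - ?X * ?S) * Phii"
  proof -
    have "?T * ?a = diag_op (\<lambda>_. 1 + s) - Phi * diag_op d * Phii * ?a"
      using sa by (simp add: left_diff_distrib)
    also have "Phi * diag_op d * Phii * ?a = Phi * diag_op d * Phii + diag_op (\<lambda>_. s) * (Phi * diag_op d * Phii * proj_neg)"
      unfolding a distrib_left using diag_op_const_commute[of s "Phi * diag_op d * Phii"]
      by (simp add: mult.assoc[symmetric])
    finally have 1: "?T * ?a = diag_op (\<lambda>_. 1 + s) - (Phi * diag_op d * Phii + diag_op (\<lambda>_. s) * (Phi * diag_op d * Phii * proj_neg))" .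
    have "Phi * (diag_op ?b * ?a) * (1 - ?X * ?S) * Phii =
        Phi * (diag_op (\<lambda>_. 1 + s) - diag_op d) * Phii - Phi * ((diag_op (\<lambda>_. 1 + s) - diag_op d) * ?X) * (?S * Phii)"
      unfolding ba by (simp add: right_diff_distrib left_diff_distrib mult.assoc)
    also have "\<dots> = Phi * diag_op (\<lambda>_. 1 + s) * Phii - Phi * diag_op d * Phii - Phi * (diag_op (\<lambda>_. s) * diag_op d) * (?S * Phii)"
      unfolding GX by (simp add: right_diff_distrib left_diff_distrib)
    also have "Phi * diag_op (\<lambda>_. 1 + s) * Phii = diag_op (\<lambda>_. 1 + s)"
      using diag_op_const_commute[of "1 + s" Phi] by (metis inv(1) mult.assoc mult.right_neutral)
    also have "Phi * (diag_op (\<lambda>_. s) * diag_op d) * (?S * Phii) = diag_op (\<lambda>_. s) * (Phi * diag_op d * Phii * proj_neg)"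
      using diag_op_const_commute[of s Phi] by (simp add: mult.assoc) (metis mult.assoc)
    finally show ?thesis unfolding 1 by simp
  qed
  have ai: "?a * ?ai = 1" "?ai * ?a = 1" using scale_neg_inverse[OF s] by auto
  \<comment> \<open>S is the sum of \<Phi>^{-1} times the commutator and of Q. The second part is
    not summable, but X annihilates it because d vanishes on negative indices.\<close>
  have XS: "tc1 (1 - ?X * ?S)"
  proof -
    have "Phii * proj_neg * Phi = Phii * hankel + proj_neg"
      unfolding hankel_def by (simp add: right_diff_distrib mult.assoc)
    moreover have "?X * proj_neg = 0"
      by (rule schur_eqI) (auto simp: ent_diag_op_mult[OF bdX] proj_neg_def ent_diag_op bounded_range_sign0 dneg)
    ultimately have "1 - ?X * ?S - 1 = - (?X * (Phii * hankel))" by (simp add: distrib_left)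
    then show ?thesis by (simp add: tc_hankel del: ent_simps)
  qed
  \<comment> \<open>From N on d equals s, so B differs from 1 in finitely many places only.\<close>
  have sub: "{i. ?b i \<noteq> 1} \<subseteq> {0..<N}"
  proof
    fix i assume "i \<in> {i. ?b i \<noteq> 1}"
    then have "0 \<le> i" "d i \<noteq> s" by (auto split: if_splits)
    then show "i \<in> {0..<N}" using dpos[of i] by force
  qed
  then have finb: "finite {i. ?b i \<noteq> 1}" by (rule finite_subset) simp
  note b = det1_diag_op_finite[OF finb]
  have pb: "(\<Prod>i | ?b i \<noteq> 1. ?b i) = (\<Prod>i\<in>{0..<N}. 1 + s - d i)"
    using sub by (intro prod.mono_neutral_cong_left) auto
  define U where "U = diag_op ?b * (?a * (1 - ?X * ?S) * ?ai) * scale_comm (1 + s)"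
  note c = det1_conj[OF XS ai]
  have U: "tc1 U" "det1 U = (\<Prod>i\<in>{0..<N}. 1 + s - d i) * det1 (1 - ?X * ?S) * (1 + s) powi n"
    unfolding U_def using b c tc1_scale_comm[OF s] by (simp_all add: det1_mult pb det1_scale_comm[OF n s])
  have "Phi * U * Phii = (Phi * (diag_op ?b * ?a) * (1 - ?X * ?S) * Phii) * ?ai"
    unfolding U_def scale_comm_def using ai by (simp add: mult.assoc) (simp add: mult.assoc[symmetric])
  also have "\<dots> = ?T" unfolding star[symmetric] using ai by (simp add: mult.assoc)
  finally have "det1 ?T = det1 (Phi * U * Phii)" by simp
  also have "\<dots> = det1 U" by (rule det1_conj(1)[OF U(1)]) simp_all
  finally show ?thesis using U(2) by (simp add: mult_ac)
qed

end

section \<open>Fredholm determinants on the circle\<close>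

lemma has_vector_derivative_cis:
  "((\<lambda>t. cis (c * t)) has_vector_derivative of_real c * (\<i> * cis (c * t))) (at t within A)"
  unfolding has_vector_derivative_def
  by (rule derivative_eq_intros refl | simp add: scaleR_conv_of_real fun_eq_iff)+

lemma has_integral_cis:
  "((\<lambda>t. cis (of_int n * t)) has_integral (if n = 0 then 2 * of_real pi else 0)) {0..2 * pi}"
proof (cases "n = 0")
  case True
  then show ?thesis
    using has_integral_const_real[of "1 :: complex" 0 "2 * pi"] by (simp add: scaleR_conv_of_real)
next
  case False
  have "((\<lambda>t. cis (of_int n * t)) has_integral
      cis (of_int n * (2 * pi)) / (\<i> * of_int n) - cis (of_int n * 0) / (\<i> * of_int n)) {0..2 * pi}"
  proof (rule fundamental_theorem_of_calculus)
    fix t :: real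
    from has_vector_derivative_divide[OF has_vector_derivative_cis[of "of_int n" t], of "\<i> * of_int n"]
    show "((\<lambda>t. cis (of_int n * t) / (\<i> * of_int n)) has_vector_derivative cis (of_int n * t)) (at t within {0..2 * pi})"
      using False by simp
  qed simp
  moreover have "cis (of_int n * (2 * pi)) = 1"
    using cis_multiple_2pi[of "of_int n"] by (simp add: mult.commute mult.left_commute)
  ultimately show ?thesis using False by simp
qed

abbreviation circ :: "real measure" where "circ \<equiv> lebesgue_on {0..2 * pi}"

lemma circ_cis:
  "integrable circ (\<lambda>t. cis (of_int n * t))"
  "integral\<^sup>L circ (\<lambda>t. cis (of_int n * t)) = (if n = 0 then 2 * of_real pi else 0)"
proof -
  show *: "integrable circ (\<lambda>t. cis (of_int n * t))"
    by (rule continuous_imp_integrable_real) (auto intro!: continuous_intros continuous_on_cis)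
  show "integral\<^sup>L circ (\<lambda>t. cis (of_int n * t)) = (if n = 0 then 2 * of_real pi else 0)"
    using lebesgue_integral_eq_integral[OF *] integral_unique[OF has_integral_cis[of n]] by simp
qed

lemma sigma_finite_circ: "sigma_finite_measure circ"
proof -
  have "{0..2 * pi} \<in> lmeasurable" using lmeasurable_cbox[of 0 "2 * pi"] by simp
  then show ?thesis by (rule finite_measure.axioms(1)[OF finite_measure_lebesgue_on])
qed

interpretation circ: product_sigma_finite "\<lambda>_ :: nat. circ"
  by (rule product_sigma_finite.intro) (rule sigma_finite_circ)

text \<open>The kernel, truncated to W, of the operator with matrix \<open>k\<close> in the basis of
  powers of z. The exponent -j - 1 is shifted by one because dw contributes a factor w, and 2 \<pi>
  i normalizes the contour integral of dw / w.\<close>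

definition circ_series :: "(int \<Rightarrow> int \<Rightarrow> complex) \<Rightarrow> int set \<Rightarrow> complex \<Rightarrow> complex \<Rightarrow> complex" where
  "circ_series k W z w = (\<Sum>i\<in>W. \<Sum>j\<in>W. k i j * z powi i * w powi (- j - 1)) / (2 * of_real pi * \<i>)"

text \<open>After expansion over permutations p and row and column tuples I and J, the integral over
  the torus leaves only J = I o p, by orthogonality. The surviving terms are the minors of
  \<open>k\<close>.\<close>

lemma circ_series_minor:
  fixes m :: nat
  assumes W: "finite W"
  shows "integrable (Pi\<^sub>M {..<m} (\<lambda>_. circ))
      (\<lambda>t. dets {..<m} (\<lambda>a b. circ_series k W (cis (t a)) (cis (t b))) * (\<Prod>a<m. \<i> * cis (t a)))"
    and "integral\<^sup>L (Pi\<^sub>M {..<m} (\<lambda>_. circ))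
      (\<lambda>t. dets {..<m} (\<lambda>a b. circ_series k W (cis (t a)) (cis (t b))) * (\<Prod>a<m. \<i> * cis (t a))) =
      (\<Sum>I\<in>{..<m} \<rightarrow>\<^sub>E W. dets {..<m} (\<lambda>a b. k (I a) (I b)))"
proof -
  let ?P = "{p. p permutes {..<m}}" and ?E = "{..<m} \<rightarrow>\<^sub>E W" and ?M = "Pi\<^sub>M {..<m} (\<lambda>_. circ)"
  define c :: "(nat \<Rightarrow> nat) \<Rightarrow> (nat \<Rightarrow> int) \<Rightarrow> (nat \<Rightarrow> int) \<Rightarrow> complex"
    where "c p I J = of_int (sign p) * (\<Prod>a<m. k (I a) (J a) / (2 * of_real pi))" for p I J
  \<comment> \<open>The inverse permutation collects the exponents by variable: the factor with
    index \<open>J a\<close> depends on \<open>t (p a)\<close>.\<close>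
  let ?e = "\<lambda>(p :: nat \<Rightarrow> nat) (I :: nat \<Rightarrow> int) (J :: nat \<Rightarrow> int) t. \<Prod>a<m. cis (of_int (I a - J (Hilbert_Choice.inv p a)) * t a)"
  have expand: "dets {..<m} (\<lambda>a b. circ_series k W (cis (t a)) (cis (t b))) * (\<Prod>a<m. \<i> * cis (t a)) =
      (\<Sum>p\<in>?P. \<Sum>I\<in>?E. \<Sum>J\<in>?E. c p I J * ?e p I J t)" for t
    unfolding dets_def sum_distrib_right
  proof (rule sum.cong[OF refl])
    fix p assume "p \<in> ?P"
    then have p: "p permutes {..<m}" by simp
    \<comment> \<open>Distributing the differentials along p gives each factor the differential of
      its own second variable, which absorbs the -1 in the exponent.\<close>
    have "of_int (sign p) * (\<Prod>a<m. circ_series k W (cis (t a)) (cis (t (p a)))) * (\<Prod>a<m. \<i> * cis (t a)) =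
        of_int (sign p) * (\<Prod>a<m. circ_series k W (cis (t a)) (cis (t (p a))) * (\<i> * cis (t (p a))))"
      using prod.permute[OF p, of "\<lambda>a. \<i> * cis (t a)"] by (simp add: prod.distrib o_def)
    also have "(\<Prod>a<m. circ_series k W (cis (t a)) (cis (t (p a))) * (\<i> * cis (t (p a)))) =
        (\<Prod>a<m. \<Sum>i\<in>W. \<Sum>j\<in>W. k i j / (2 * of_real pi) * (cis (of_int i * t a) * cis (- of_int j * t (p a))))"
    proof (rule prod.cong[OF refl])
      fix a
      have e: "k i j * cis (t a) powi i * cis (t (p a)) powi (- j - 1) / (2 * of_real pi * \<i>) * (\<i> * cis (t (p a))) =
          k i j / (2 * of_real pi) * (cis (of_int i * t a) * cis (- of_int j * t (p a)))" for i j
      proof -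
        have "cis (t (p a)) powi (- j - 1) * cis (t (p a)) = cis (- of_int j * t (p a))"
          by (simp add: cis_power_int cis_mult algebra_simps)
        then show ?thesis by (simp add: cis_power_int[of "t a"] field_simps)
      qed
      show "circ_series k W (cis (t a)) (cis (t (p a))) * (\<i> * cis (t (p a))) =
        (\<Sum>i\<in>W. \<Sum>j\<in>W. k i j / (2 * of_real pi) * (cis (of_int i * t a) * cis (- of_int j * t (p a))))"
        unfolding circ_series_def sum_divide_distrib sum_distrib_right
        by (intro sum.cong refl e)
    qed
    also have "\<dots> = (\<Sum>I\<in>?E. \<Sum>J\<in>?E. \<Prod>a<m. k (I a) (J a) / (2 * of_real pi) * (cis (of_int (I a) * t a) * cis (- of_int (J a) * t (p a))))"
      using W by (simp add: prod_sum_PiE)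
    also have "\<dots> = (\<Sum>I\<in>?E. \<Sum>J\<in>?E. (\<Prod>a<m. k (I a) (J a) / (2 * of_real pi)) * ?e p I J t)"
    proof (intro sum.cong refl)
      fix I J :: "nat \<Rightarrow> int"
      have "(\<Prod>a<m. cis (- of_int (J a) * t (p a))) = (\<Prod>a<m. cis (- of_int (J (Hilbert_Choice.inv p a)) * t a))"
        using prod.permute[OF p, of "\<lambda>a. cis (- of_int (J (Hilbert_Choice.inv p a)) * t a)"] p
        by (simp add: o_def permutes_inverses)
      then have "(\<Prod>a<m. cis (of_int (I a) * t a)) * (\<Prod>a<m. cis (- of_int (J a) * t (p a))) = ?e p I J t"
        by (simp add: prod.distrib[symmetric] cis_mult algebra_simps)
      then show "(\<Prod>a<m. k (I a) (J a) / (2 * of_real pi) * (cis (of_int (I a) * t a) * cis (- of_int (J a) * t (p a)))) =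
          (\<Prod>a<m. k (I a) (J a) / (2 * of_real pi)) * ?e p I J t"
        by (simp only: prod.distrib)
    qed
    finally show "of_int (sign p) * (\<Prod>a<m. circ_series k W (cis (t a)) (cis (t (p a)))) * (\<Prod>a<m. \<i> * cis (t a)) =
        (\<Sum>I\<in>?E. \<Sum>J\<in>?E. c p I J * ?e p I J t)"
      by (simp add: c_def sum_distrib_left mult.assoc)
  qed
  have int: "integrable ?M (\<lambda>t. c p I J * ?e p I J t)" for p I J
    by (intro integrable_mult_right circ.product_integrable_prod circ_cis) simp
  show "integrable ?M
      (\<lambda>t. dets {..<m} (\<lambda>a b. circ_series k W (cis (t a)) (cis (t b))) * (\<Prod>a<m. \<i> * cis (t a)))"
    unfolding expand by (intro Bochner_Integration.integrable_sum int)
  have one: "(\<Sum>J\<in>?E. integral\<^sup>L ?M (\<lambda>t. c p I J * ?e p I J t)) = of_int (sign p) * (\<Prod>a<m. k (I a) (I (p a)))"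
    if p: "p permutes {..<m}" and I: "I \<in> ?E" for p I
  proof -
    have "integral\<^sup>L ?M (\<lambda>t. c p I J * ?e p I J t) =
        of_int (sign p) * (\<Prod>a<m. if J a = I (p a) then k (I a) (J a) else 0)" for J
    proof -
      have "integral\<^sup>L ?M (\<lambda>t. c p I J * ?e p I J t) = c p I J * integral\<^sup>L ?M (?e p I J)"
        by simp
      also have "integral\<^sup>L ?M (?e p I J) = (\<Prod>a<m. if I a - J (Hilbert_Choice.inv p a) = 0 then 2 * of_real pi else 0)"
        by (subst circ.product_integral_prod) (simp_all only: circ_cis finite_lessThan)
      also have "\<dots> = (\<Prod>a<m. if J a = I (p a) then 2 * of_real pi else 0)"
      proof -
        have "I (p a) - J (Hilbert_Choice.inv p (p a)) = 0 \<longleftrightarrow> J a = I (p a)" for a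
          by (auto simp: permutes_inverses[OF p])
        then show ?thesis
          by (subst prod.permute[OF p]) (simp add: o_def)
      qed
      also have "c p I J * \<dots> = of_int (sign p) * (\<Prod>a<m. k (I a) (J a) / (2 * of_real pi) * (if J a = I (p a) then 2 * of_real pi else 0))"
        unfolding c_def mult.assoc prod.distrib[symmetric] ..
      also have "(\<Prod>a<m. k (I a) (J a) / (2 * of_real pi) * (if J a = I (p a) then 2 * of_real pi else 0)) =
          (\<Prod>a<m. if J a = I (p a) then k (I a) (J a) else 0)"
        by (intro prod.cong) auto
      finally show ?thesis .
    qed
    then have "(\<Sum>J\<in>?E. integral\<^sup>L ?M (\<lambda>t. c p I J * ?e p I J t)) =
        of_int (sign p) * (\<Sum>J\<in>?E. \<Prod>a<m. if J a = I (p a) then k (I a) (J a) else 0)"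
      by (simp add: sum_distrib_left)
    also have "(\<Sum>J\<in>?E. \<Prod>a<m. if J a = I (p a) then k (I a) (J a) else 0) =
        (\<Prod>a<m. \<Sum>j\<in>W. if j = I (p a) then k (I a) j else 0)"
      using W by (subst prod_sum_PiE) auto
    also have "\<dots> = (\<Prod>a<m. k (I a) (I (p a)))"
    proof (intro prod.cong refl)
      fix a assume "a \<in> {..<m}"
      then have "p a \<in> {..<m}" using permutes_in_image[OF p] by blast
      then have "I (p a) \<in> W" using I by (auto simp: PiE_iff)
      then show "(\<Sum>j\<in>W. if j = I (p a) then k (I a) j else 0) = k (I a) (I (p a))"
        using W by simp
    qed
    finally show ?thesis .
  qed
  have "integral\<^sup>L ?M
      (\<lambda>t. dets {..<m} (\<lambda>a b. circ_series k W (cis (t a)) (cis (t b))) * (\<Prod>a<m. \<i> * cis (t a))) =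
      (\<Sum>p\<in>?P. \<Sum>I\<in>?E. \<Sum>J\<in>?E. integral\<^sup>L ?M (\<lambda>t. c p I J * ?e p I J t))"
    unfolding expand by (simp only: Bochner_Integration.integral_sum Bochner_Integration.integrable_sum int)
  also have "\<dots> = (\<Sum>p\<in>?P. \<Sum>I\<in>?E. of_int (sign p) * (\<Prod>a<m. k (I a) (I (p a))))"
    by (intro sum.cong refl one) auto
  also have "\<dots> = (\<Sum>I\<in>?E. dets {..<m} (\<lambda>a b. k (I a) (I b)))"
    unfolding dets_def by (rule sum.swap)
  finally show "integral\<^sup>L ?M
      (\<lambda>t. dets {..<m} (\<lambda>a b. circ_series k W (cis (t a)) (cis (t b))) * (\<Prod>a<m. \<i> * cis (t a))) =
      (\<Sum>I\<in>?E. dets {..<m} (\<lambda>a b. k (I a) (I b)))" .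
qed

lemma norm_det_const_le:
  assumes "\<And>a b. norm (M a b) \<le> K"
  shows "norm (dets {..<m} M) \<le> (real m * K) ^ m"
proof -
  have "norm (dets {..<m} M) \<le> (\<Prod>a<m. \<Sum>b<m. norm (M a b))" by (rule norm_dets_le) simp
  also have "\<dots> \<le> (\<Prod>a<m. real m * K)"
    using sum_mono[of "{..<m}" "\<lambda>b. norm (M a b)" "\<lambda>_. K" for a] assms
    by (intro prod_mono conjI sum_nonneg) auto
  finally show ?thesis by simp
qed

lemma norm_circ_term: "norm (k i j * cis s powi i * cis t powi l) = norm (k i j)"
  by (simp add: norm_mult norm_power_int)

text \<open>Equality holds for each m separately, so no exchange with the outer series occurs. For
  fixed m the truncated kernels converge pointwise and are bounded by K, so dominated convergence on
  the finite-measure torus applies with the constant (m K)^m.\<close>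

lemma fredholm_det_circle_eq_l2:
  assumes tc: "tc k"
    and A: "\<And>s t. A (cis s) (cis t) =
      (\<Sum>\<^sub>\<infinity>(i, j). k i j * cis s powi i * cis t powi (- j - 1)) / (2 * of_real pi * \<i>)"
  shows "fredholm_det_circle A = fredholm_det_l2 k"
proof -
  let ?S = "\<lambda>N. circ_series k (win N)"
  have summ: "(\<lambda>(i, j). k i j * cis s powi i * cis t powi (- j - 1)) summable_on UNIV" for s t
    using tc unfolding tc_abs
    by (subst summable_on_iff_abs_summable_on_complex) (simp add: case_prod_unfold norm_circ_term)
  have winwin: "filterlim (\<lambda>N. win N \<times> win N) (finite_subsets_at_top UNIV) sequentially"
    unfolding filterlim_finite_subsets_at_top
  proof safe
    fix X :: "(int \<times> int) set" assume X: "finite X"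
    have "eventually (\<lambda>N. \<forall>x\<in>X. fst x \<in> win N) sequentially" "eventually (\<lambda>N. \<forall>x\<in>X. snd x \<in> win N) sequentially"
      using X by (auto intro!: eventually_ball_finite eventually_mem_win)
    then show "\<forall>\<^sub>F N in sequentially. finite (win N \<times> win N) \<and> X \<subseteq> win N \<times> win N \<and> win N \<times> win N \<subseteq> UNIV"
      by eventually_elim auto
  qed
  have lim: "(\<lambda>N. ?S N (cis s) (cis t)) \<longlonglongrightarrow> A (cis s) (cis t)" for s t
  proof -
    have "(\<lambda>N. \<Sum>(i, j)\<in>win N \<times> win N. k i j * cis s powi i * cis t powi (- j - 1)) \<longlonglongrightarrow>
        (\<Sum>\<^sub>\<infinity>(i, j). k i j * cis s powi i * cis t powi (- j - 1))"
      by (rule filterlim_compose[OF has_sum_infsum[OF summ, unfolded has_sum_def] winwin])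
    then show ?thesis
      unfolding A circ_series_def by (intro tendsto_divide) (simp_all add: sum.cartesian_product)
  qed
  define K where "K = (\<Sum>\<^sub>\<infinity>(i, j). norm (k i j)) / (2 * pi)"
  have bound: "norm (?S N (cis s) (cis t)) \<le> K" for N s t
  proof -
    have "norm (\<Sum>i\<in>win N. \<Sum>j\<in>win N. k i j * cis s powi i * cis t powi (- j - 1)) \<le> (\<Sum>i\<in>win N. \<Sum>j\<in>win N. norm (k i j))"
      by (intro order_trans[OF norm_sum] sum_mono) (simp add: norm_circ_term)
    also have "\<dots> = (\<Sum>(i, j)\<in>win N \<times> win N. norm (k i j))" by (simp add: sum.cartesian_product)
    also have "\<dots> \<le> (\<Sum>\<^sub>\<infinity>(i, j). norm (k i j))"
      using tc unfolding tc_abs by (intro finite_sum_le_infsum) auto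
    finally show ?thesis by (simp add: circ_series_def K_def norm_divide norm_mult divide_right_mono)
  qed
  have "integral\<^sup>L (Pi\<^sub>M {..<m} (\<lambda>_. circ))
      (\<lambda>t. dets {..<m} (\<lambda>a b. A (cis (t a)) (cis (t b))) * (\<Prod>a<m. \<i> * cis (t a))) =
      (\<Sum>\<^sub>\<infinity>I\<in>{..<m} \<rightarrow>\<^sub>E UNIV. dets {..<m} (\<lambda>a b. k (I a) (I b)))" for m :: nat
  proof -
    let ?M = "Pi\<^sub>M {..<m} (\<lambda>_. circ)" and ?U = "{..<m} \<rightarrow>\<^sub>E (UNIV :: int set)"
    let ?F = "\<lambda>A t. dets {..<m} (\<lambda>a b. A (cis (t a)) (cis (t b))) * (\<Prod>a<m. \<i> * cis (t a))"
    have limF: "(\<lambda>N. ?F (?S N) t) \<longlonglongrightarrow> ?F A t" for t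
      unfolding dets_def by (intro tendsto_intros lim)
    have meas: "?F (?S N) \<in> borel_measurable ?M" for N
      by (rule borel_measurable_integrable[OF circ_series_minor(1)[OF finite_win]])
    have "(\<lambda>N. integral\<^sup>L ?M (?F (?S N))) \<longlonglongrightarrow> integral\<^sup>L ?M (?F A)"
    proof (rule integral_dominated_convergence)
      show "?F A \<in> borel_measurable ?M"
        by (rule borel_measurable_LIMSEQ_metric[OF meas limF])
      show "integrable ?M (\<lambda>t. (real m * K) ^ m)"
        using circ.product_integrable_prod[of "{..<m}" "\<lambda>_ _. real m * K"] circ_cis(1)[of 0]
        by (simp add: integrable_const_ivl)
      show "AE t in ?M. (\<lambda>N. ?F (?S N) t) \<longlonglongrightarrow> ?F A t" using limF by simp
      show "AE t in ?M. norm (?F (?S N) t) \<le> (real m * K) ^ m" for N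
        using norm_det_const_le[OF bound] by (simp add: norm_mult prod_norm[symmetric])
    qed (rule meas)
    moreover have "(\<lambda>N. \<Sum>I\<in>{..<m} \<rightarrow>\<^sub>E win N. dets {..<m} (\<lambda>a b. k (I a) (I b))) \<longlonglongrightarrow>
        (\<Sum>\<^sub>\<infinity>I\<in>?U. dets {..<m} (\<lambda>a b. k (I a) (I b)))"
    proof -
      have "(\<lambda>I. dets {..<m} (\<lambda>a b. k (I a) (I b)) / fact m) summable_on ?U"
        by (rule summable_on_SigmaD1[OF minor_summable[OF tc order_refl]]) simp
      then have s: "(\<lambda>I. dets {..<m} (\<lambda>a b. k (I a) (I b))) summable_on ?U"
        using summable_on_cmult_left[of _ ?U "fact m :: complex"] by fastforce
      have "filterlim (\<lambda>N. {..<m} \<rightarrow>\<^sub>E win N) (finite_subsets_at_top ?U) sequentially"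
        unfolding filterlim_finite_subsets_at_top
      proof safe
        fix X assume X: "finite X" "X \<subseteq> ?U"
        have "eventually (\<lambda>N. \<forall>I\<in>X. \<forall>a\<in>{..<m}. I a \<in> win N) sequentially"
          using X by (intro eventually_ball_finite ballI eventually_mem_win) auto
        then show "\<forall>\<^sub>F N in sequentially. finite ({..<m} \<rightarrow>\<^sub>E win N) \<and> X \<subseteq> {..<m} \<rightarrow>\<^sub>E win N \<and> {..<m} \<rightarrow>\<^sub>E win N \<subseteq> ?U"
        proof eventually_elim
          case (elim N)
          then show ?case using X(2) by (auto simp: PiE_iff subset_iff intro!: finite_PiE)
        qed
      qed
      from filterlim_compose[OF has_sum_infsum[OF s, unfolded has_sum_def] this] show ?thesis .
    qed
    ultimately show ?thesis
      unfolding circ_series_minor(2)[OF finite_win] by (rule LIMSEQ_unique)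
  qed
  then show ?thesis
    by (simp add: fredholm_det_circle_def fredholm_det_l2_def det_fun_eq_dets)
qed

section \<open>Fourier series\<close>

text \<open>An inductive closure, so that orthogonality can be proved by induction without tracking
  coefficients.\<close>

inductive trigpoly :: "(real \<Rightarrow> complex) \<Rightarrow> bool" where
  trigpoly_mono: "trigpoly (\<lambda>t. c * cis (of_int j * t))"
| trigpoly_add: "trigpoly p \<Longrightarrow> trigpoly q \<Longrightarrow> trigpoly (\<lambda>t. p t + q t)"

lemma trigpoly_mult:
  assumes "trigpoly p" "trigpoly q"
  shows "trigpoly (\<lambda>t. p t * q t)"
  using assms(1)
proof induction
  case (trigpoly_mono c j)
  from assms(2) show ?case
  proof induction
    case (trigpoly_mono d i)
    have "(\<lambda>t. c * cis (of_int j * t) * (d * cis (of_int i * t))) = (\<lambda>t. (c * d) * cis (of_int (j + i) * t))"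
      by (simp add: fun_eq_iff algebra_simps flip: cis_mult)
    then show ?case using trigpoly.trigpoly_mono[of "c * d" "j + i"] by simp
  next
    case (trigpoly_add p q)
    then show ?case by (simp add: distrib_left trigpoly.trigpoly_add)
  qed
next
  case (trigpoly_add p r)
  then show ?case by (simp add: distrib_right trigpoly.trigpoly_add)
qed

lemma trigpoly_real_polynomial:
  fixes q :: "complex \<Rightarrow> real"
  assumes "real_polynomial_function q"
  shows "trigpoly (\<lambda>t. of_real (q (cis t)))"
  using assms
proof (induction rule: real_polynomial_function.induct)
  case (linear f)
  then interpret bounded_linear f .
  \<comment> \<open>A real-linear functional on the plane takes the value cos t f(1) + sin t f(i);
    the coefficients come from Euler's formulas.\<close>
  have "(\<lambda>t. complex_of_real (f (cis t))) =
      (\<lambda>t. ((of_real (f 1) - \<i> * of_real (f \<i>)) / 2) * cis (of_int 1 * t) +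
           ((of_real (f 1) + \<i> * of_real (f \<i>)) / 2) * cis (of_int (-1) * t))"
  proof
    fix t
    have "cis t = cos t *\<^sub>R 1 + sin t *\<^sub>R \<i>" by (simp add: complex_eq_iff)
    then have "f (cis t) = cos t * f 1 + sin t * f \<i>" by (simp add: add scaleR)
    then show "complex_of_real (f (cis t)) = ((of_real (f 1) - \<i> * of_real (f \<i>)) / 2) * cis (of_int 1 * t) +
           ((of_real (f 1) + \<i> * of_real (f \<i>)) / 2) * cis (of_int (-1) * t)"
      by (simp add: complex_eq_iff field_simps)
  qed
  then show ?case by (simp only: trigpoly.intros)
next
  case (const c)
  show ?case using trigpoly_mono[of "of_real c" 0] by simp
next
  case (add f g)
  then show ?case by (simp add: trigpoly.trigpoly_add)
next
  case (mult f g)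
  then show ?case by (simp add: trigpoly_mult)
qed

lemma continuous_on_circle:
  assumes "continuous_on (sphere 0 1) f"
  shows "continuous_on A (\<lambda>t. f (cis t))"
  by (rule continuous_on_compose2[OF assms]) (auto intro!: continuous_intros)

lemma unit_complex_cis:
  assumes "z \<in> sphere 0 1"
  obtains t where "0 \<le> t" "t \<le> 2 * pi" "z = cis t"
proof
  show "0 \<le> Arg2pi z" "Arg2pi z \<le> 2 * pi" "z = cis (Arg2pi z)"
    using Arg2pi_ge_0[of z] Arg2pi_lt_2pi[of z] Arg2pi_eq[of z] assms
    by (auto simp: cis_conv_exp mult.commute intro: less_imp_le)
qed

text \<open>Stone-Weierstrass approximates the conjugate of g uniformly by a polynomial p, which is
  a trigonometric polynomial on the circle and hence orthogonal to g. So the integral of |g|^2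
  equals that of g (conj g - p), which is arbitrarily small.\<close>

lemma fourier_unique:
  assumes g: "continuous_on (sphere 0 1) g" and zero: "\<And>j. fourier_coeff g j = 0" and z: "z \<in> sphere 0 1"
  shows "g z = 0"
proof -
  let ?I = "{0..2 * pi}"
  have gc: "continuous_on ?I (\<lambda>t. g (cis t))" by (rule continuous_on_circle[OF g])
  have orth: "((\<lambda>t. g (cis t) * p t) has_integral 0) ?I" if "trigpoly p" for p
    using that
  proof induction
    case (trigpoly_mono c j)
    have "(\<lambda>t. g (cis t) * cis (- (of_int (- j) * t))) integrable_on ?I"
      by (intro integrable_continuous_real continuous_intros gc)
    moreover have "integral ?I (\<lambda>t. g (cis t) * cis (- (of_int (- j) * t))) = 0"
      using zero[of "- j"] by (simp add: fourier_coeff_def)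
    ultimately have "((\<lambda>t. g (cis t) * cis (of_int j * t)) has_integral 0) ?I"
      by (simp add: has_integral_iff)
    from has_integral_mult_right[OF this, of c] show ?case by (simp add: mult.left_commute)
  next
    case (trigpoly_add p q)
    from has_integral_add[OF trigpoly_add.IH] show ?case by (simp add: distrib_left)
  qed
  let ?n = "\<lambda>t. (norm (g (cis t)))\<^sup>2"
  have int_n: "?n integrable_on ?I" by (intro integrable_continuous_real continuous_intros gc)
  obtain B where "\<forall>z\<in>sphere 0 1. norm (g z) \<le> B"
    using compact_imp_bounded[OF compact_continuous_image[OF g compact_sphere]]
    unfolding bounded_iff by blast
  then have B: "norm (g z) \<le> B" if "z \<in> sphere 0 1" for z using that by blast
  have B0: "0 \<le> B" using B[of 1] norm_ge_zero order_trans by (metis dist_0_norm mem_sphere norm_one)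
  have le: "integral ?I ?n \<le> e * (2 * pi * B)" if e: "e > 0" for e
  proof -
    have "continuous_on (sphere 0 1) (\<lambda>z. cnj (g z))" by (intro continuous_intros g)
    from Stone_Weierstrass_polynomial_function[OF compact_sphere this e]
    obtain p where p: "polynomial_function p" "\<And>z. z \<in> sphere 0 1 \<Longrightarrow> norm (cnj (g z) - p z) < e"
      by blast
    have "real_polynomial_function (\<lambda>z. Re (p z))" "real_polynomial_function (\<lambda>z. Im (p z))"
      using p(1) bounded_linear_Re bounded_linear_Im unfolding polynomial_function_def o_def by blast+
    then have "trigpoly (\<lambda>t. of_real (Re (p (cis t))) + (\<i> * cis (of_int 0 * t)) * of_real (Im (p (cis t))))"
      by (intro trigpoly_add trigpoly_mult trigpoly_real_polynomial trigpoly_mono)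
    also have "(\<lambda>t. of_real (Re (p (cis t))) + (\<i> * cis (of_int 0 * t)) * of_real (Im (p (cis t)))) = (\<lambda>t. p (cis t))"
      by (simp add: complex_eq_iff fun_eq_iff)
    finally have tp: "trigpoly (\<lambda>t. p (cis t))" .
    have "((\<lambda>t. complex_of_real (?n t)) has_integral of_real (integral ?I ?n)) ?I"
      using int_n by (intro has_integral_of_real) auto
    from has_integral_diff[OF this orth[OF tp]]
    have "((\<lambda>t. g (cis t) * (cnj (g (cis t)) - p (cis t))) has_integral of_real (integral ?I ?n)) ?I"
      by (simp add: right_diff_distrib complex_norm_square[symmetric])
    moreover have "norm (g (cis t) * (cnj (g (cis t)) - p (cis t))) \<le> B * e" for t
      unfolding norm_mult by (intro mult_mono B less_imp_le[OF p(2)] B0) auto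
    ultimately have "norm (complex_of_real (integral ?I ?n)) \<le> B * e * measure lborel ?I"
      using B0 e by (intro has_integral_bound[where f = "\<lambda>t. g (cis t) * (cnj (g (cis t)) - p (cis t))"
          and a = 0 and b = "2 * pi", unfolded cbox_interval]) auto
    then show ?thesis by (simp add: mult_ac)
  qed
  have "integral ?I ?n \<le> 0"
  proof (rule field_le_epsilon)
    fix e :: real assume e: "e > 0"
    \<comment> \<open>The added 1 keeps the denominator positive when B = 0.\<close>
    have "integral ?I ?n \<le> (e / (2 * pi * B + 1)) * (2 * pi * B)"
      using e B0 by (intro le divide_pos_pos add_nonneg_pos mult_nonneg_nonneg) auto
    also have "\<dots> \<le> (e / (2 * pi * B + 1)) * (2 * pi * B + 1)"
      using e B0 by (intro mult_left_mono divide_nonneg_nonneg) auto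
    also have "\<dots> = e"
    proof -
      have "2 * pi * B + 1 > 0" using B0 by (intro add_nonneg_pos mult_nonneg_nonneg) auto
      then show ?thesis by simp
    qed
    finally show "integral ?I ?n \<le> 0 + e" by simp
  qed
  then have "integral ?I ?n = 0"
    using integral_nonneg[OF int_n] by simp
  then have "\<forall>t\<in>?I. ?n t = 0"
    by (subst (asm) integral_eq_0_iff) (auto intro!: continuous_intros gc)
  moreover obtain t where "0 \<le> t" "t \<le> 2 * pi" "z = cis t" using unit_complex_cis[OF z] .
  ultimately show ?thesis by auto
qed

section \<open>Absolutely convergent Fourier series\<close>

definition fourier_sum :: "(int \<Rightarrow> complex) \<Rightarrow> real \<Rightarrow> complex" where
  "fourier_sum a t = (\<Sum>\<^sub>\<infinity>j. a j * cis (of_int j * t))"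

lemma norm_summable: "(a :: 'a \<Rightarrow> complex) summable_on A \<Longrightarrow> (\<lambda>j. norm (a j)) summable_on A"
  using summable_on_iff_abs_summable_on_complex by auto

lemma fourier_sum_has_sum:
  assumes "a summable_on UNIV"
  shows "((\<lambda>j. a j * cis (of_int j * t)) has_sum fourier_sum a t) UNIV"
  unfolding fourier_sum_def
  by (rule has_sum_infsum, subst summable_on_iff_abs_summable_on_complex)
     (simp add: norm_mult norm_summable[OF assms])

lemma fourier_sum_uniform:
  assumes "a summable_on UNIV"
  shows "uniform_limit UNIV (\<lambda>X t. \<Sum>j\<in>X. a j * cis (of_int j * t)) (fourier_sum a) (finite_subsets_at_top UNIV)"
  unfolding fourier_sum_def
  by (rule Weierstrass_m_test_general[OF _ norm_summable[OF assms]]) (simp add: norm_mult)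

lemma fourier_sum_continuous:
  assumes "a summable_on UNIV"
  shows "continuous_on A (fourier_sum a)"
proof -
  have "continuous_on UNIV (fourier_sum a)"
    by (rule uniform_limit_theorem[OF _ fourier_sum_uniform[OF assms]])
       (auto intro!: always_eventually continuous_intros)
  then show ?thesis using continuous_on_subset by blast
qed

lemma fourier_sum_integral:
  assumes a: "a summable_on UNIV" and h: "continuous_on {0..2 * pi} h"
  shows "((\<lambda>j. a j * integral {0..2 * pi} (\<lambda>t. cis (of_int j * t) * h t)) has_sum
      integral {0..2 * pi} (\<lambda>t. fourier_sum a t * h t)) UNIV"
proof -
  let ?I = "{0..2 * pi}"
  obtain B where "\<forall>t\<in>?I. norm (h t) \<le> B"
    using compact_imp_bounded[OF compact_continuous_image[OF h compact_Icc]]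
    unfolding bounded_iff by blast
  then have B: "norm (h t) \<le> B" if "t \<in> ?I" for t using that by blast
  have "uniform_limit ?I (\<lambda>X t. \<Sum>j\<in>X. a j * cis (of_int j * t) * h t)
     (\<lambda>t. \<Sum>\<^sub>\<infinity>j. a j * cis (of_int j * t) * h t) (finite_subsets_at_top UNIV)"
    by (rule Weierstrass_m_test_general[where M = "\<lambda>j. norm (a j) * B"])
       (auto simp: norm_mult intro!: mult_left_mono B summable_on_cmult_left norm_summable a)
  then have u: "uniform_limit ?I (\<lambda>X t. \<Sum>j\<in>X. a j * cis (of_int j * t) * h t)
     (\<lambda>t. fourier_sum a t * h t) (finite_subsets_at_top UNIV)"
    by (simp add: fourier_sum_def infsum_cmult_left')
  have "continuous_on ?I (\<lambda>t. \<Sum>j\<in>X. a j * cis (of_int j * t) * h t)" for X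
    by (intro continuous_intros h)
  from uniform_limit_integral[OF u this finite_subsets_at_top_neq_bot]
  obtain I J where I: "\<And>X. ((\<lambda>t. \<Sum>j\<in>X. a j * cis (of_int j * t) * h t) has_integral I X) ?I"
    and J: "((\<lambda>t. fourier_sum a t * h t) has_integral J) ?I" and lim: "(I \<longlongrightarrow> J) (finite_subsets_at_top UNIV)" by blast
  have "I X = (\<Sum>j\<in>X. a j * integral ?I (\<lambda>t. cis (of_int j * t) * h t))" if "finite X" for X
  proof -
    have "((\<lambda>t. \<Sum>j\<in>X. a j * (cis (of_int j * t) * h t)) has_integral
        (\<Sum>j\<in>X. a j * integral ?I (\<lambda>t. cis (of_int j * t) * h t))) ?I"
      by (intro has_integral_sum[OF that] has_integral_mult_right integrable_integral
          integrable_continuous_real continuous_intros h)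
    from has_integral_unique[OF I[of X, unfolded mult.assoc] this] show ?thesis .
  qed
  then have "eventually (\<lambda>X. I X = (\<Sum>j\<in>X. a j * integral ?I (\<lambda>t. cis (of_int j * t) * h t)))
      (finite_subsets_at_top UNIV)"
    by (intro eventually_finite_subsets_at_top_weakI) auto
  from Lim_transform_eventually[OF lim this] show ?thesis
    using J by (simp add: has_sum_def integral_unique)
qed

lemma fourier_sum_coeff:
  assumes a: "a summable_on UNIV"
  shows "integral {0..2 * pi} (\<lambda>t. fourier_sum a t * cis (- (of_int n * t))) = 2 * of_real pi * a n"
proof -
  have "((\<lambda>j. a j * integral {0..2 * pi} (\<lambda>t. cis (of_int j * t) * cis (- (of_int n * t)))) has_sum
      integral {0..2 * pi} (\<lambda>t. fourier_sum a t * cis (- (of_int n * t)))) UNIV"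
    by (rule fourier_sum_integral[OF a]) (intro continuous_intros)
  moreover have "integral {0..2 * pi} (\<lambda>t. cis (of_int j * t) * cis (- (of_int n * t))) =
      (if j = n then 2 * of_real pi else 0)" for j
    using integral_unique[OF has_integral_cis[of "j - n"]] by (simp add: cis_mult algebra_simps)
  ultimately have "((\<lambda>j. a j * (if j = n then 2 * of_real pi else 0)) has_sum
      integral {0..2 * pi} (\<lambda>t. fourier_sum a t * cis (- (of_int n * t)))) UNIV" by simp
  moreover have "((\<lambda>j. a j * (if j = n then 2 * of_real pi else 0)) has_sum a n * (2 * of_real pi)) UNIV"
    by (rule has_sum_finite_neutralI[where B = "{n}"]) auto
  ultimately show ?thesis unfolding mult.commute[of _ "a n"] by (rule has_sum_unique)
qed

text \<open>The absolutely convergent series is continuous and has the same coefficients as f, so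
  uniqueness applies to the difference. The series is written in powers of z because uniqueness is
  stated for functions on the circle.\<close>

lemma fourier_series:
  assumes f: "continuous_on (sphere 0 1) f" and s: "fourier_coeff f summable_on UNIV"
  shows "f (cis t) = fourier_sum (fourier_coeff f) t"
proof -
  let ?a = "fourier_coeff f"
  let ?G = "\<lambda>z. \<Sum>\<^sub>\<infinity>j. ?a j * z powi j"
  have "uniform_limit (sphere 0 1) (\<lambda>X z. \<Sum>j\<in>X. ?a j * z powi j) ?G (finite_subsets_at_top UNIV)"
    by (rule Weierstrass_m_test_general[OF _ norm_summable[OF s]]) (simp add: norm_mult norm_power_int)
  then have Gc: "continuous_on (sphere 0 1) ?G"
    by (rule uniform_limit_theorem[rotated])
       (auto intro!: always_eventually continuous_intros)
  have G: "?G (cis t) = fourier_sum ?a t" for t by (simp add: fourier_sum_def cis_power_int)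
  have "f (cis t) - ?G (cis t) = 0"
  proof (rule fourier_unique[of "\<lambda>z. f z - ?G z"])
    show "continuous_on (sphere 0 1) (\<lambda>z. f z - ?G z)" by (intro continuous_intros f Gc)
    fix j
    have "integral {0..2 * pi} (\<lambda>t. (f (cis t) - ?G (cis t)) * cis (- (of_int j * t))) =
      integral {0..2 * pi} (\<lambda>t. f (cis t) * cis (- (of_int j * t))) -
      integral {0..2 * pi} (\<lambda>t. fourier_sum ?a t * cis (- (of_int j * t)))"
      unfolding G left_diff_distrib
      by (intro Henstock_Kurzweil_Integration.integral_diff integrable_continuous_real continuous_intros
          continuous_on_circle[OF f] fourier_sum_continuous s)
    then show "fourier_coeff (\<lambda>z. f z - ?G z) j = 0"
      unfolding fourier_sum_coeff[OF s] by (simp add: fourier_coeff_def)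
  qed simp
  then show ?thesis using G by simp
qed

text \<open>The differentiated series converges uniformly by the weighted summability, so the limit
  may be differentiated termwise along the windows.\<close>

lemma fourier_sum_deriv:
  assumes a: "a summable_on UNIV" and wa: "(\<lambda>j. of_int j * a j) summable_on UNIV"
  shows "(fourier_sum a has_vector_derivative fourier_sum (\<lambda>j. \<i> * (of_int j * a j)) t) (at t)"
proof -
  let ?b = "\<lambda>j. \<i> * (of_int j * a j)"
  have b: "?b summable_on UNIV" by (intro summable_on_cmult_right wa)
  let ?f = "\<lambda>N t. \<Sum>j\<in>win N. a j * cis (of_int j * t)"
  let ?f' = "\<lambda>N t. \<Sum>j\<in>win N. ?b j * cis (of_int j * t)"
  have lim: "(\<lambda>N. ?f N t) \<longlonglongrightarrow> fourier_sum a t" for t by (rule has_sum_win[OF fourier_sum_has_sum[OF a]])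
  have "\<exists>g. \<forall>x\<in>UNIV. (\<lambda>N. ?f N x) \<longlonglongrightarrow> g x \<and>
      (g has_derivative (\<lambda>h. h *\<^sub>R fourier_sum ?b x)) (at x within UNIV)"
  proof (rule has_derivative_sequence)
    show "(?f N has_derivative (\<lambda>h. h *\<^sub>R ?f' N x)) (at x within UNIV)" for N x
    proof -
      have "(?f N has_vector_derivative (\<Sum>j\<in>win N. a j * (of_real (of_int j) * (\<i> * cis (of_int j * x))))) (at x)"
        by (intro has_vector_derivative_sum has_vector_derivative_mult_right has_vector_derivative_cis)
      also have "(\<Sum>j\<in>win N. a j * (of_real (of_int j) * (\<i> * cis (of_int j * x)))) = ?f' N x"
        by (intro sum.cong) auto
      finally show ?thesis by (simp add: has_vector_derivative_def)
    qed
    fix e :: real assume e: "e > 0"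
    have "uniform_limit UNIV ?f' (fourier_sum ?b) sequentially"
      using filterlim_compose[OF fourier_sum_uniform[OF b] filterlim_win] .
    then have "\<forall>\<^sub>F N in sequentially. \<forall>x\<in>UNIV. dist (?f' N x) (fourier_sum ?b x) < e"
      using e by (rule uniform_limitD)
    then show "\<forall>\<^sub>F N in sequentially. \<forall>x\<in>UNIV. \<forall>h. norm (h *\<^sub>R ?f' N x - h *\<^sub>R fourier_sum ?b x) \<le> e * norm h"
    proof eventually_elim
      case (elim N)
      show ?case
      proof (intro ballI allI)
        fix x h :: real
        have "norm (h *\<^sub>R ?f' N x - h *\<^sub>R fourier_sum ?b x) = \<bar>h\<bar> * dist (?f' N x) (fourier_sum ?b x)"
          by (simp add: dist_norm flip: scaleR_diff_right)
        also have "\<dots> \<le> \<bar>h\<bar> * e" using elim by (intro mult_left_mono) (auto intro: less_imp_le)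
        finally show "norm (h *\<^sub>R ?f' N x - h *\<^sub>R fourier_sum ?b x) \<le> e * norm h" by (simp add: mult.commute)
      qed
    qed
  qed (use lim in auto)
  then obtain g where g: "\<And>x. (\<lambda>N. ?f N x) \<longlonglongrightarrow> g x" "\<And>x. (g has_derivative (\<lambda>h. h *\<^sub>R fourier_sum ?b x)) (at x)"
    by auto
  have "g = fourier_sum a" using LIMSEQ_unique[OF g(1) lim] by auto
  then show ?thesis using g(2)[of t] by (simp add: has_vector_derivative_def)
qed

text \<open>Nonnegativity of the integral of |h - s|^2, with s the partial Fourier sum over F: both
  mixed terms and the last term equal 2 \<pi> S, so two of the three cancel.\<close>

lemma bessel:
  assumes h: "continuous_on {0..2 * pi} h" and F: "finite F"
    and d: "\<And>j. d j = integral {0..2 * pi} (\<lambda>t. h t * cis (- (of_int j * t))) / (2 * of_real pi)"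
  shows "(\<Sum>j\<in>F. (norm (d j))\<^sup>2) \<le> Re (integral {0..2 * pi} (\<lambda>t. h t * cnj (h t))) / (2 * pi)"
proof -
  let ?I = "{0..2 * pi}"
  define s where "s t = (\<Sum>j\<in>F. d j * cis (of_int j * t))" for t
  define S where "S = (\<Sum>j\<in>F. (norm (d j))\<^sup>2)"
  have cnj_d: "cnj (d j) * (2 * of_real pi * d j) = 2 * of_real pi * of_real ((norm (d j))\<^sup>2)" for j
    unfolding complex_norm_square by (simp add: mult_ac)
  have A: "((\<lambda>t. h t * cnj (h t)) has_integral integral ?I (\<lambda>t. h t * cnj (h t))) ?I"
    by (intro integrable_integral integrable_continuous_real continuous_intros h)
  have hj: "((\<lambda>t. h t * cis (- (of_int j * t))) has_integral (2 * of_real pi * d j)) ?I" for j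
    using integrable_integral[of "\<lambda>t. h t * cis (- (of_int j * t))" ?I] d[of j]
    by (simp add: integrable_continuous_real h continuous_intros)
  have "((\<lambda>t. \<Sum>j\<in>F. cnj (d j) * (h t * cis (- (of_int j * t)))) has_integral
      (\<Sum>j\<in>F. cnj (d j) * (2 * of_real pi * d j))) ?I"
    by (intro has_integral_sum[OF F] has_integral_mult_right hj)
  then have B: "((\<lambda>t. h t * cnj (s t)) has_integral (2 * of_real pi * of_real S)) ?I"
    unfolding cnj_d by (simp add: s_def S_def sum_distrib_left mult_ac cis_cnj)
  have C: "((\<lambda>t. cnj (h t) * s t) has_integral (2 * of_real pi * of_real S)) ?I"
    using B[folded has_integral_cnj[of "\<lambda>t. h t * cnj (s t)"]] by (simp add: o_def)
  have "((\<lambda>t. \<Sum>j\<in>F. \<Sum>i\<in>F. d j * cnj (d i) * cis (of_int (j - i) * t)) has_integral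
      (\<Sum>j\<in>F. \<Sum>i\<in>F. d j * cnj (d i) * (if j - i = 0 then 2 * of_real pi else 0))) ?I"
    by (intro has_integral_sum[OF F] has_integral_mult_right has_integral_cis)
  moreover have "(\<lambda>t. \<Sum>j\<in>F. \<Sum>i\<in>F. d j * cnj (d i) * cis (of_int (j - i) * t)) = (\<lambda>t. s t * cnj (s t))"
    by (simp add: s_def fun_eq_iff sum_product cis_cnj cis_mult algebra_simps)
  moreover have "(\<Sum>j\<in>F. \<Sum>i\<in>F. d j * cnj (d i) * (if j - i = 0 then 2 * of_real pi else 0)) = 2 * of_real pi * of_real S"
  proof -
    have "(\<Sum>i\<in>F. d j * cnj (d i) * (if j - i = 0 then 2 * of_real pi else 0)) = 2 * of_real pi * of_real ((norm (d j))\<^sup>2)"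
      if "j \<in> F" for j
    proof -
      have "(\<Sum>i\<in>F. d j * cnj (d i) * (if j - i = 0 then 2 * of_real pi else 0)) =
          (\<Sum>i\<in>F. if i = j then d j * cnj (d j) * (2 * of_real pi) else 0)"
        by (intro sum.cong) auto
      also have "\<dots> = d j * cnj (d j) * (2 * of_real pi)" using F that by simp
      finally show ?thesis by (simp only: complex_norm_square mult_ac)
    qed
    then show ?thesis by (simp add: S_def sum_distrib_left)
  qed
  ultimately have D: "((\<lambda>t. s t * cnj (s t)) has_integral 2 * of_real pi * of_real S) ?I" by simp
  have "((\<lambda>t. (h t * cnj (h t) - h t * cnj (s t)) - (cnj (h t) * s t - s t * cnj (s t))) has_integral
      ((integral ?I (\<lambda>t. h t * cnj (h t)) - 2 * of_real pi * of_real S) - (2 * of_real pi * of_real S - 2 * of_real pi * of_real S))) ?I"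
    by (intro has_integral_diff A B C D)
  moreover have "(h t * cnj (h t) - h t * cnj (s t)) - (cnj (h t) * s t - s t * cnj (s t)) = of_real ((norm (h t - s t))\<^sup>2)" for t
    unfolding complex_norm_square by (simp add: algebra_simps)
  ultimately have "((\<lambda>t. of_real ((norm (h t - s t))\<^sup>2)) has_integral
      (integral ?I (\<lambda>t. h t * cnj (h t)) - 2 * of_real pi * of_real S)) ?I" by simp
  from has_integral_linear[OF this bounded_linear_Re]
  have "((\<lambda>t. (norm (h t - s t))\<^sup>2) has_integral Re (integral ?I (\<lambda>t. h t * cnj (h t)) - 2 * of_real pi * of_real S)) ?I"
    by (simp add: o_def)
  then have "0 \<le> Re (integral ?I (\<lambda>t. h t * cnj (h t)) - 2 * of_real pi * of_real S)"
    by (rule has_integral_nonneg) simp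
  then show ?thesis by (simp add: S_def field_simps)
qed

lemma summable_inverse_int_squares: "(\<lambda>j :: int. 1 / (real_of_int j)\<^sup>2) summable_on UNIV"
proof -
  have n: "(\<lambda>n :: nat. 1 / (real n)\<^sup>2) summable_on UNIV"
    using inverse_power_summable[of 2, where 'a = real]
    by (intro summable_nonneg_imp_summable_on) (auto simp: divide_inverse)
  have "(\<lambda>j :: int. 1 / (real_of_int j)\<^sup>2) summable_on range int"
    by (subst summable_on_reindex) (use n in \<open>auto simp: o_def\<close>)
  moreover have "(\<lambda>j :: int. 1 / (real_of_int j)\<^sup>2) summable_on range (\<lambda>n. - int n)"
    by (subst summable_on_reindex) (use n in \<open>auto simp: o_def inj_on_def\<close>)
  moreover have "UNIV = range int \<union> range (\<lambda>n. - int n)"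
    by (auto simp: image_iff) (metis int_cases2)
  ultimately show ?thesis using summable_on_union by metis
qed

section \<open>Symbols with summable weighted coefficients\<close>

text \<open>The convolution is absolutely summable and its Fourier series is the product, here the
  constant 1, so its coefficients are read off by orthogonality.\<close>

lemma fourier_sum_convolution:
  assumes a: "a summable_on UNIV" and b: "b summable_on UNIV"
    and prod: "\<And>t. fourier_sum a t * fourier_sum b t = 1"
  shows "(\<Sum>\<^sub>\<infinity>l. a (m - l) * b l) = (if m = 0 then 1 else 0)"
proof -
  define c where "c m = (\<Sum>\<^sub>\<infinity>l. a (m - l) * b l)" for m
  \<comment> \<open>The unimodular weight is instantiated with 1 for summability of the convolution
    and with exponentials for the exchange of sums.\<close>
  have pairs: "(\<lambda>(l, m). a (m - l) * b l * w m) summable_on UNIV" if w: "\<And>m. norm (w m) = 1" for w :: "int \<Rightarrow> complex"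
  proof (rule summable_on_pairs[OF b, where M = "\<Sum>\<^sub>\<infinity>x. norm (a x)"])
    fix l and F :: "int set" assume F: "finite F"
    have "(\<Sum>m\<in>F. norm (a (m - l) * b l * w m)) = norm (b l) * (\<Sum>m\<in>F. norm (a (m - l)))"
      by (simp add: norm_mult w sum_distrib_left mult.commute)
    also have "(\<Sum>m\<in>F. norm (a (m - l))) = (\<Sum>x\<in>(\<lambda>m. m - l) ` F. norm (a x))"
      by (simp add: sum.reindex inj_on_def)
    also have "\<dots> \<le> (\<Sum>\<^sub>\<infinity>x. norm (a x))"
      using F norm_summable[OF a] by (intro finite_sum_le_infsum) auto
    finally show "(\<Sum>m\<in>F. norm (a (m - l) * b l * w m)) \<le> norm (b l) * (\<Sum>\<^sub>\<infinity>x. norm (a x))"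
      by (simp add: mult_left_mono)
  qed
  have swapped: "(\<lambda>(m, l). a (m - l) * b l * w m) summable_on UNIV \<times> UNIV" if "\<And>m. norm (w m) = 1" for w :: "int \<Rightarrow> complex"
    using pairs[of w, OF that] summable_on_swap[of "\<lambda>(l, m). a (m - l) * b l * w m" UNIV UNIV]
    by (simp add: case_prod_unfold)
  have c: "c summable_on UNIV"
    using summable_on_Sigma_banach[OF swapped[of "\<lambda>_. 1"]] by (simp add: c_def[abs_def])
  have "fourier_sum c t = 1" for t
  proof -
    let ?w = "\<lambda>m :: int. cis (of_int m * t)"
    have "fourier_sum c t = (\<Sum>\<^sub>\<infinity>m. \<Sum>\<^sub>\<infinity>l. a (m - l) * b l * ?w m)"
      by (simp add: fourier_sum_def c_def infsum_cmult_left')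
    also have "\<dots> = (\<Sum>\<^sub>\<infinity>l. \<Sum>\<^sub>\<infinity>m. a (m - l) * b l * ?w m)"
      by (rule infsum_swap_banach) (rule swapped, simp)
    also have "\<dots> = (\<Sum>\<^sub>\<infinity>l. fourier_sum a t * (b l * ?w l))"
    proof (rule infsum_cong)
      fix l
      have "(\<Sum>\<^sub>\<infinity>m. a (m - l) * b l * ?w m) = (\<Sum>\<^sub>\<infinity>m. (a m * ?w m) * (b l * ?w l))"
      proof (rule infsum_reindex_bij_witness[where j = "\<lambda>m. m - l" and i = "\<lambda>m. m + l"])
        fix m
        have "?w m = ?w (m - l) * ?w l" by (simp add: cis_mult algebra_simps)
        then show "(a (m - l) * ?w (m - l)) * (b l * ?w l) = a (m - l) * b l * ?w m"
          by (simp only: mult_ac)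
      qed auto
      also have "\<dots> = fourier_sum a t * (b l * ?w l)"
        unfolding fourier_sum_def by (rule infsum_cmult_left')
      finally show "(\<Sum>\<^sub>\<infinity>m. a (m - l) * b l * ?w m) = fourier_sum a t * (b l * ?w l)" .
    qed
    also have "\<dots> = fourier_sum a t * fourier_sum b t"
      unfolding fourier_sum_def[of b] by (rule infsum_cmult_right')
    finally show ?thesis using prod by simp
  qed
  with fourier_sum_coeff[OF c, of m] have "2 * of_real pi * c m = integral {0..2 * pi} (\<lambda>t. cis (of_int (- m) * t))"
    by simp
  also have "\<dots> = (if - m = 0 then 2 * of_real pi else 0)"
    by (rule integral_unique[OF has_integral_cis])
  finally show ?thesis by (simp add: c_def split: if_splits)
qed

locale circle_symbol =
  fixes \<phi> :: "complex \<Rightarrow> complex"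
  assumes cont: "continuous_on (sphere 0 1) \<phi>"
    and nonzero: "\<forall>z\<in>sphere 0 1. \<phi> z \<noteq> 0"
    and coeff: "(\<lambda>j::int. norm (of_int j * fourier_coeff \<phi> j)) summable_on UNIV"
begin

abbreviation "f \<equiv> fourier_coeff \<phi>"
abbreviation "g \<equiv> fourier_coeff (\<lambda>z. inverse (\<phi> z))"

lemma weighted: "(\<lambda>j. of_int j * f j) summable_on UNIV"
  using coeff by (rule abs_summable_summable)

lemma f_summable: "f summable_on UNIV"
proof (rule abs_summable_summable, rule summable_on_comparison_test)
  \<comment> \<open>The weight vanishes at j = 0, so the mean value needs its own summand.\<close>
  show "(\<lambda>j. norm (of_int j * f j) + (if j = 0 then norm (f 0) else 0)) summable_on UNIV"
    by (intro summable_on_add coeff finite_nonzero_values_imp_summable_on) (auto intro: finite_subset[of _ "{0}"])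
  fix j :: int
  show "norm (f j) \<le> norm (of_int j * f j) + (if j = 0 then norm (f 0) else 0)"
  proof (cases "j = 0")
    case False
    then have "1 \<le> \<bar>real_of_int j\<bar>" by linarith
    then have "1 * norm (f j) \<le> \<bar>real_of_int j\<bar> * norm (f j)" by (intro mult_right_mono) auto
    then show ?thesis by (simp add: norm_mult)
  qed simp
qed simp

lemma phi_fourier_sum: "\<phi> (cis t) = fourier_sum f t"
  by (rule fourier_series[OF cont f_summable])

lemma phi_nz [simp]: "\<phi> (cis t) \<noteq> 0"
  using nonzero by simp

definition "dphi = fourier_sum (\<lambda>j. \<i> * (of_int j * f j))"

lemma dphi_continuous: "continuous_on A dphi"
  unfolding dphi_def by (intro fourier_sum_continuous summable_on_cmult_right weighted)

lemma phi_deriv: "((\<lambda>t. \<phi> (cis t)) has_vector_derivative dphi t) (at t)"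
  unfolding phi_fourier_sum dphi_def by (rule fourier_sum_deriv[OF f_summable weighted])

lemma phi_continuous: "continuous_on A (\<lambda>t. \<phi> (cis t))"
  by (rule continuous_on_circle[OF cont])

text \<open>The derivative -\<phi>'/\<phi>^2 along the circle, spelled as
  \<open>DERIV_inverse\<close> produces it.\<close>

definition "dinv_phi t = dphi t * - (inverse (\<phi> (cis t)) ^ Suc (Suc 0))"

lemma inverse_phi_deriv: "((\<lambda>t. inverse (\<phi> (cis t))) has_vector_derivative dinv_phi t) (at t)"
  using field_vector_diff_chain_at[OF phi_deriv[of t] DERIV_inverse[OF phi_nz]]
  by (simp add: o_def dinv_phi_def)

lemma dinv_phi_continuous: "continuous_on A dinv_phi"
  unfolding dinv_phi_def[abs_def] by (intro continuous_intros dphi_continuous phi_continuous) simp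

text \<open>Integration by parts over a full period; the boundary terms cancel by
  periodicity.\<close>

lemma dinv_phi_coeff:
  "integral {0..2 * pi} (\<lambda>t. dinv_phi t * cis (- (of_int j * t))) / (2 * of_real pi) = \<i> * of_int j * g j"
proof -
  let ?h = "\<lambda>t. inverse (\<phi> (cis t))" and ?I = "{0..2 * pi}"
  have hc: "continuous_on ?I ?h" by (intro continuous_intros phi_continuous) simp
  have i1: "((\<lambda>t. dinv_phi t * cis (- (of_int j * t))) has_integral integral ?I (\<lambda>t. dinv_phi t * cis (- (of_int j * t)))) ?I"
    by (intro integrable_integral integrable_continuous_real continuous_intros dinv_phi_continuous)
  have i2: "((\<lambda>t. ?h t * cis (- (of_int j * t))) has_integral 2 * of_real pi * g j) ?I"
    using integrable_integral[OF integrable_continuous_real, of 0 "2 * pi" "\<lambda>t. ?h t * cis (- (of_int j * t))"] hc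
    by (simp add: fourier_coeff_def continuous_intros)
  have "((\<lambda>t. ?h t * (of_real (- of_int j) * (\<i> * cis (- of_int j * t))) + dinv_phi t * cis (- of_int j * t)) has_integral
      ?h (2 * pi) * cis (- of_int j * (2 * pi)) - ?h 0 * cis (- of_int j * 0)) ?I"
    by (rule fundamental_theorem_of_calculus, simp)
       (rule has_vector_derivative_mult[OF has_vector_derivative_at_within[OF inverse_phi_deriv]
          has_vector_derivative_cis[of "- of_int j"]])
  moreover have "cis (- of_int j * (2 * pi)) = 1"
    using cis_multiple_2pi[of "of_int (- j)"] by (simp add: mult_ac)
  ultimately have X: "((\<lambda>t. ?h t * (of_real (- of_int j) * (\<i> * cis (- of_int j * t))) + dinv_phi t * cis (- of_int j * t)) has_integral 0) ?I"
    by simp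
  have Y: "((\<lambda>t. (- \<i> * of_int j) * (?h t * cis (- (of_int j * t))) + dinv_phi t * cis (- (of_int j * t))) has_integral
     (- \<i> * of_int j) * (2 * of_real pi * g j) + integral ?I (\<lambda>t. dinv_phi t * cis (- (of_int j * t)))) ?I"
    by (intro has_integral_add has_integral_mult_right i1 i2)
  have E: "(\<lambda>t. ?h t * (of_real (- of_int j) * (\<i> * cis (- of_int j * t))) + dinv_phi t * cis (- of_int j * t)) =
     (\<lambda>t. (- \<i> * of_int j) * (?h t * cis (- (of_int j * t))) + dinv_phi t * cis (- (of_int j * t)))"
    by (simp add: fun_eq_iff mult_ac)
  from has_integral_unique[OF X[unfolded E] Y]
  have "0 = (- \<i> * of_int j) * (2 * of_real pi * g j) + integral ?I (\<lambda>t. dinv_phi t * cis (- (of_int j * t)))" .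
  then have "integral ?I (\<lambda>t. dinv_phi t * cis (- (of_int j * t))) = - ((- \<i> * of_int j) * (2 * of_real pi * g j))"
    by (simp only: eq_neg_iff_add_eq_0 add.commute)
  then show ?thesis by simp
qed

text \<open>Wiener's lemma is not needed for the inverse: it is continuously differentiable, and Bessel's
  inequality for its derivative makes its Fourier coefficients summable.\<close>
lemma g_summable: "g summable_on UNIV"
proof (rule abs_summable_summable, rule summable_on_comparison_test)
  let ?d = "\<lambda>j :: int. \<i> * of_int j * g j"
  have d: "(\<lambda>j. (norm (?d j))\<^sup>2) summable_on UNIV"
  proof (rule nonneg_bdd_above_summable_on)
    show "bdd_above (sum (\<lambda>j. (norm (?d j))\<^sup>2) ` {F. F \<subseteq> UNIV \<and> finite F})"
      by (rule bdd_aboveI2, rule bessel[OF dinv_phi_continuous _ dinv_phi_coeff[symmetric]]) simp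
  qed simp
  \<comment> \<open>At j = 0 the first two summands are 0, since 1 / 0 = 0, and the last one carries
    g 0.\<close>
  show "(\<lambda>j. ((norm (?d j))\<^sup>2 + 1 / (real_of_int j)\<^sup>2) + (if j = 0 then norm (g 0) else 0)) summable_on UNIV"
    by (intro summable_on_add d summable_inverse_int_squares finite_nonzero_values_imp_summable_on)
       (auto intro: finite_subset[of _ "{0}"])
  fix j :: int
  show "norm (g j) \<le> ((norm (?d j))\<^sup>2 + 1 / (real_of_int j)\<^sup>2) + (if j = 0 then norm (g 0) else 0)"
  proof (cases "j = 0")
    case False
    let ?x = "norm (?d j)" and ?y = "1 / \<bar>real_of_int j\<bar>"
    have "norm (g j) = ?x * ?y" using False by (simp add: norm_mult)
    also have "\<dots> \<le> ?x\<^sup>2 + ?y\<^sup>2"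
    proof -
      have amgm: "x * y \<le> x\<^sup>2 + y\<^sup>2" if "0 \<le> x" "0 \<le> y" for x y :: real
        using sum_squares_bound[of x y] mult_nonneg_nonneg[OF that] by linarith
      show ?thesis by (rule amgm) simp_all
    qed
    also have "?y\<^sup>2 = 1 / (real_of_int j)\<^sup>2" by (simp add: power_divide)
    finally show ?thesis using False by simp
  qed simp
qed simp

lemma inverse_phi_fourier_sum: "inverse (\<phi> (cis t)) = fourier_sum g t"
  using nonzero by (intro fourier_series[OF _ g_summable] continuous_intros cont) auto

sublocale sp: symbol_pair f g
proof
  show "f summable_on UNIV" "g summable_on UNIV" "(\<lambda>m. of_int m * f m) summable_on UNIV"
    by (fact f_summable g_summable weighted)+
  have "fourier_sum f t * fourier_sum g t = 1" "fourier_sum g t * fourier_sum f t = 1" for t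
    unfolding phi_fourier_sum[symmetric] inverse_phi_fourier_sum[symmetric] by simp_all
  then show "(\<Sum>\<^sub>\<infinity>l. f (m - l) * g l) = (if m = 0 then 1 else 0)"
    "(\<Sum>\<^sub>\<infinity>l. g (m - l) * f l) = (if m = 0 then 1 else 0)" for m
    by (intro fourier_sum_convolution f_summable g_summable; simp)+
qed

lemma log_deriv_integral:
  "integral {0..2 * pi} (\<lambda>t. dphi t * inverse (\<phi> (cis t))) = 2 * of_real pi * \<i> * sp.log_residue"
proof -
  have hc: "continuous_on {0..2 * pi} (\<lambda>t. inverse (\<phi> (cis t)))"
    by (intro continuous_intros phi_continuous) simp
  have "((\<lambda>j. \<i> * (of_int j * f j) * integral {0..2 * pi} (\<lambda>t. cis (of_int j * t) * inverse (\<phi> (cis t)))) has_sum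
      integral {0..2 * pi} (\<lambda>t. dphi t * inverse (\<phi> (cis t)))) UNIV"
    unfolding dphi_def by (intro fourier_sum_integral summable_on_cmult_right weighted hc)
  moreover have "integral {0..2 * pi} (\<lambda>t. cis (of_int j * t) * inverse (\<phi> (cis t))) = 2 * of_real pi * g (- j)" for j
    by (simp add: fourier_coeff_def mult.commute)
  ultimately have "((\<lambda>j. (2 * of_real pi * \<i>) * (of_int j * f j * g (- j))) has_sum
      integral {0..2 * pi} (\<lambda>t. dphi t * inverse (\<phi> (cis t)))) UNIV"
    by (simp add: mult_ac)
  from infsumI[OF this] show ?thesis
    unfolding sp.log_residue_def infsum_cmult_right' by simp
qed

text \<open>The image path is C1, so its winding number is the integral of the logarithmic
  derivative, rescaled to the unit interval. The path is closed, so this is an integer, which gives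
  the description in \<open>wind\<close> its unique value.\<close>

lemma log_residue_eq_wind: "sp.log_residue = of_int (wind \<phi>)"
proof -
  let ?c = "\<phi> \<circ> circlepath 0 1"
  have c: "?c = (\<lambda>x. \<phi> (cis (2 * pi * x)))"
    by (simp add: fun_eq_iff circlepath cis_conv_exp mult_ac)
  have deriv: "(?c has_vector_derivative (2 * pi) *\<^sub>R dphi (2 * pi * x)) (at x)" for x
  proof -
    have "((\<lambda>x. 2 * pi * x) has_vector_derivative 2 * pi) (at x)"
      by (auto intro!: derivative_eq_intros simp: has_real_derivative_iff_has_vector_derivative[symmetric])
    from vector_diff_chain_at[OF this phi_deriv] show ?thesis unfolding c by (simp add: o_def)
  qed
  have valid: "valid_path ?c"
    unfolding valid_path_def
  proof (rule C1_differentiable_imp_piecewise)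
    show "?c C1_differentiable_on {0..1}"
      unfolding C1_differentiable_on_def
      by (intro exI[of _ "\<lambda>x. (2 * pi) *\<^sub>R dphi (2 * pi * x)"] conjI ballI deriv continuous_intros
          continuous_on_compose2[OF dphi_continuous[of UNIV]]) auto
  qed
  have nz: "0 \<notin> path_image ?c" by (auto simp: path_image_def c)
  have closed: "pathfinish ?c = pathstart ?c" by (simp add: pathfinish_def pathstart_def c)
  have "winding_number ?c 0 = 1 / (2 * pi * \<i>) * contour_integral ?c (\<lambda>w. 1 / (w - 0))"
    by (rule winding_number_valid_path[OF valid nz])
  also have "contour_integral ?c (\<lambda>w. 1 / (w - 0)) =
      integral {0..1} (\<lambda>x. (2 * pi) *\<^sub>R (dphi (2 * pi * x) * inverse (\<phi> (cis (2 * pi * x)))))"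
    unfolding contour_integral_integral vector_derivative_at[OF deriv]
    by (simp add: c divide_inverse scaleR_conv_of_real mult_ac)
  also have "\<dots> = integral {0..2 * pi} (\<lambda>t. dphi t * inverse (\<phi> (cis t)))"
  proof -
    have "((\<lambda>t. dphi t * inverse (\<phi> (cis t))) has_integral integral {0..2 * pi} (\<lambda>t. dphi t * inverse (\<phi> (cis t)))) {0..2 * pi}"
      by (intro integrable_integral integrable_continuous_real continuous_intros dphi_continuous phi_continuous) simp
    from has_integral_stretch_real[OF this, of "2 * pi"]
    have "((\<lambda>x. dphi (2 * pi * x) * inverse (\<phi> (cis (2 * pi * x)))) has_integral
        (1 / (2 * pi)) *\<^sub>R integral {0..2 * pi} (\<lambda>t. dphi t * inverse (\<phi> (cis t)))) {0..1}"
      by (simp add: image_divide_atLeastAtMost)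
    from integral_unique[OF has_integral_cmul[OF this, of "2 * pi"]] show ?thesis
      by simp
  qed
  finally have "winding_number ?c 0 = 1 / (2 * pi * \<i>) * (2 * of_real pi * \<i> * sp.log_residue)"
    unfolding log_deriv_integral .
  then have w: "winding_number ?c 0 = sp.log_residue" by (rule trans) simp
  have "winding_number ?c 0 \<in> \<int>"
    by (rule integer_winding_number[OF valid_path_imp_path[OF valid] closed nz])
  then obtain m where m: "winding_number ?c 0 = of_int m" by (elim Ints_cases)
  then have "wind \<phi> = m" unfolding wind_def by (intro the_equality) auto
  with m w show ?thesis by simp
qed

end

section \<open>Fourier expansion of the kernels\<close>

text \<open>2 \<pi> i times the kernel of the operator with matrix \<open>k\<close>; the untruncated
  counterpart of \<open>circ_series\<close>.\<close>

definition double_sum :: "(int \<Rightarrow> int \<Rightarrow> complex) \<Rightarrow> complex \<Rightarrow> complex \<Rightarrow> complex" where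
  "double_sum k z w = (\<Sum>\<^sub>\<infinity>(i, j). k i j * z powi i * w powi (- j - 1))"

lemma norm_powi_unit: "norm z = 1 \<Longrightarrow> norm (z powi i) = 1" for z :: complex
  by (simp add: norm_power_int)

lemma double_sum_has_sum:
  assumes "tc k" "norm z = 1" "norm w = 1"
  shows "((\<lambda>(i, j). k i j * z powi i * w powi (- j - 1)) has_sum double_sum k z w) UNIV"
  unfolding double_sum_def
proof (rule has_sum_infsum)
  show "(\<lambda>(i, j). k i j * z powi i * w powi (- j - 1)) summable_on UNIV"
    using assms unfolding tc_abs
    by (subst summable_on_iff_abs_summable_on_complex) (simp add: case_prod_unfold norm_mult norm_powi_unit)
qed

lemma double_sum_add:
  assumes "tc k" "tc l" "norm z = 1" "norm w = 1"
  shows "double_sum (\<lambda>i j. k i j + l i j) z w = double_sum k z w + double_sum l z w"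
  using infsumI[OF has_sum_add[OF double_sum_has_sum[OF assms(1,3,4)] double_sum_has_sum[OF assms(2,3,4)]]]
  by (simp add: double_sum_def case_prod_unfold distrib_right)

lemma double_sum_cmult: "double_sum (\<lambda>i j. c * k i j) z w = c * double_sum k z w"
  unfolding double_sum_def infsum_cmult_right'[symmetric] by (simp add: case_prod_unfold mult_ac)

lemma double_sum_continuous:
  assumes k: "tc k" and z: "norm z = 1"
  shows "continuous_on (sphere 0 1) (double_sum k z)"
proof -
  have "uniform_limit (sphere 0 1) (\<lambda>X w. \<Sum>x\<in>X. case x of (i, j) \<Rightarrow> k i j * z powi i * w powi (- j - 1))
     (\<lambda>w. \<Sum>\<^sub>\<infinity>x. case x of (i, j) \<Rightarrow> k i j * z powi i * w powi (- j - 1)) (finite_subsets_at_top UNIV)"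
    by (rule Weierstrass_m_test_general[OF _ k[unfolded tc_abs]])
       (auto simp: norm_mult norm_powi_unit z)
  then have "continuous_on (sphere 0 1) (\<lambda>w. \<Sum>\<^sub>\<infinity>x. case x of (i, j) \<Rightarrow> k i j * z powi i * w powi (- j - 1))"
    by (rule uniform_limit_theorem[rotated])
       (auto intro!: always_eventually continuous_intros simp: case_prod_unfold)
  then show ?thesis by (simp add: double_sum_def[abs_def])
qed

lemma laurent_sum_le:
  assumes "f summable_on UNIV" "finite F" "inj h"
  shows "(\<Sum>j\<in>F. norm (f (h j :: int))) \<le> (\<Sum>\<^sub>\<infinity>x. norm (f x :: complex))"
proof -
  have "(\<Sum>j\<in>F. norm (f (h j))) = (\<Sum>x\<in>h ` F. norm (f x))"
    using assms by (simp add: sum.reindex inj_on_subset)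
  then show ?thesis using assms norm_summable[of f UNIV] by (simp add: finite_sum_le_infsum)
qed

text \<open>Right multiplication by a Laurent matrix multiplies the kernel by the function of w:
  with l = k - j the power w^(-j-1) splits as w^(-k-1) w^l. Left multiplication acts likewise on
  z.\<close>

lemma double_sum_mult_laurent_right:
  assumes X: "tc (ent X)" and g: "g summable_on UNIV" and z: "norm z = 1"
  shows "double_sum (ent (X * laurent g)) z (cis t) = double_sum (ent X) z (cis t) * fourier_sum g t"
proof -
  let ?w = "cis t"
  let ?q = "\<lambda>p j. ent X (fst p) (snd p) * g (snd p - j) * z powi (fst p) * ?w powi (- j - 1)"
  have s: "(\<lambda>(p, j). ?q p j) summable_on UNIV"
  proof (rule summable_on_pairs[where a = "\<lambda>p. ent X (fst p) (snd p)" and M = "\<Sum>\<^sub>\<infinity>x. norm (g x)"])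
    show "(\<lambda>p. ent X (fst p) (snd p)) summable_on UNIV" using X by (simp add: tc_def case_prod_unfold)
    fix p :: "int \<times> int" and F :: "int set" assume F: "finite F"
    have "(\<Sum>j\<in>F. norm (?q p j)) = norm (ent X (fst p) (snd p)) * (\<Sum>j\<in>F. norm (g (snd p - j)))"
      by (simp add: norm_mult norm_powi_unit z sum_distrib_left)
    also have "\<dots> \<le> norm (ent X (fst p) (snd p)) * (\<Sum>\<^sub>\<infinity>x. norm (g x))"
      by (intro mult_left_mono laurent_sum_le g F) (auto simp: inj_on_def)
    finally show "(\<Sum>j\<in>F. norm (?q p j)) \<le> norm (ent X (fst p) (snd p)) * (\<Sum>\<^sub>\<infinity>x. norm (g x))" .
  qed
  have s': "(\<lambda>(p, k). ?q (fst p, k) (snd p)) summable_on UNIV \<times> UNIV"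
    by (subst summable_on_reindex_bij_witness[where T = UNIV
        and j = "\<lambda>((i, j), k). ((i, k), j)" and i = "\<lambda>((i, k), j). ((i, j), k)"
        and h = "\<lambda>(p, j). ?q p j"]) (use s in auto)
  have "double_sum (ent (X * laurent g)) z ?w = (\<Sum>\<^sub>\<infinity>p. \<Sum>\<^sub>\<infinity>k. ?q (fst p, k) (snd p))"
    unfolding double_sum_def by (simp add: ent_mult ent_laurent[OF g] case_prod_unfold infsum_cmult_left')
  also have "\<dots> = (\<Sum>\<^sub>\<infinity>(p, k). ?q (fst p, k) (snd p))"
    using infsum_Sigma'_banach[OF s'] by simp
  also have "\<dots> = (\<Sum>\<^sub>\<infinity>(p, j). ?q p j)"
    by (rule infsum_reindex_bij_witness[where j = "\<lambda>((i, j), k). ((i, k), j)" and i = "\<lambda>((i, k), j). ((i, j), k)"]) auto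
  also have "\<dots> = (\<Sum>\<^sub>\<infinity>p. \<Sum>\<^sub>\<infinity>j. ?q p j)"
    using infsum_Sigma'_banach[of ?q UNIV "\<lambda>_. UNIV"] s by simp
  also have "\<dots> = (\<Sum>\<^sub>\<infinity>p. (ent X (fst p) (snd p) * z powi (fst p) * ?w powi (- snd p - 1)) * fourier_sum g t)"
  proof (rule infsum_cong)
    fix p :: "int \<times> int"
    have "(\<Sum>\<^sub>\<infinity>j. ?q p j) = (\<Sum>\<^sub>\<infinity>l. (ent X (fst p) (snd p) * z powi (fst p) * ?w powi (- snd p - 1)) * (g l * cis (of_int l * t)))"
    proof (rule infsum_reindex_bij_witness[where j = "\<lambda>j. snd p - j" and i = "\<lambda>l. snd p - l"])
      fix j
      have e: "?w powi (- snd p - 1) * cis (of_int (snd p - j) * t) = ?w powi (- j - 1)"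
        unfolding cis_power_int cis_mult by (rule arg_cong[where f = cis]) (simp add: algebra_simps)
      have "(ent X (fst p) (snd p) * z powi (fst p) * ?w powi (- snd p - 1)) * (g (snd p - j) * cis (of_int (snd p - j) * t)) =
          ent X (fst p) (snd p) * g (snd p - j) * z powi (fst p) * (?w powi (- snd p - 1) * cis (of_int (snd p - j) * t))"
        by (simp only: mult_ac)
      then show "(ent X (fst p) (snd p) * z powi (fst p) * ?w powi (- snd p - 1)) * (g (snd p - j) * cis (of_int (snd p - j) * t)) = ?q p j"
        unfolding e .
    qed auto
    then show "(\<Sum>\<^sub>\<infinity>j. ?q p j) = (ent X (fst p) (snd p) * z powi (fst p) * ?w powi (- snd p - 1)) * fourier_sum g t"
      by (simp only: infsum_cmult_right' fourier_sum_def)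
  qed
  also have "\<dots> = double_sum (ent X) z ?w * fourier_sum g t"
    unfolding double_sum_def by (simp add: infsum_cmult_left' case_prod_unfold)
  finally show ?thesis .
qed

lemma double_sum_mult_laurent_left:
  assumes X: "tc (ent X)" and f: "f summable_on UNIV" and w: "norm w = 1"
  shows "double_sum (ent (laurent f * X)) (cis s) w = fourier_sum f s * double_sum (ent X) (cis s) w"
proof -
  let ?z = "cis s"
  let ?q = "\<lambda>p i. f (i - fst p) * ent X (fst p) (snd p) * ?z powi i * w powi (- snd p - 1)"
  have s: "(\<lambda>(p, i). ?q p i) summable_on UNIV"
  proof (rule summable_on_pairs[where a = "\<lambda>p. ent X (fst p) (snd p)" and M = "\<Sum>\<^sub>\<infinity>x. norm (f x)"])
    show "(\<lambda>p. ent X (fst p) (snd p)) summable_on UNIV" using X by (simp add: tc_def case_prod_unfold)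
    fix p :: "int \<times> int" and F :: "int set" assume F: "finite F"
    have "(\<Sum>i\<in>F. norm (?q p i)) = norm (ent X (fst p) (snd p)) * (\<Sum>i\<in>F. norm (f (i - fst p)))"
      by (simp add: norm_mult norm_powi_unit w sum_distrib_left mult.commute)
    also have "\<dots> \<le> norm (ent X (fst p) (snd p)) * (\<Sum>\<^sub>\<infinity>x. norm (f x))"
      by (intro mult_left_mono laurent_sum_le f F) (auto simp: inj_on_def)
    finally show "(\<Sum>i\<in>F. norm (?q p i)) \<le> norm (ent X (fst p) (snd p)) * (\<Sum>\<^sub>\<infinity>x. norm (f x))" .
  qed
  have s': "(\<lambda>(p, k). ?q (k, snd p) (fst p)) summable_on UNIV \<times> UNIV"
    by (subst summable_on_reindex_bij_witness[where T = UNIV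
        and j = "\<lambda>((i, j), k). ((k, j), i)" and i = "\<lambda>((k, j), i). ((i, j), k)"
        and h = "\<lambda>(p, i). ?q p i"]) (use s in auto)
  have "double_sum (ent (laurent f * X)) ?z w = (\<Sum>\<^sub>\<infinity>p. \<Sum>\<^sub>\<infinity>k. ?q (k, snd p) (fst p))"
    unfolding double_sum_def by (simp add: ent_mult ent_laurent[OF f] case_prod_unfold infsum_cmult_left')
  also have "\<dots> = (\<Sum>\<^sub>\<infinity>(p, k). ?q (k, snd p) (fst p))"
    using infsum_Sigma'_banach[OF s'] by simp
  also have "\<dots> = (\<Sum>\<^sub>\<infinity>(p, i). ?q p i)"
    by (rule infsum_reindex_bij_witness[where j = "\<lambda>((i, j), k). ((k, j), i)" and i = "\<lambda>((k, j), i). ((i, j), k)"]) auto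
  also have "\<dots> = (\<Sum>\<^sub>\<infinity>p. \<Sum>\<^sub>\<infinity>i. ?q p i)"
    using infsum_Sigma'_banach[of ?q UNIV "\<lambda>_. UNIV"] s by simp
  also have "\<dots> = (\<Sum>\<^sub>\<infinity>p. fourier_sum f s * (ent X (fst p) (snd p) * ?z powi (fst p) * w powi (- snd p - 1)))"
  proof (rule infsum_cong)
    fix p :: "int \<times> int"
    have "(\<Sum>\<^sub>\<infinity>i. ?q p i) = (\<Sum>\<^sub>\<infinity>l. (f l * cis (of_int l * s)) * (ent X (fst p) (snd p) * ?z powi (fst p) * w powi (- snd p - 1)))"
    proof (rule infsum_reindex_bij_witness[where j = "\<lambda>i. i - fst p" and i = "\<lambda>l. l + fst p"])
      fix i
      have e: "cis (of_int (i - fst p) * s) * ?z powi (fst p) = ?z powi i"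
        unfolding cis_power_int cis_mult by (rule arg_cong[where f = cis]) (simp add: algebra_simps)
      have "(f (i - fst p) * cis (of_int (i - fst p) * s)) * (ent X (fst p) (snd p) * ?z powi (fst p) * w powi (- snd p - 1)) =
          f (i - fst p) * ent X (fst p) (snd p) * (cis (of_int (i - fst p) * s) * ?z powi (fst p)) * w powi (- snd p - 1)"
        by (simp only: mult_ac)
      then show "(f (i - fst p) * cis (of_int (i - fst p) * s)) * (ent X (fst p) (snd p) * ?z powi (fst p) * w powi (- snd p - 1)) = ?q p i"
        unfolding e .
    qed auto
    then show "(\<Sum>\<^sub>\<infinity>i. ?q p i) = fourier_sum f s * (ent X (fst p) (snd p) * ?z powi (fst p) * w powi (- snd p - 1))"
      by (simp only: infsum_cmult_left' fourier_sum_def)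
  qed
  also have "\<dots> = fourier_sum f s * double_sum (ent X) ?z w"
    unfolding double_sum_def by (simp add: infsum_cmult_right' case_prod_unfold)
  finally show ?thesis .
qed

lemma telescope_int:
  fixes u :: "int \<Rightarrow> 'a :: ab_group_add"
  assumes "a \<le> b"
  shows "(\<Sum>j\<in>{a..<b}. u (j + 1) - u j) = u b - u a"
  using assms
proof (induction b rule: int_ge_induct)
  case (step b)
  have "{a..<b + 1} = insert b {a..<b}" using step.hyps by auto
  then show ?case using step by simp
qed simp

text \<open>A geometric sum in a form without division, so that it also holds at z = w. The shift m
  serves the diagonals of the commutator, and m = 0 the difference of two projections.\<close>

lemma kernel_telescope:
  fixes z w :: complex
  assumes "z \<noteq> 0" "w \<noteq> 0" "a \<le> b"
  shows "(z - w) * (\<Sum>j\<in>{a..<b}. z powi (m + j) * w powi (- j - 1)) =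
     z powi (m + b) * w powi (- b) - z powi (m + a) * w powi (- a)"
proof -
  let ?u = "\<lambda>j. z powi (m + j) * w powi (- j)"
  have "(z - w) * (z powi (m + j) * w powi (- j - 1)) = ?u (j + 1) - ?u j" for j
  proof -
    have "z powi (m + (j + 1)) = z powi (m + j) * z"
      using power_int_add_1[of z "m + j"] assms by (simp add: add.assoc)
    moreover have "w powi (- j) = w powi (- j - 1) * w"
      using power_int_add_1[of w "- j - 1"] assms by simp
    moreover have "- (j + 1) = - j - 1" by simp
    ultimately show ?thesis by (simp only: left_diff_distrib mult_ac)
  qed
  then show ?thesis
    unfolding sum_distrib_left using telescope_int[OF assms(3), of ?u] by simp
qed

definition proj_ge :: "int \<Rightarrow> schur" where "proj_ge n = diag_op (\<lambda>i. if i < n then 0 else 1)"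

lemma ent_proj_ge: "ent (proj_ge n) i j = (if i = j \<and> n \<le> i then 1 else 0)"
proof -
  have "bounded (range (\<lambda>i. if i < n then 0 else (1 :: complex)))"
    by (rule finite_imp_bounded, rule finite_subset[of _ "{0, 1}"]) auto
  then show ?thesis by (simp add: proj_ge_def ent_diag_op del: image_Un)
qed

context circle_symbol
begin

text \<open>The kernel of the commutator is the negative difference quotient of \<phi>: the diagonal
  i - j = m telescopes to -f(m) (z^m - w^m), and the sum over m restores \<phi>.\<close>

lemma double_sum_hankel:
  "(cis s - cis t) * double_sum (ent sp.hankel) (cis s) (cis t) = - (\<phi> (cis s) - \<phi> (cis t))"
proof -
  let ?z = "cis s" and ?w = "cis t"
  let ?q = "\<lambda>m j. ent sp.hankel (m + j) j * ?z powi (m + j) * ?w powi (- j - 1)"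
  have h: "((\<lambda>(i, j). ent sp.hankel i j * ?z powi i * ?w powi (- j - 1)) has_sum double_sum (ent sp.hankel) ?z ?w) UNIV"
    by (rule double_sum_has_sum[OF sp.tc_hankel]) simp_all
  have q: "((\<lambda>(m, j). ?q m j) has_sum double_sum (ent sp.hankel) ?z ?w) (UNIV \<times> UNIV)"
    using h
    by (subst has_sum_reindex_bij_witness[where T = UNIV and j = "\<lambda>(m, j). (m + j, j)" and i = "\<lambda>(i, j). (i - j, j)"
        and h = "\<lambda>(i, j). ent sp.hankel i j * ?z powi i * ?w powi (- j - 1)"]) auto
  have sq: "(\<lambda>(m, j). ?q m j) summable_on UNIV \<times> UNIV" using q by (rule has_sum_imp_summable)
  have inner: "(?z - ?w) * (\<Sum>\<^sub>\<infinity>j. ?q m j) = - (f m * ?z powi m - f m * ?w powi m)" for m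
  proof -
    define S where "S = {j. (m + j < 0) \<noteq> (j < (0::int))}"
    have fS: "finite S" unfolding S_def sp.sign_change by auto
    have "(\<Sum>\<^sub>\<infinity>j. ?q m j) = (\<Sum>\<^sub>\<infinity>j\<in>S. - of_int (sgn m) * f m * (?z powi (m + j) * ?w powi (- j - 1)))"
      by (rule infsum_cong_neutral) (auto simp: sp.ent_hankel sgn_if S_def)
    also have "\<dots> = - of_int (sgn m) * f m * (\<Sum>j\<in>S. ?z powi (m + j) * ?w powi (- j - 1))"
      using fS by (simp add: sum_distrib_left)
    finally have e: "(?z - ?w) * (\<Sum>\<^sub>\<infinity>j. ?q m j) =
       - of_int (sgn m) * f m * ((?z - ?w) * (\<Sum>j\<in>S. ?z powi (m + j) * ?w powi (- j - 1)))"
      by (simp only: mult_ac)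
    show ?thesis
    proof (cases "m \<ge> 0")
      case True
      then have "S = {-m..<0}" unfolding S_def sp.sign_change by simp
      then show ?thesis
        unfolding e using True kernel_telescope[of ?z ?w "- m" 0 m]
        by (cases "m = 0") (simp_all add: right_diff_distrib)
    next
      case False
      then have "S = {0..<-m}" unfolding S_def sp.sign_change by simp
      then show ?thesis
        unfolding e using False kernel_telescope[of ?z ?w 0 "- m" m]
        by (simp add: right_diff_distrib)
    qed
  qed
  have "double_sum (ent sp.hankel) ?z ?w = (\<Sum>\<^sub>\<infinity>m. \<Sum>\<^sub>\<infinity>j. ?q m j)"
    using infsumI[OF q] infsum_Sigma'_banach[OF sq] by simp
  then have "(?z - ?w) * double_sum (ent sp.hankel) ?z ?w = (\<Sum>\<^sub>\<infinity>m. (?z - ?w) * (\<Sum>\<^sub>\<infinity>j. ?q m j))"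
    by (simp add: infsum_cmult_right')
  also have "\<dots> = - (fourier_sum f s - fourier_sum f t)"
  proof -
    note u = fourier_sum_has_sum[OF f_summable]
    have "((\<lambda>m. - (f m * cis (of_int m * s) - f m * cis (of_int m * t))) has_sum - (fourier_sum f s - fourier_sum f t)) UNIV"
      using has_sum_uminusI[OF has_sum_add[OF u[of s] has_sum_uminusI[OF u[of t]]]] by simp
    then show ?thesis unfolding inner unfolding cis_power_int by (rule infsumI)
  qed
  finally show ?thesis by (simp add: phi_fourier_sum)
qed

definition "kernel_op n = sp.Phi * proj_ge n * sp.Phii - proj_ge 0"

text \<open>The defining difference does not display summability. Here the first term contains the
  commutator and the second a finite diagonal matrix.\<close>

lemma kernel_op_decomp:
  "kernel_op n = sp.hankel * sp.Phii - sp.Phi * (proj_ge 0 - proj_ge n) * sp.Phii"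
proof -
  have Q: "proj_neg = 1 - proj_ge 0"
    by (rule schur_eqI) (simp add: proj_neg_def ent_proj_ge ent_diag_op bounded_range_sign0 del: image_Un)
  have "sp.hankel = sp.Phi * proj_ge 0 - proj_ge 0 * sp.Phi"
    unfolding sp.hankel_def Q by (simp add: left_diff_distrib right_diff_distrib)
  then show ?thesis
    by (simp add: kernel_op_def left_diff_distrib right_diff_distrib mult.assoc)
qed

lemma tc_proj_ge_diff: "tc (ent (proj_ge 0 - proj_ge n))"
proof -
  have "finite ((\<lambda>i. (i, i)) ` ({0..<n} \<union> {n..<0}))" by simp
  then show ?thesis
    unfolding tc_def
    by (rule finite_nonzero_values_imp_summable_on[OF finite_subset[rotated]])
       (auto simp: ent_proj_ge split: if_splits)
qed

lemma tc_kernel_op: "tc (ent (kernel_op n))"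
  unfolding kernel_op_decomp by (intro tc_minus tc_mult_right tc_mult_left sp.tc_hankel tc_proj_ge_diff)

lemma double_sum_kernel_op:
  assumes n: "0 \<le> n"
  shows "(cis s - cis t) * double_sum (ent (kernel_op n)) (cis s) (cis t) =
    1 - cis s powi n * \<phi> (cis s) * cis t powi (- n) * inverse (\<phi> (cis t))"
proof -
  let ?z = "cis s" and ?w = "cis t"
  let ?E = "proj_ge 0 - proj_ge n"
  have E: "(?z - ?w) * double_sum (ent ?E) ?z ?w = ?z powi n * ?w powi (- n) - 1"
  proof -
    have "double_sum (ent ?E) ?z ?w = (\<Sum>\<^sub>\<infinity>(i, j)\<in>(\<lambda>i. (i, i)) ` {0..<n}. ?z powi i * ?w powi (- j - 1))"
      unfolding double_sum_def using n by (intro infsum_cong_neutral) (auto simp: ent_proj_ge split: if_splits)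
    also have "\<dots> = (\<Sum>i\<in>{0..<n}. ?z powi (0 + i) * ?w powi (- i - 1))"
      by (simp add: sum.reindex inj_on_def)
    finally show ?thesis using kernel_telescope[of ?z ?w 0 n 0] n by simp
  qed
  have dec: "ent (kernel_op n) = (\<lambda>i j. ent (sp.hankel * sp.Phii) i j + (-1) * ent (sp.Phi * ?E * sp.Phii) i j)"
    by (simp add: kernel_op_decomp fun_eq_iff)
  have "double_sum (ent (kernel_op n)) ?z ?w = double_sum (ent (sp.hankel * sp.Phii)) ?z ?w - double_sum (ent (sp.Phi * ?E * sp.Phii)) ?z ?w"
  proof -
    have "tc (\<lambda>i j. (-1) * ent (sp.Phi * ?E * sp.Phii) i j)"
      using tc_mult_right[OF tc_mult_left[OF tc_proj_ge_diff[of n]], of sp.Phi sp.Phii] by (simp add: tc_abs)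
    then show ?thesis
      unfolding dec by (subst double_sum_add) (simp_all only: double_sum_cmult tc_mult_right sp.tc_hankel norm_cis, simp)
  qed
  also have "double_sum (ent (sp.hankel * sp.Phii)) ?z ?w = double_sum (ent sp.hankel) ?z ?w * inverse (\<phi> ?w)"
    unfolding sp.Phii_def inverse_phi_fourier_sum by (rule double_sum_mult_laurent_right[OF sp.tc_hankel g_summable]) simp
  also have "double_sum (ent (sp.Phi * ?E * sp.Phii)) ?z ?w = \<phi> ?z * double_sum (ent ?E) ?z ?w * inverse (\<phi> ?w)"
    unfolding sp.Phii_def sp.Phi_def inverse_phi_fourier_sum unfolding phi_fourier_sum
    by (subst double_sum_mult_laurent_right[OF _ g_summable])
       (simp_all only: double_sum_mult_laurent_left f_summable tc_mult_left tc_proj_ge_diff norm_cis)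
  finally have "double_sum (ent (kernel_op n)) ?z ?w = double_sum (ent sp.hankel) ?z ?w * inverse (\<phi> ?w) -
      \<phi> ?z * double_sum (ent ?E) ?z ?w * inverse (\<phi> ?w)" .
  then have "(?z - ?w) * double_sum (ent (kernel_op n)) ?z ?w =
     ((?z - ?w) * double_sum (ent sp.hankel) ?z ?w) * inverse (\<phi> ?w) - \<phi> ?z * ((?z - ?w) * double_sum (ent ?E) ?z ?w) * inverse (\<phi> ?w)"
    by (simp only: right_diff_distrib mult_ac)
  then show ?thesis
    unfolding E double_sum_hankel by (simp add: field_simps)
qed

text \<open>Off the diagonal one divides by z - w. On it \<open>K_kernel\<close> is a limit along
  the circle, and the absolutely convergent double series is continuous in w and supplies that
  limit.\<close>

lemma K_kernel_eq_double_sum: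
  assumes n: "0 \<le> n"
  shows "K_kernel \<phi> n (cis s) (cis t) = double_sum (ent (kernel_op n)) (cis s) (cis t) / (2 * of_real pi * \<i>)"
proof -
  have formula: "K_formula \<phi> n (cis s) (cis u) = double_sum (ent (kernel_op n)) (cis s) (cis u) / (2 * of_real pi * \<i>)"
    if "cis s \<noteq> cis u" for u
    using that unfolding K_formula_def double_sum_kernel_op[OF n, symmetric] by simp
  show ?thesis
  proof (cases "cis s = cis t")
    case False
    then show ?thesis by (simp add: K_kernel_def formula)
  next
    case True
    let ?z = "cis s" and ?S = "sphere (0 :: complex) 1"
    have zS: "?z \<in> ?S" by simp
    \<comment> \<open>The value of \<open>Lim\<close> is determined only if the filter is
      nontrivial, that is, if the point is not isolated in the circle.\<close>
    have "?z islimpt ?S"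
    proof (rule connected_imp_perfect[OF connected_sphere zS])
      show "2 \<le> DIM(complex)" by simp
      show "?S \<noteq> {x}" for x
      proof
        assume "?S = {x}"
        moreover have "1 \<in> ?S" "-1 \<in> ?S" by simp_all
        ultimately have "(1 :: complex) = -1" by auto
        then show False by simp
      qed
    qed
    then have nb: "at ?z within ?S \<noteq> bot" by (simp add: trivial_limit_within)
    have "((\<lambda>w. double_sum (ent (kernel_op n)) ?z w / (2 * of_real pi * \<i>)) \<longlongrightarrow> double_sum (ent (kernel_op n)) ?z ?z / (2 * of_real pi * \<i>)) (at ?z within ?S)"
      using double_sum_continuous[OF tc_kernel_op, of ?z] zS unfolding continuous_on_def by (intro tendsto_divide) auto
    moreover have "eventually (\<lambda>w. double_sum (ent (kernel_op n)) ?z w / (2 * of_real pi * \<i>) = K_formula \<phi> n ?z w) (at ?z within ?S)"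
    proof -
      have "double_sum (ent (kernel_op n)) ?z w / (2 * of_real pi * \<i>) = K_formula \<phi> n ?z w" if w: "w \<in> ?S" "w \<noteq> ?z" for w
      proof -
        obtain u where "w = cis u" using unit_complex_cis[OF w(1)] by metis
        then show ?thesis using formula[of u] w(2) by simp
      qed
      then show ?thesis by (auto simp: eventually_at_filter)
    qed
    ultimately have "((\<lambda>w. K_formula \<phi> n ?z w) \<longlongrightarrow> double_sum (ent (kernel_op n)) ?z ?z / (2 * of_real pi * \<i>)) (at ?z within ?S)"
      by (rule Lim_transform_eventually)
    from tendsto_Lim[OF nb this] show ?thesis using True by (simp add: K_kernel_def)
  qed
qed

lemma ent_S: "ent (sp.Phii * proj_neg * sp.Phi) a b = S_matrix \<phi> a b"
proof -
  have e: "ent (sp.Phii * proj_neg * sp.Phi) a b = (\<Sum>\<^sub>\<infinity>l. g (a - l) * (if l < 0 then 1 else 0) * f (l - b))"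
    unfolding ent_mult[of "sp.Phii * proj_neg"] unfolding proj_neg_def ent_diag_op_mult(2)[OF bounded_range_sign0]
    by (simp add: sp.Phii_def sp.Phi_def ent_laurent f_summable g_summable)
  have s: "(\<lambda>l. g (a - l) * (if l < 0 then 1 else 0) * f (l - b)) summable_on UNIV"
    using ent_mult_summable[of "sp.Phii * proj_neg" a sp.Phi b]
    unfolding proj_neg_def ent_diag_op_mult(2)[OF bounded_range_sign0]
    by (simp add: sp.Phii_def sp.Phi_def ent_laurent f_summable g_summable)
  let ?h = "\<lambda>k :: nat. g (a + int (Suc k)) * f (- b - int (Suc k))"
  have "((\<lambda>l. g (a - l) * (if l < 0 then 1 else 0) * f (l - b)) has_sum ent (sp.Phii * proj_neg * sp.Phi) a b) UNIV"
    unfolding e using s by (rule has_sum_infsum)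
  also have "?this \<longleftrightarrow> ((\<lambda>l. g (a - l) * f (l - b)) has_sum ent (sp.Phii * proj_neg * sp.Phi) a b) {..<0}"
    by (rule has_sum_cong_neutral) auto
  \<comment> \<open>The negative frequencies selected by Q are l = -(k + 1) with k a natural number;
    this is the sum over k \<ge> 1 in the matrix S.\<close>
  also have "\<dots> \<longleftrightarrow> (?h has_sum ent (sp.Phii * proj_neg * sp.Phi) a b) UNIV"
    by (rule has_sum_reindex_bij_witness[where i = "\<lambda>k. - int (Suc k)" and j = "\<lambda>l. nat (- l - 1)"])
       (auto simp: algebra_simps)
  finally have "?h sums ent (sp.Phii * proj_neg * sp.Phi) a b" by (rule has_sum_imp_sums)
  then show ?thesis by (simp add: S_matrix_def sums_iff)
qed

end

section \<open>The step function\<close>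

locale step_data =
  fixes k :: nat and n :: "nat \<Rightarrow> int" and s :: "nat \<Rightarrow> complex"
  assumes n0: "n 0 = 0" and n_mono: "\<forall>j<k. n j \<le> n (Suc j)" and s0: "s 0 = 0"
begin

definition "step_value i = (\<Sum>j=1..k. (s j - s (j - 1)) * (if n j \<le> i then 1 else 0))"

lemma n_le: "i \<le> j \<Longrightarrow> j \<le> k \<Longrightarrow> n i \<le> n j"
proof (induction j rule: dec_induct)
  case (step m)
  then show ?case using n_mono[rule_format, of m] by simp
qed simp

lemma n_nonneg: "j \<le> k \<Longrightarrow> 0 \<le> n j"
  using n_le[of 0 j] n0 by simp

lemma step_value_neg: "i < 0 \<Longrightarrow> step_value i = 0"
  unfolding step_value_def using n_nonneg by (intro sum.neutral) force

text \<open>The block containing i belongs to the largest m with n m \<le> i, which skips empty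
  blocks when thresholds coincide. The infinite last block is encoded by dropping the upper bound at
  j = k. The sum of increments then telescopes.\<close>

lemma step_index:
  assumes i: "0 \<le> i"
  obtains m where "m \<le> k" "n m \<le> i" "step_value i = s m"
    "\<forall>j\<le>k. n j \<le> i \<and> (j < k \<longrightarrow> i < n (Suc j)) \<longleftrightarrow> j = m"
proof
  define m where "m = Max {j. j \<le> k \<and> n j \<le> i}"
  have fin: "finite {j. j \<le> k \<and> n j \<le> i}" by simp
  have "0 \<in> {j. j \<le> k \<and> n j \<le> i}" using n0 i by simp
  then have "m \<in> {j. j \<le> k \<and> n j \<le> i}" unfolding m_def using fin by (intro Max_in) auto
  then show m: "m \<le> k" "n m \<le> i" by auto
  have max: "j \<le> m" if "j \<le> k" "n j \<le> i" for j
    unfolding m_def using fin that by (intro Max_ge) auto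
  have iff: "n j \<le> i \<longleftrightarrow> j \<le> m" if "j \<le> k" for j
    using max[OF that] n_le[of j m] m by force
  have "step_value i = (\<Sum>j=1..m. s j - s (j - 1))"
    unfolding step_value_def using m iff by (intro sum.mono_neutral_cong_right) auto
  also have "\<dots> = s m - s 0"
    by (induction m) (auto simp: sum.nat_ivl_Suc')
  finally show "step_value i = s m" by (simp add: s0)
  show "\<forall>j\<le>k. n j \<le> i \<and> (j < k \<longrightarrow> i < n (Suc j)) \<longleftrightarrow> j = m"
  proof (intro allI impI)
    fix j assume that: "j \<le> k"
    have "j < k \<Longrightarrow> i < n (Suc j) \<longleftrightarrow> m < Suc j" using iff[of "Suc j"] by force
    then show "n j \<le> i \<and> (j < k \<longrightarrow> i < n (Suc j)) \<longleftrightarrow> j = m" using iff[OF that] m(1) that by force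
  qed
qed

lemma step_value_large: "n k \<le> i \<Longrightarrow> step_value i = s k"
proof -
  assume i: "n k \<le> i"
  then have "0 \<le> i" using n_nonneg[of k] by simp
  then obtain m where "m \<le> k" "n m \<le> i" "step_value i = s m" "\<forall>j\<le>k. n j \<le> i \<and> (j < k \<longrightarrow> i < n (Suc j)) \<longleftrightarrow> j = m"
    by (rule step_index)
  with i show ?thesis by auto
qed

lemma step_value_in: "\<exists>m\<le>k. step_value i = s m"
proof (cases "0 \<le> i")
  case True
  then show ?thesis using step_index by metis
next
  case False
  then show ?thesis using step_value_neg[of i] s0 by (intro exI[of _ 0]) simp
qed

lemma finite_range_step_value: "finite (range step_value)"
proof (rule finite_subset)
  show "range step_value \<subseteq> s ` {..k}" using step_value_in by fastforce
qed simp

lemma step_value_quotient: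
  "(\<Sum>j=1..k. (s k * s j / (1 + s k - s j)) * (if n j \<le> i \<and> (j < k \<longrightarrow> i < n (Suc j)) then 1 else 0)) =
   s k * step_value i / (1 + s k - step_value i)"
proof (cases "0 \<le> i")
  case True
  then obtain m where m: "m \<le> k" "n m \<le> i" "step_value i = s m"
    "\<forall>j\<le>k. n j \<le> i \<and> (j < k \<longrightarrow> i < n (Suc j)) \<longleftrightarrow> j = m"
    by (rule step_index)
  have "(\<Sum>j=1..k. (s k * s j / (1 + s k - s j)) * (if n j \<le> i \<and> (j < k \<longrightarrow> i < n (Suc j)) then 1 else 0)) =
     (\<Sum>j=1..k. if j = m then s k * s j / (1 + s k - s j) else 0)"
    using m(4) by (intro sum.cong refl) auto
  \<comment> \<open>For m = 0 the index lies outside the range of summation and the sum is 0, in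
    agreement with s 0 = 0.\<close>
  also have "\<dots> = s k * s m / (1 + s k - s m)"
    using m(1) s0 by (cases "m = 0") (auto simp: sum.delta)
  finally show ?thesis by (simp add: m(3))
next
  case False
  have "\<not> n j \<le> i" if "j \<le> k" for j using n_nonneg[OF that] False by linarith
  then have "(\<Sum>j=1..k. (s k * s j / (1 + s k - s j)) * (if n j \<le> i \<and> (j < k \<longrightarrow> i < n (Suc j)) then 1 else 0)) = 0"
    by (intro sum.neutral) auto
  then show ?thesis using step_value_neg[of i] False by simp
qed

lemma prod_blocks:
  assumes "m \<le> k"
  shows "(\<Prod>i\<in>{0..<n m}. h (step_value i)) = (\<Prod>j<m. h (s j) powi (n (Suc j) - n j) :: complex)"
  using assms
proof (induction m)
  case 0
  then show ?case by (simp add: n0)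
next
  case (Suc m)
  then have m: "m < k" by simp
  have le: "0 \<le> n m" "n m \<le> n (Suc m)" using n_nonneg[of m] n_mono m by auto
  have d: "step_value i = s m" if "i \<in> {n m..<n (Suc m)}" for i
  proof -
    have "0 \<le> i" using that le by simp
    then obtain m' where m': "m' \<le> k" "n m' \<le> i" "step_value i = s m'"
      "\<forall>j\<le>k. n j \<le> i \<and> (j < k \<longrightarrow> i < n (Suc j)) \<longleftrightarrow> j = m'"
      by (rule step_index)
    have "m = m'" using spec[OF m'(4), of m] that m by auto
    with m' show ?thesis by simp
  qed
  have "(\<Prod>i\<in>{0..<n (Suc m)}. h (step_value i)) = (\<Prod>i\<in>{0..<n m}. h (step_value i)) * (\<Prod>i\<in>{n m..<n (Suc m)}. h (step_value i))"
    using le by (subst prod.union_disjoint[symmetric]) (auto simp: ivl_disj_un intro!: prod.cong)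
  also have "(\<Prod>i\<in>{n m..<n (Suc m)}. h (step_value i)) = h (s m) ^ nat (n (Suc m) - n m)"
    by (simp add: d)
  also have "\<dots> = h (s m) powi (n (Suc m) - n m)"
    using le by (simp add: power_int_def)
  finally show ?case using Suc by simp
qed

end

lemma ent_sum: "ent (\<Sum>x\<in>A. F x) i j = (\<Sum>x\<in>A. ent (F x) i j)"
  by (induction A rule: infinite_finite_induct) simp_all

theorem theorem2p6:
  fixes \<phi> :: "complex \<Rightarrow> complex"
    and k :: nat
    and n :: "nat \<Rightarrow> int"
    and s :: "nat \<Rightarrow> complex"
  assumes cont: "continuous_on (sphere 0 1) \<phi>"
    and nonzero: "\<forall>z\<in>sphere 0 1. \<phi> z \<noteq> 0"
    and coeff: "(\<lambda>j::int. norm (of_int j * fourier_coeff \<phi> j)) summable_on UNIV"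
    and n0: "n 0 = 0"
    and n_mono: "\<forall>j<k. n j \<le> n (Suc j)"
    and s0: "s 0 = 0"
    and sk: "s k \<noteq> -1"
    and skj: "\<forall>j\<le>k. s k - s j \<noteq> -1"
  shows "fredholm_det_circle
           (\<lambda>z w. - (\<Sum>j=1..k. (s j - s (j - 1)) * K_kernel \<phi> (n j) z w))
         = (1 + s k) powi (wind \<phi>)
           * (\<Prod>j<k. (1 + s k - s j) powi (n (Suc j) - n j))
           * fredholm_det_l2
               (\<lambda>a b. - ((\<Sum>j=1..k. (s k * s j / (1 + s k - s j))
                            * (if n j \<le> a \<and> (j < k \<longrightarrow> a < n (Suc j)) then 1 else 0))
                          * S_matrix \<phi> a b))"
proof -
  interpret circle_symbol \<phi> by standard (fact cont nonzero coeff)+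
  interpret st: step_data k n s by standard (fact n0 n_mono s0)+
  define d where "d = st.step_value"
  note d_facts = st.step_value_neg[folded d_def] st.step_value_large[folded d_def] st.finite_range_step_value[folded d_def]
  have nz: "1 + s k - d i \<noteq> 0" for i
  proof -
    obtain m where "m \<le> k" "d i = s m" using st.step_value_in[of i] unfolding d_def by auto
    then show ?thesis using skj by (auto simp: add_eq_0_iff algebra_simps)
  qed
  have s1: "1 + s k \<noteq> 0" using sk by (simp add: add_eq_0_iff)
  have bd: "bounded (range d)" using d_facts(3) by (rule finite_imp_bounded)
  let ?c = "\<lambda>j. s j - s (j - 1)"
  define T where "T = 1 + diag_op (\<lambda>i. if i < 0 then 0 else s k) - sp.Phi * diag_op d * sp.Phii"
  have sum_c: "(\<Sum>j=1..k. ?c j) = s k"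
    using s0 by (induction k) (auto simp: sum.nat_ivl_Suc')
  \<comment> \<open>The increments resum: with weights s_j - s_(j-1) the projections P_(n_j) add up
    to D, and the weights themselves telescope to s_k, which multiplies P.\<close>
  have Tsum: "T - 1 = (\<Sum>j=1..k. diag_op (\<lambda>_. - ?c j) * kernel_op (n j))"
  proof -
    have "(\<Sum>j=1..k. diag_op (\<lambda>_. - ?c j) * kernel_op (n j)) =
      sp.Phi * (\<Sum>j=1..k. diag_op (\<lambda>_. - ?c j) * proj_ge (n j)) * sp.Phii - (\<Sum>j=1..k. diag_op (\<lambda>_. - ?c j)) * proj_ge 0"
      unfolding sum_distrib_left sum_distrib_right sum_subtractf[symmetric] kernel_op_def
    proof (rule sum.cong[OF refl])
      fix j
      have "diag_op (\<lambda>_. - ?c j) * (sp.Phi * proj_ge (n j) * sp.Phii) = sp.Phi * (diag_op (\<lambda>_. - ?c j) * proj_ge (n j)) * sp.Phii"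
        by (metis diag_op_const_commute mult.assoc)
      then show "diag_op (\<lambda>_. - ?c j) * (sp.Phi * proj_ge (n j) * sp.Phii - proj_ge 0) =
          sp.Phi * (diag_op (\<lambda>_. - ?c j) * proj_ge (n j)) * sp.Phii - diag_op (\<lambda>_. - ?c j) * proj_ge 0"
        by (simp only: right_diff_distrib)
    qed
    moreover have "(\<Sum>j=1..k. diag_op (\<lambda>_. - ?c j) * proj_ge (n j)) = - diag_op d"
    proof (rule schur_eqI)
      fix i j
      have "ent (\<Sum>j=1..k. diag_op (\<lambda>_. - ?c j) * proj_ge (n j)) i j = (\<Sum>l=1..k. - ?c l * (if i = j \<and> n l \<le> i then 1 else 0))"
        unfolding ent_sum ent_diag_op_mult(1)[OF bounded_range_const] ent_proj_ge ..
      also have "\<dots> = (if i = j then - d i else 0)"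
        unfolding d_def st.step_value_def by (auto simp: sum_negf[symmetric] intro!: sum.cong)
      finally show "ent (\<Sum>j=1..k. diag_op (\<lambda>_. - ?c j) * proj_ge (n j)) i j = ent (- diag_op d) i j"
        by (simp add: ent_diag_op[OF bd])
    qed
    moreover have "(\<Sum>j=1..k. diag_op (\<lambda>_. - ?c j)) * proj_ge 0 = - diag_op (\<lambda>i. if i < 0 then 0 else s k)"
    proof (rule schur_eqI)
      fix i j
      have "(\<Sum>j=1..k. diag_op (\<lambda>_. - ?c j)) * proj_ge 0 = (\<Sum>j=1..k. diag_op (\<lambda>_. - ?c j) * proj_ge 0)"
        by (rule sum_distrib_right)
      then have "ent ((\<Sum>j=1..k. diag_op (\<lambda>_. - ?c j)) * proj_ge 0) i j = (\<Sum>l=1..k. - ?c l) * (if i = j \<and> 0 \<le> i then 1 else 0)"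
        unfolding sum_distrib_right by (simp only: ent_sum ent_diag_op_mult(1)[OF bounded_range_const] ent_proj_ge)
      also have "(\<Sum>l=1..k. - ?c l) = - s k" unfolding sum_negf sum_c ..
      finally show "ent ((\<Sum>j=1..k. diag_op (\<lambda>_. - ?c j)) * proj_ge 0) i j = ent (- diag_op (\<lambda>i. if i < 0 then 0 else s k)) i j"
        by (simp add: ent_diag_op[OF bounded_range_sign0])
    qed
    ultimately show ?thesis by (simp add: T_def)
  qed
  have tcT: "tc1 T"
  proof -
    have "tc (ent (\<Sum>j\<in>A. diag_op (\<lambda>_. - ?c j) * kernel_op (n j)))" for A
      by (induction A rule: infinite_finite_induct) (simp_all add: tc_kernel_op del: ent_simps)
    then show ?thesis unfolding Tsum .
  qed
  have "fredholm_det_circle (\<lambda>z w. - (\<Sum>j=1..k. ?c j * K_kernel \<phi> (n j) z w)) = det1 T"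
    unfolding det1_def
  proof (rule fredholm_det_circle_eq_l2[OF tcT])
    fix u v
    \<comment> \<open>Linearity of the kernel in the matrix, by induction because each addition has
      to know that both matrices are summable.\<close>
    have ser: "double_sum (ent (\<Sum>j\<in>A. diag_op (\<lambda>_. - ?c j) * kernel_op (n j))) (cis u) (cis v) =
        (\<Sum>j\<in>A. - ?c j * double_sum (ent (kernel_op (n j))) (cis u) (cis v))" if "finite A" for A
      using that
    proof (induction A)
      case empty
      show ?case by (simp add: double_sum_def case_prod_unfold)
    next
      case (insert x A)
      have "tc (ent (\<Sum>j\<in>A. diag_op (\<lambda>_. - ?c j) * kernel_op (n j)))" for A
        by (induction A rule: infinite_finite_induct) (simp_all add: tc_kernel_op del: ent_simps)
      then have "double_sum (\<lambda>i j. ent (diag_op (\<lambda>_. - ?c x) * kernel_op (n x)) i j + ent (\<Sum>j\<in>A. diag_op (\<lambda>_. - ?c j) * kernel_op (n j)) i j) (cis u) (cis v) =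
         double_sum (ent (diag_op (\<lambda>_. - ?c x) * kernel_op (n x))) (cis u) (cis v) + double_sum (ent (\<Sum>j\<in>A. diag_op (\<lambda>_. - ?c j) * kernel_op (n j))) (cis u) (cis v)"
        by (intro double_sum_add tc_mult_left tc_kernel_op) simp_all
      moreover have "double_sum (ent (diag_op (\<lambda>_. - ?c x) * kernel_op (n x))) (cis u) (cis v) = - ?c x * double_sum (ent (kernel_op (n x))) (cis u) (cis v)"
        unfolding double_sum_cmult[symmetric]
        by (rule arg_cong[where f = "\<lambda>k. double_sum k (cis u) (cis v)"]) (simp add: fun_eq_iff ent_diag_op_mult(1)[OF bounded_range_const])
      moreover have "ent (\<Sum>j\<in>insert x A. diag_op (\<lambda>_. - ?c j) * kernel_op (n j)) =
          (\<lambda>i j. ent (diag_op (\<lambda>_. - ?c x) * kernel_op (n x)) i j + ent (\<Sum>j\<in>A. diag_op (\<lambda>_. - ?c j) * kernel_op (n j)) i j)"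
        using insert by (simp add: fun_eq_iff)
      ultimately show ?case using insert by simp
    qed
    let ?X = "\<lambda>j. double_sum (ent (kernel_op (n j))) (cis u) (cis v)" and ?p = "2 * of_real pi * \<i>"
    have "(\<Sum>j=1..k. ?c j * K_kernel \<phi> (n j) (cis u) (cis v)) = (\<Sum>j=1..k. ?c j * (?X j / ?p))"
      by (intro sum.cong refl) (simp add: K_kernel_eq_double_sum st.n_nonneg)
    also have "- \<dots> = (\<Sum>j=1..k. - ?c j * ?X j) / ?p"
      by (simp only: mult_minus_left sum_negf minus_divide_left[symmetric] sum_divide_distrib times_divide_eq_right)
    also have "\<dots> = double_sum (ent (T - 1)) (cis u) (cis v) / ?p"
      unfolding Tsum ser[OF finite_atLeastAtMost] ..
    finally have "- (\<Sum>j=1..k. ?c j * K_kernel \<phi> (n j) (cis u) (cis v)) = double_sum (ent (T - 1)) (cis u) (cis v) / ?p" .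
    then show "- (\<Sum>j=1..k. ?c j * K_kernel \<phi> (n j) (cis u) (cis v)) =
        (\<Sum>\<^sub>\<infinity>(i, j). ent (T - 1) i j * cis u powi i * cis v powi (- j - 1)) / (2 * of_real pi * \<i>)"
      unfolding double_sum_def .
  qed
  also have "det1 T = (1 + s k) powi (wind \<phi>) * (\<Prod>i\<in>{0..<n k}. 1 + s k - d i) *
      det1 (1 - diag_op (\<lambda>i. s k * d i / (1 + s k - d i)) * (sp.Phii * proj_neg * sp.Phi))"
    unfolding T_def
    by (rule sp.det1_factorization[OF log_residue_eq_wind d_facts(3) s1 d_facts(1,2) nz st.n_nonneg[OF order_refl]])
  also have "(\<Prod>i\<in>{0..<n k}. 1 + s k - d i) = (\<Prod>j<k. (1 + s k - s j) powi (n (Suc j) - n j))"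
    unfolding d_def by (rule st.prod_blocks[OF order_refl])
  also have "det1 (1 - diag_op (\<lambda>i. s k * d i / (1 + s k - d i)) * (sp.Phii * proj_neg * sp.Phi)) =
      fredholm_det_l2
               (\<lambda>a b. - ((\<Sum>j=1..k. (s k * s j / (1 + s k - s j))
                            * (if n j \<le> a \<and> (j < k \<longrightarrow> a < n (Suc j)) then 1 else 0))
                          * S_matrix \<phi> a b))"
  proof -
    have b: "bounded (range (\<lambda>i. s k * d i / (1 + s k - d i)))"
      using bounded_range_sign[OF d_facts(3), of "\<lambda>_ x. s k * x / (1 + s k - x)"] .
    show ?thesis
      unfolding det1_def st.step_value_quotient d_def[symmetric]
      by (rule arg_cong[where f = fredholm_det_l2]) (simp add: fun_eq_iff ent_diag_op_mult(1)[OF b] ent_S)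
  qed
  finally show ?thesis .
qed

end
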